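(* Let $n\ge 2$ and $l\ge 1$ be integers, let $\Omega$ be a bounded domain in $\mathbb{R}^n$, and let $\lambda_j$ denote the $j$-th eigenvalue of the Dirichlet problem for the poly-Laplacian $$(-\Delta)^l u=\lambda u \ \text{ on } \Omega,\qquad u|_{\partial\Omega}=\frac{\partial u}{\partial \nu}\Big|_{\partial\Omega}=\cdots=\frac{\partial^{l-1}u}{\partial\nu^{l-1}}\Big|_{\partial\Omega}=0 .$$ Then there is a sequence $\varepsilon_n(k)$, $k\ge 1$, with $\varepsilon_n(k)\ge 0$ and $\varepsilon_n(k)=O(k^{-2/n})$ as $k\to\infty$, such that for every integer $k\ge 1$ $$\frac1k\sum_{j=1}^k\lambda_j\ \ge\ \frac{n}{n+2l}\,\frac{(2\pi)^{2l}}{(\omega_n V(\Omega))^{\frac{2l}{n}}}\,k^{\frac{2l}{n}}+\frac{nl}{48}\,\frac{(2\pi)^{2l-2}}{(\omega_n V(\Omega))^{\frac{2l-2}{n}}}\,\frac{V(\Omega)}{I(\Omega)}\,k^{\frac{2l-2}{n}}\bigl(1-\varepsilon_n(k)\bigr).$$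
   Context: $\omega_n$ is the volume of the unit ball in $\mathbb{R}^n$; $V(\Omega)$ is the volume of $\Omega$; $I(\Omega)=\min_{c\in\mathbb{R}^n}\int_\Omega |x-c|^2\,dx$ is the moment of inertia of $\Omega$. $\Delta$ is the Laplacian and $\nu$ is the outward unit normal vector field of $\partial\Omega$. The problem has a real discrete spectrum $0<\lambda_1\le\lambda_2\le\cdots\to\infty$, each eigenvalue being repeated according to its multiplicity. (For a general bounded domain the eigenvalue problem is understood in the usual weak sense, in the Sobolev space $H_0^l(\Omega)$.) The sequence $\varepsilon_n(k)$ is for the given $n,l,\Omega$. *)

theory Defs
  imports "HOL-Analysis.Analysis" "HOL-Library.Landau_Symbols"
begin

definition partial :: "'n::finite \<Rightarrow> (real ^ 'n \<Rightarrow> real) \<Rightarrow> real ^ 'n \<Rightarrow> real" where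
  "partial i f x = frechet_derivative f (at x) (axis i 1)"

text \<open>
  A word \<open>w = [i\<^sub>1, \<dots>, i\<^sub>m]\<close> of coordinate indices stands for the derivative
  \<open>\<partial>\<^sub>i\<^sub>1 \<dots> \<partial>\<^sub>i\<^sub>m\<close> of order \<open>length w\<close>. Words are used instead of multi-indices; different
  words may therefore denote the same derivative.
\<close>

definition partials :: "'n::finite list \<Rightarrow> (real ^ 'n \<Rightarrow> real) \<Rightarrow> real ^ 'n \<Rightarrow> real" where
  "partials w f = foldr partial w f"

definition smooth_fun :: "(real ^ 'n::finite \<Rightarrow> real) \<Rightarrow> bool" where
  "smooth_fun f \<longleftrightarrow> (\<forall>w x. partials w f differentiable (at x))"

definition test_functions :: "(real ^ 'n::finite) set \<Rightarrow> (real ^ 'n \<Rightarrow> real) set" where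
  "test_functions \<Omega> =
     {\<phi>. smooth_fun \<phi> \<and> compact (closure {x. \<phi> x \<noteq> 0}) \<and> closure {x. \<phi> x \<noteq> 0} \<subseteq> \<Omega>}"

definition L2_functions :: "(real ^ 'n::finite) set \<Rightarrow> (real ^ 'n \<Rightarrow> real) set" where
  "L2_functions \<Omega> =
     {u \<in> borel_measurable (lebesgue_on \<Omega>). integrable (lebesgue_on \<Omega>) (\<lambda>x. (u x)\<^sup>2)}"

definition has_weak_derivative ::
  "(real ^ 'n::finite) set \<Rightarrow> 'n list \<Rightarrow> (real ^ 'n \<Rightarrow> real) \<Rightarrow> (real ^ 'n \<Rightarrow> real) \<Rightarrow> bool" where
  "has_weak_derivative \<Omega> w u g \<longleftrightarrow>
     (\<forall>\<phi>\<in>test_functions \<Omega>.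
        (LINT x|lebesgue_on \<Omega>. u x * partials w \<phi> x) =
        (-1) ^ length w * (LINT x|lebesgue_on \<Omega>. g x * \<phi> x))"

text \<open>The Sobolev space \<open>H\<^sup>l(\<Omega>) = W\<^sup>l\<^sup>,\<^sup>2(\<Omega>)\<close>; elements are functions, not classes modulo null sets.\<close>

definition sobolev :: "nat \<Rightarrow> (real ^ 'n::finite) set \<Rightarrow> (real ^ 'n \<Rightarrow> real) set" where
  "sobolev l \<Omega> =
     {u \<in> L2_functions \<Omega>. \<forall>w. length w \<le> l \<longrightarrow> (\<exists>g\<in>L2_functions \<Omega>. has_weak_derivative \<Omega> w u g)}"

text \<open>
  On an open set a weak derivative is unique up to a null set, so the integrals below do not
  depend on the chosen representative.
\<close>

definition weak_derivative ::
  "(real ^ 'n::finite) set \<Rightarrow> 'n list \<Rightarrow> (real ^ 'n \<Rightarrow> real) \<Rightarrow> real ^ 'n \<Rightarrow> real" where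
  "weak_derivative \<Omega> w u = (SOME g. g \<in> L2_functions \<Omega> \<and> has_weak_derivative \<Omega> w u g)"

text \<open>\<open>H\<^sub>0\<^sup>l(\<Omega>)\<close>: the closure of the test functions in the norm of \<open>H\<^sup>l(\<Omega>)\<close>.\<close>

definition sobolev0 :: "nat \<Rightarrow> (real ^ 'n::finite) set \<Rightarrow> (real ^ 'n \<Rightarrow> real) set" where
  "sobolev0 l \<Omega> =
     {u \<in> sobolev l \<Omega>. \<exists>\<phi>. range \<phi> \<subseteq> test_functions \<Omega> \<and>
        (\<forall>w. length w \<le> l \<longrightarrow>
           (\<lambda>m::nat. LINT x|lebesgue_on \<Omega>. (partials w (\<phi> m) x - weak_derivative \<Omega> w u x)\<^sup>2)
             \<longlonglongrightarrow> 0)}"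

text \<open>
  The bilinear form of \<open>(-\<Delta>)\<^sup>l\<close>. Expanding the power of the Laplacian,
  \<open>(-\<Delta>)\<^sup>l = (-1)\<^sup>l \<Sum>\<^sub>w \<partial>\<^sup>w \<partial>\<^sup>w\<close> with \<open>w\<close> ranging over all words of length \<open>l\<close>
  (each multi-index \<open>\<alpha>\<close> of order \<open>l\<close> occurs \<open>l!/\<alpha>!\<close> times), and moving one factor \<open>\<partial>\<^sup>w\<close> to \<open>v\<close>
  by parts gives the form below.
\<close>

definition polylaplace_form ::
  "nat \<Rightarrow> (real ^ 'n::finite) set \<Rightarrow> (real ^ 'n \<Rightarrow> real) \<Rightarrow> (real ^ 'n \<Rightarrow> real) \<Rightarrow> real" where
  "polylaplace_form l \<Omega> u v =
     (\<Sum>w\<in>{w. length w = l}.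
        LINT x|lebesgue_on \<Omega>. weak_derivative \<Omega> w u x * weak_derivative \<Omega> w v x)"

definition dirichlet_eigenspace ::
  "nat \<Rightarrow> (real ^ 'n::finite) set \<Rightarrow> real \<Rightarrow> (real ^ 'n \<Rightarrow> real) set" where
  "dirichlet_eigenspace l \<Omega> t =
     {u \<in> sobolev0 l \<Omega>. \<forall>v\<in>sobolev0 l \<Omega>.
        polylaplace_form l \<Omega> u v = t * (LINT x|lebesgue_on \<Omega>. u x * v x)}"

text \<open>
  \<open>m\<close> is the dimension of the eigenspace of \<open>t\<close> modulo almost everywhere equality: there is a
  basis with \<open>m\<close> elements. If \<open>t\<close> is not an eigenvalue, this holds exactly for \<open>m = 0\<close>.
\<close>

definition has_multiplicity ::
  "nat \<Rightarrow> (real ^ 'n::finite) set \<Rightarrow> real \<Rightarrow> nat \<Rightarrow> bool" where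
  "has_multiplicity l \<Omega> t m \<longleftrightarrow>
     (\<exists>u :: nat \<Rightarrow> real ^ 'n \<Rightarrow> real.
        (\<forall>i<m. u i \<in> dirichlet_eigenspace l \<Omega> t) \<and>
        (\<forall>c :: nat \<Rightarrow> real.
           (AE x in lebesgue_on \<Omega>. (\<Sum>i<m. c i * u i x) = 0) \<longrightarrow> (\<forall>i<m. c i = 0)) \<and>
        (\<forall>v\<in>dirichlet_eigenspace l \<Omega> t. \<exists>c :: nat \<Rightarrow> real.
           AE x in lebesgue_on \<Omega>. v x = (\<Sum>i<m. c i * u i x)))"

text \<open>
  \<open>\<lambda>\<^sub>1 \<le> \<lambda>\<^sub>2 \<le> \<dots> \<rightarrow> \<infinity>\<close> lists all eigenvalues with multiplicity; the value at index \<open>0\<close> is irrelevant.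
  Divergence makes the index sets in the last clause finite, so that \<^const>\<open>card\<close> is meaningful.
\<close>

definition dirichlet_eigenvalues ::
  "nat \<Rightarrow> (real ^ 'n::finite) set \<Rightarrow> (nat \<Rightarrow> real) \<Rightarrow> bool" where
  "dirichlet_eigenvalues l \<Omega> lam \<longleftrightarrow>
     mono_on {1..} lam \<and> filterlim lam at_top sequentially \<and>
     (\<forall>t. has_multiplicity l \<Omega> t (card {j. 1 \<le> j \<and> lam j = t}))"

definition volume :: "(real ^ 'n::finite) set \<Rightarrow> real" where
  "volume \<Omega> = measure lebesgue \<Omega>"

definition moment_of_inertia :: "(real ^ 'n::finite) set \<Rightarrow> real" where
  "moment_of_inertia \<Omega> = (INF c. LINT x|lebesgue_on \<Omega>. (norm (x - c))\<^sup>2)"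

end

(*
Let v_1, ..., v_k be orthonormal eigenfunctions for lam_1, ..., lam_k and let
G(xi) = |F v_1(xi)|^2 + ... + |F v_k(xi)|^2 with the unnormalised Fourier transform F on Omega.
Bessel's inequality for exp(-i xi.x) gives 0 <= G <= V, and Bessel's inequality for differences
of such exponentials, centred at an arbitrary point, shows that G has Lipschitz constant
L = 2 sqrt(V I). Plancherel's formula, applied to approximating test functions, turns the
quadratic forms of the eigenfunctions into
  integral of (|xi|^(2l) - mu) G over a ball of radius T  <=  (2 pi)^n (sum lam_j - mu k)
whenever mu <= T^(2l). Among all densities with these bounds the left side is smallest for a
truncated cone: the value V near the origin, followed by a slope -L down to 0, if mu is the mean
of |xi|^(2l) over the slope. This is checked on rays, without rearrangement.
The mean radius of the slope is taken to be kappa = 2 pi (k / (omega_n V))^(1/n). The optimal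
choice, for which the cone has integral (2 pi)^n k, differs from it by a relative error of order
kappa^(-2), which affects the bound only to relative order kappa^(-4). Expanding the bound, a
rational function of 1/kappa, to that order gives both terms.
*)

theory Submission
  imports Defs "HOL-Probability.Characteristic_Functions"
begin

text \<open>The number mu acts as a Lagrange multiplier for the total mass of G. A bound of this
  kind therefore holds for every admissible position of the slope, and an explicit radius can be
  used instead of the root of the mass equation. Working on a ball means that the passage from test
  functions to H_0^l needs only bounded convergence. No decay of the Fourier transform of an
  eigenfunction is required, because outside the ball the weight is nonnegative and its contribution
  is dropped already for test functions. The constant 48 is 3 * 4 * 4: the slope has width delta = V
  / L with delta^2 = V / (4 I), its half width relative to kappa is h = delta / (2 kappa), and the
  second term of the expansion is n l h^2 / 3. The cone makes sense only while its slope stays away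
  from the origin (h < 1), that is, for large k. The error sequence is therefore defined as the
  relative deficit of the claimed bound, cut off at 0. The inequality then holds for every k by
  construction, and only the decay for large k has to be proved.\<close>

section \<open>Smooth bump functions\<close>

lemma partial_eq:
  assumes "(f has_derivative f') (at x)"
  shows "partial i f x = f' (axis i 1)"
  using frechet_derivative_at[OF assms] by (simp add: partial_def)

lemma partials_append: "partials (v @ w) f = partials v (partials w f)"
  by (simp add: partials_def)

lemma partials_Cons: "partials (i # w) f = partial i (partials w f)"
  by (simp add: partials_def)

lemma partials_Nil [simp]: "partials [] f = f"
  by (simp add: partials_def)

text \<open>The classical flat function exp(-1/x) together with its quotients by powers of x. The
  parameter \<open>m\<close> makes the family closed under differentiation up to linear
  combinations, so one derivative formula covers all orders.\<close>

definition flat :: "nat \<Rightarrow> real \<Rightarrow> real" where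
  "flat m x = (if x > 0 then exp (- 1 / x) / x ^ m else 0)"

text \<open>On the right of 0 the substitution of 1/x for x reduces this to the growth of exp
  beating every power at infinity.\<close>

lemma flat_tendsto_0: "(flat m \<longlongrightarrow> 0) (at 0)"
proof -
  have "((\<lambda>x::real. x ^ m / exp x) \<longlongrightarrow> 0) at_top"
    by (rule tendsto_power_div_exp_0)
  then have "((\<lambda>x::real. inverse x ^ m / exp (inverse x)) \<longlongrightarrow> 0) (at_right 0)"
    by (rule filterlim_compose) (rule filterlim_inverse_at_top_right)
  then have R: "(flat m \<longlongrightarrow> 0) (at_right 0)"
    by (rule Lim_transform_eventually)
       (auto simp: eventually_at_filter flat_def exp_minus field_simps)
  have "(flat m \<longlongrightarrow> 0) (at_left 0)"
    by (rule Lim_transform_eventually[OF tendsto_const])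
       (auto simp: eventually_at_filter flat_def)
  with R show ?thesis
    by (simp add: filterlim_split_at)
qed

lemma DERIV_flat:
  "(flat m has_real_derivative flat (m + 2) x - real m * flat (m + 1) x) (at x)"
proof -
  consider "x > 0" | "x < 0" | "x = 0" by linarith
  then show ?thesis
  proof cases
    case 1
    have "((\<lambda>x. exp (- 1 / x) / x ^ m) has_real_derivative
        flat (m + 2) x - real m * flat (m + 1) x) (at x)"
      using 1
      by (auto intro!: derivative_eq_intros simp: flat_def)
         (cases m; simp add: field_simps power2_eq_square)
    then show ?thesis
    proof (rule has_field_derivative_transform_within_open[of _ _ _ "{0<..}"])
    qed (use 1 in \<open>auto simp: flat_def\<close>)
  next
    case 2
    have "((\<lambda>x. 0) has_real_derivative 0) (at x)" by simp
    then have "(flat m has_real_derivative 0) (at x)"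
    proof (rule has_field_derivative_transform_within_open[of _ _ _ "{..<0}"])
    qed (use 2 in \<open>auto simp: flat_def\<close>)
    with 2 show ?thesis by (simp add: flat_def)
  next
    case 3
    have "((\<lambda>h. (flat m (0 + h) - flat m 0) / h) \<longlongrightarrow> 0) (at 0)"
      by (rule Lim_transform_eventually[OF flat_tendsto_0[of "Suc m"]])
         (auto simp: eventually_at_filter flat_def)
    then show ?thesis using 3 by (simp add: DERIV_def flat_def)
  qed
qed

text \<open>An algebra of functions that is closed under partial derivatives and contains enough bumps.\<close>

inductive_set bump_algebra :: "(real ^ 'n::finite \<Rightarrow> real) set" where
  const: "(\<lambda>x. c) \<in> bump_algebra"
| flat: "(\<lambda>x. flat m (a + c * x $ i)) \<in> bump_algebra"
| add: "f \<in> bump_algebra \<Longrightarrow> g \<in> bump_algebra \<Longrightarrow> (\<lambda>x. f x + g x) \<in> bump_algebra"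
| mult: "f \<in> bump_algebra \<Longrightarrow> g \<in> bump_algebra \<Longrightarrow> (\<lambda>x. f x * g x) \<in> bump_algebra"
| exp: "f \<in> bump_algebra \<Longrightarrow> (\<lambda>x. exp (f x)) \<in> bump_algebra"

text \<open>The induction carries a gradient whose entries again lie in the algebra. Smoothness then
  follows by iterating the first derivative along a word, without any formula for higher
  derivatives.\<close>

lemma bump_algebra_has_derivative:
  fixes f :: "real ^ 'n::finite \<Rightarrow> real"
  assumes "f \<in> bump_algebra"
  shows "\<exists>D. (\<forall>i. D i \<in> bump_algebra) \<and>
    (\<forall>x. (f has_derivative (\<lambda>h. \<Sum>i\<in>UNIV. h $ i * D i x)) (at x))"
  using assms
proof induction
  case (const c)
  show ?case
    by (rule exI[of _ "\<lambda>i x. 0"]) (auto intro: bump_algebra.const)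
next
  case (flat m a c j)
  let ?d = "\<lambda>x::real^'n. flat (m + 2) (a + c * x $ j) + (- real m) * flat (m + 1) (a + c * x $ j)"
  have d: "?d \<in> bump_algebra"
    by (intro bump_algebra.intros)
  show ?case
  proof (rule exI[of _ "\<lambda>i x. (if i = j then c else 0) * ?d x"], intro conjI allI)
    fix i show "(\<lambda>x. (if i = j then c else 0) * ?d x) \<in> bump_algebra"
      using d by (intro bump_algebra.mult bump_algebra.const)
  next
    fix x :: "real^'n"
    have "((\<lambda>x. a + c * x $ j) has_derivative (\<lambda>h. c * h $ j)) (at x)"
      by (auto intro!: derivative_eq_intros bounded_linear_imp_has_derivative bounded_linear_vec_nth)
    from has_derivative_compose[OF this DERIV_flat[of m, unfolded has_field_derivative_def]]
    have "((\<lambda>x. flat m (a + c * x $ j)) has_derivative (\<lambda>h. ?d x * (c * h $ j))) (at x)"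
      by (simp add: mult.commute)
    moreover have "(\<lambda>h. ?d x * (c * h $ j)) = (\<lambda>h. \<Sum>i\<in>UNIV. h $ i * ((if i = j then c else 0) * ?d x))"
      by (auto simp: fun_eq_iff if_distrib[of "\<lambda>u. _ * (u * _)"] sum.delta cong: if_cong)
    ultimately show "((\<lambda>x. flat m (a + c * x $ j)) has_derivative
        (\<lambda>h. \<Sum>i\<in>UNIV. h $ i * ((if i = j then c else 0) * ?d x))) (at x)"
      by simp
  qed
next
  case (add f g)
  then obtain D E where "\<forall>i. D i \<in> bump_algebra" "\<forall>i. E i \<in> bump_algebra"
    and D: "\<And>x. (f has_derivative (\<lambda>h. \<Sum>i\<in>UNIV. h $ i * D i x)) (at x)"
    and E: "\<And>x. (g has_derivative (\<lambda>h. \<Sum>i\<in>UNIV. h $ i * E i x)) (at x)" by blast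
  then show ?case
    by (intro exI[of _ "\<lambda>i x. D i x + E i x"] conjI allI bump_algebra.add)
       (auto intro!: derivative_eq_intros D E simp: algebra_simps sum.distrib)
next
  case (mult f g)
  then obtain D E where "\<forall>i. D i \<in> bump_algebra" "\<forall>i. E i \<in> bump_algebra"
    and D: "\<And>x. (f has_derivative (\<lambda>h. \<Sum>i\<in>UNIV. h $ i * D i x)) (at x)"
    and E: "\<And>x. (g has_derivative (\<lambda>h. \<Sum>i\<in>UNIV. h $ i * E i x)) (at x)" by blast
  with mult.hyps show ?case
    by (intro exI[of _ "\<lambda>i x. f x * E i x + D i x * g x"] conjI allI bump_algebra.add bump_algebra.mult)
       (auto intro!: derivative_eq_intros D E
             simp: algebra_simps sum.distrib sum_distrib_left sum_distrib_right)
next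
  case (exp f)
  then obtain D where "\<forall>i. D i \<in> bump_algebra"
    and D: "\<And>x. (f has_derivative (\<lambda>h. \<Sum>i\<in>UNIV. h $ i * D i x)) (at x)" by blast
  with exp.hyps show ?case
    by (intro exI[of _ "\<lambda>i x. exp (f x) * D i x"] conjI allI bump_algebra.mult bump_algebra.exp)
       (auto intro!: derivative_eq_intros D 
             simp: algebra_simps sum.distrib sum_distrib_left sum_distrib_right)
qed

lemma partial_bump_algebra:
  fixes f :: "real ^ 'n::finite \<Rightarrow> real"
  assumes "f \<in> bump_algebra"
  shows "partial i f \<in> bump_algebra"
proof -
  obtain D where D: "\<And>i. D i \<in> bump_algebra"
    "\<And>x. (f has_derivative (\<lambda>h. \<Sum>i\<in>UNIV. h $ i * D i x)) (at x)"
    using bump_algebra_has_derivative[OF assms] by blast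
  have "partial i f = D i"
    by (auto simp: fun_eq_iff partial_eq[OF D(2)] axis_def if_distrib[of "\<lambda>u. u * _"] sum.delta cong: if_cong)
  with D(1) show ?thesis by simp
qed

lemma smooth_bump_algebra:
  assumes "f \<in> bump_algebra"
  shows "smooth_fun f"
proof -
  have "partials w f \<in> bump_algebra" for w
    by (induction w) (use assms in \<open>auto simp: partials_Cons intro: partial_bump_algebra\<close>)
  then show ?thesis
    using bump_algebra_has_derivative unfolding smooth_fun_def differentiable_def by blast
qed

lemma box_bump_exists:
  fixes a b :: "real ^ 'n::finite"
  shows "\<exists>\<theta>\<in>bump_algebra. (\<forall>x. \<theta> x \<ge> 0) \<and> (\<forall>x. \<theta> x > 0 \<longleftrightarrow> x \<in> box a b)"
proof -
  \<comment> \<open>Two flat factors per coordinate, one for each face of the box. The affine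
    arguments are spelled out so that they match the generating functions of the algebra.\<close>
  let ?\<theta> = "\<lambda>J (x::real^'n). \<Prod>i\<in>J. flat 0 (- (a $ i) + 1 * x $ i) * flat 0 (b $ i + (-1) * x $ i)"
  have "?\<theta> J \<in> bump_algebra" if "finite J" for J
    using that
  proof induction
    case empty
    show ?case by (simp add: bump_algebra.const)
  next
    case (insert i J)
    have "(\<lambda>x. (flat 0 (- (a $ i) + 1 * x $ i) * flat 0 (b $ i + (-1) * x $ i)) * ?\<theta> J x) \<in> bump_algebra"
      using insert.IH by (intro bump_algebra.mult bump_algebra.flat)
    with insert.hyps show ?case by simp
  qed
  then have S: "?\<theta> UNIV \<in> bump_algebra" by simp
  have nn: "flat 0 t \<ge> 0" "flat 0 t > 0 \<longleftrightarrow> t > 0" for t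
    by (auto simp: flat_def)
  have "?\<theta> UNIV x \<ge> 0" for x
    by (intro prod_nonneg ballI mult_nonneg_nonneg nn)
  moreover have "?\<theta> UNIV x > 0 \<longleftrightarrow> x \<in> box a b" for x
  proof
    assume "?\<theta> UNIV x > 0"
    then have "?\<theta> UNIV x \<noteq> 0" by linarith
    then have "flat 0 (- (a $ i) + 1 * x $ i) \<noteq> 0 \<and> flat 0 (b $ i + (-1) * x $ i) \<noteq> 0" for i
      by (simp add: prod_zero_iff)
    moreover have "flat 0 t \<noteq> 0 \<Longrightarrow> t > 0" for t
      by (simp add: flat_def split: if_splits)
    ultimately have "- (a $ i) + 1 * x $ i > 0 \<and> b $ i + (-1) * x $ i > 0" for i
      by blast
    then show "x \<in> box a b" by (simp add: mem_box_cart)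
  next
    assume "x \<in> box a b"
    then show "?\<theta> UNIV x > 0"
      by (intro prod_pos ballI mult_pos_pos) (auto simp: nn mem_box_cart)
  qed
  ultimately have "(\<forall>x. ?\<theta> UNIV x \<ge> 0) \<and> (\<forall>x. ?\<theta> UNIV x > 0 \<longleftrightarrow> x \<in> box a b)"
    by (intro conjI allI)
  then show ?thesis by (rule bexI[OF _ S])
qed

text \<open>The functions \<open>1 - exp (- m \<theta>)\<close> for a bump \<open>\<theta>\<close> of the box.\<close>

lemma box_test_function_sequence:
  fixes a b :: "real ^ 'n::finite"
  assumes "cbox a b \<subseteq> \<Omega>"
  shows "\<exists>\<phi>. (\<forall>m::nat. \<phi> m \<in> test_functions \<Omega>) \<and> (\<forall>m x. 0 \<le> \<phi> m x \<and> \<phi> m x \<le> 1) \<and>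
     (\<forall>x. (\<lambda>m. \<phi> m x) \<longlonglongrightarrow> indicator (box a b) x)"
proof -
  obtain \<theta> :: "real ^ 'n \<Rightarrow> real" where \<theta>: "\<theta> \<in> bump_algebra" "\<And>x. \<theta> x \<ge> 0" "\<And>x. \<theta> x > 0 \<longleftrightarrow> x \<in> box a b"
    using box_bump_exists by blast
  \<comment> \<open>Written with sums, products and \<open>exp\<close> only, so that membership in
    the algebra, and hence smoothness, is immediate from its closure rules.\<close>
  define \<phi> where "\<phi> = (\<lambda>(m::nat) x. 1 + (-1) * exp ((- real m) * \<theta> x))"
  have "smooth_fun (\<phi> m)" for m
    unfolding \<phi>_def using \<theta>(1) by (intro smooth_bump_algebra bump_algebra.intros)
  moreover have sub: "closure {x. \<phi> m x \<noteq> 0} \<subseteq> cbox a b" for m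
  proof (rule closure_minimal)
    have "\<theta> x = 0" if "x \<notin> box a b" for x
      using \<theta>(2,3)[of x] that by linarith
    then show "{x. \<phi> m x \<noteq> 0} \<subseteq> cbox a b"
      using box_subset_cbox[of a b] by (force simp: \<phi>_def)
  qed (rule closed_cbox)
  then have "compact (closure {x. \<phi> m x \<noteq> 0})" for m
    by (metis bounded_cbox bounded_subset closed_closure compact_eq_bounded_closed)
  ultimately have "\<phi> m \<in> test_functions \<Omega>" for m
    using sub[of m] assms by (auto simp: test_functions_def)
  moreover have "0 \<le> \<phi> m x \<and> \<phi> m x \<le> 1" for m x
    using \<theta>(2)[of x] by (simp add: \<phi>_def)
  moreover have "(\<lambda>m. \<phi> m x) \<longlonglongrightarrow> indicator (box a b) x" for x
  proof (cases "x \<in> box a b")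
    case True
    then have "\<theta> x > 0" using \<theta>(3) by simp
    then have "norm (exp (- \<theta> x)) < 1" by simp
    then have "(\<lambda>m. exp (- \<theta> x) ^ m) \<longlonglongrightarrow> 0"
      by (rule LIMSEQ_power_zero)
    then have "(\<lambda>m. 1 - exp (- \<theta> x) ^ m) \<longlonglongrightarrow> 1 - 0"
      by (rule tendsto_diff[OF tendsto_const])
    with True show ?thesis
      by (simp add: \<phi>_def exp_of_nat_mult[symmetric])
  next
    case False
    then have "\<theta> x = 0" using \<theta>(2,3)[of x] by linarith
    with False show ?thesis by (simp add: \<phi>_def)
  qed
  ultimately show ?thesis by blast
qed

section \<open>The fundamental lemma of the calculus of variations\<close>

text \<open>The positive and the negative part of \<open>h\<close> are densities of two finite
  measures that agree on all open boxes. Boxes form an intersection-stable generator, so the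
  measures coincide, and so do their densities almost everywhere. The coercion
  \<open>ennreal\<close> truncates at 0, which is why \<open>?p\<close> and \<open>?m\<close> are
  these two parts.\<close>

lemma AE_eq_0_of_box_integrals:
  fixes h :: "'a::euclidean_space \<Rightarrow> real"
  assumes h: "integrable lborel h"
    and z: "\<And>a b. (LINT x|lborel. indicator (box a b) x * h x) = 0"
  shows "AE x in lborel. h x = 0"
proof -
  have [measurable]: "h \<in> borel_measurable borel"
    using h by auto
  let ?p = "\<lambda>x. ennreal (h x)" and ?m = "\<lambda>x. ennreal (- h x)"
  have eq: "emeasure (density lborel ?p) (box a b) = emeasure (density lborel ?m) (box a b)" for a b
  proof -
    let ?g = "\<lambda>x. indicator (box a b) x * h x"
    have g: "integrable lborel ?g"
      using integrable_real_mult_indicator[OF _ h, of "box a b"] by (simp add: mult.commute)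
    then have g': "integrable lborel (\<lambda>x. - ?g x)" by simp
    have fin: "(\<integral>\<^sup>+ x. ennreal (?g x) \<partial>lborel) < top" "(\<integral>\<^sup>+ x. ennreal (- ?g x) \<partial>lborel) < top"
      using g real_integrable_def[of lborel ?g] by (auto simp: less_top)
    have "enn2real (\<integral>\<^sup>+ x. ennreal (?g x) \<partial>lborel) = enn2real (\<integral>\<^sup>+ x. ennreal (- ?g x) \<partial>lborel)"
      using real_lebesgue_integral_def[OF g] z[of a b] by simp
    then have "(\<integral>\<^sup>+ x. ennreal (?g x) \<partial>lborel) = (\<integral>\<^sup>+ x. ennreal (- ?g x) \<partial>lborel)"
      using fin by (metis ennreal_enn2real)
    moreover have "ennreal (?g x) = ?p x * indicator (box a b) x" "ennreal (- ?g x) = ?m x * indicator (box a b) x" for x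
      by (auto simp: indicator_def)
    ultimately show ?thesis
      by (simp add: emeasure_density)
  qed
  have fin: "(\<integral>\<^sup>+ x. ?p x \<partial>lborel) \<noteq> \<infinity>"
    using h real_integrable_def[of lborel h] by auto
  let ?E = "range (\<lambda>(a, b). box a b::'a set)"
  have "density lborel ?p = density lborel ?m"
  proof (rule measure_eqI_generator_eq)
    show "Int_stable ?E"
      by (auto simp: Int_stable_def box_Int_box)
    show "?E \<subseteq> Pow UNIV" "sets (density lborel ?p) = sigma_sets UNIV ?E"
      "sets (density lborel ?m) = sigma_sets UNIV ?E"
      by (simp_all add: borel_eq_box)
    let ?A = "\<lambda>n::nat. box (- (real n *\<^sub>R One)) (real n *\<^sub>R One) :: 'a set"
    show "range ?A \<subseteq> ?E" "(\<Union>i. ?A i) = UNIV"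
      unfolding UN_box_eq_UNIV by auto
    show "emeasure (density lborel ?p) (?A i) \<noteq> \<infinity>" for i
    proof -
      have "emeasure (density lborel ?p) (?A i) \<le> emeasure (density lborel ?p) UNIV"
        by (rule emeasure_mono) auto
      also have "\<dots> = (\<integral>\<^sup>+ x. ?p x \<partial>lborel)"
        by (simp add: emeasure_density)
      finally show ?thesis using fin by (auto simp: top_unique)
    qed
  qed (auto simp: eq)
  then have "AE x in lborel. ?p x = ?m x"
    using finite_density_unique[of ?p lborel ?m] fin by simp
  then show ?thesis
  proof (rule AE_mp, intro AE_I2 impI)
    fix x assume "ennreal (h x) = ennreal (- h x)"
    then show "h x = 0"
      by (cases "h x \<ge> 0") (auto simp: ennreal_neg ennreal_eq_0_iff)
  qed
qed

lemma integrable_mult_bounded: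
  fixes f g :: "'a \<Rightarrow> real"
  assumes "integrable M f" "g \<in> borel_measurable M" "\<And>x. x \<in> space M \<Longrightarrow> \<bar>g x\<bar> \<le> B"
  shows "integrable M (\<lambda>x. f x * g x)"
proof (rule Bochner_Integration.integrable_bound[where f = "\<lambda>x. B * f x"])
  show "AE x in M. norm (f x * g x) \<le> norm (B * f x)"
  proof (intro AE_I2)
    fix x assume "x \<in> space M"
    then have "\<bar>f x\<bar> * \<bar>g x\<bar> \<le> \<bar>f x\<bar> * \<bar>B\<bar>"
      using assms(3)[of x] by (intro mult_left_mono) auto
    then show "norm (f x * g x) \<le> norm (B * f x)"
      by (simp add: abs_mult mult.commute)
  qed
qed (use assms in \<open>auto intro: borel_measurable_times\<close>)

section \<open>Elementary properties of test functions\<close>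

lemma test_function_differentiable:
  assumes "\<phi> \<in> test_functions \<Omega>"
  shows "partials w \<phi> differentiable (at x)"
  using assms by (auto simp: test_functions_def smooth_fun_def)

lemma test_function_continuous:
  assumes "\<phi> \<in> test_functions \<Omega>"
  shows "continuous_on UNIV (partials w \<phi>)"
  using test_function_differentiable[OF assms]
  by (auto simp: continuous_on_eq_continuous_at intro: differentiable_imp_continuous_within)

text \<open>Off the closed support the function vanishes on an open set, so its derivative vanishes
  there as well and the support can only shrink.\<close>

lemma test_function_partial:
  assumes "\<phi> \<in> test_functions \<Omega>"
  shows "partial i \<phi> \<in> test_functions \<Omega>"
proof -
  have S: "smooth_fun (partial i \<phi>)"
    unfolding smooth_fun_def
  proof (intro allI)
    fix w x
    have "partials w (partial i \<phi>) = partials (w @ [i]) \<phi>"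
      by (simp add: partials_append partials_Cons)
    then show "partials w (partial i \<phi>) differentiable (at x)"
      using test_function_differentiable[OF assms] by simp
  qed
  let ?K = "closure {x. \<phi> x \<noteq> 0}"
  have "partial i \<phi> x = 0" if "x \<notin> ?K" for x
  proof -
    have "((\<lambda>x. 0) has_derivative (\<lambda>h. 0)) (at x)" by simp
    then have "(\<phi> has_derivative (\<lambda>h. 0)) (at x)"
    proof (rule has_derivative_transform_within_open[of _ _ _ _ "- ?K"])
      show "0 = \<phi> y" if "y \<in> - ?K" for y
        using that closure_subset[of "{x. \<phi> x \<noteq> 0}"] by auto
    qed (use that in auto)
    then show ?thesis by (simp add: partial_eq)
  qed
  then have K: "closure {x. partial i \<phi> x \<noteq> 0} \<subseteq> ?K"
    by (intro closure_minimal) auto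
  have cK: "compact ?K" "?K \<subseteq> \<Omega>"
    using assms by (auto simp: test_functions_def)
  have "compact (closure {x. partial i \<phi> x \<noteq> 0})"
    using compact_Int_closed[OF cK(1) closed_closure[of "{x. partial i \<phi> x \<noteq> 0}"]] K
    by (simp add: Int_absorb1)
  with S K cK show ?thesis
    by (auto simp: test_functions_def)
qed

lemma test_function_partials:
  assumes "\<phi> \<in> test_functions \<Omega>"
  shows "partials w \<phi> \<in> test_functions \<Omega>"
  using assms by (induction w) (auto simp: partials_Cons intro: test_function_partial)

lemma test_function_zero_outside:
  assumes "\<phi> \<in> test_functions \<Omega>" "x \<notin> \<Omega>"
  shows "\<phi> x = 0"
  using assms closure_subset[of "{x. \<phi> x \<noteq> 0}"] by (auto simp: test_functions_def)

lemma continuous_compact_support_bounded: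
  fixes \<phi> :: "'a::metric_space \<Rightarrow> real"
  assumes "continuous_on UNIV \<phi>" "compact (closure {x. \<phi> x \<noteq> 0})"
  shows "\<exists>B>0. \<forall>x. \<bar>\<phi> x\<bar> \<le> B"
proof -
  have "compact (\<phi> ` closure {x. \<phi> x \<noteq> 0})"
    using assms by (intro compact_continuous_image) (auto intro: continuous_on_subset)
  then obtain B where B: "\<And>x. x \<in> closure {x. \<phi> x \<noteq> 0} \<Longrightarrow> \<bar>\<phi> x\<bar> \<le> B"
    using bounded_real[of "\<phi> ` closure {x. \<phi> x \<noteq> 0}"] compact_imp_bounded by fastforce
  have "\<bar>\<phi> x\<bar> \<le> max B 1" for x
    using B[of x] closure_subset[of "{x. \<phi> x \<noteq> 0}"] by (cases "\<phi> x = 0") fastforce+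
  then show ?thesis by (intro exI[of _ "max B 1"]) auto
qed

lemma test_function_bounded:
  assumes "\<phi> \<in> test_functions \<Omega>"
  shows "\<exists>B>0. \<forall>x. \<bar>partials w \<phi> x\<bar> \<le> B"
  using test_function_partials[OF assms, of w] test_function_continuous[OF assms, of w]
  by (intro continuous_compact_support_bounded) (auto simp: test_functions_def)

lemma test_function_measurable:
  assumes "\<phi> \<in> test_functions \<Omega>"
  shows "partials w \<phi> \<in> borel_measurable borel" "partials w \<phi> \<in> borel_measurable (lebesgue_on S)"
  using borel_measurable_continuous_onI[OF test_function_continuous[OF assms, of w]]
  by (auto intro!: measurable_restrict_space1 measurable_completion)

text \<open>Test functions approximate the indicator of an open box boundedly and pointwise, so
  \<open>h\<close> has integral 0 over every open box whose closed box lies in the domain. This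
  forces \<open>h\<close> to vanish on each such box, and countably many of them cover the
  domain.\<close>

lemma AE_zero_of_test_integrals:
  fixes h :: "real ^ 'n::finite \<Rightarrow> real"
  assumes \<Omega>: "open \<Omega>" and h: "integrable (lebesgue_on \<Omega>) h"
    and z: "\<And>\<phi>. \<phi> \<in> test_functions \<Omega> \<Longrightarrow> (LINT x|lebesgue_on \<Omega>. h x * \<phi> x) = 0"
  shows "AE x in lebesgue_on \<Omega>. h x = 0"
proof -
  have sO: "\<Omega> \<inter> space lebesgue \<in> sets lebesgue" using \<Omega> by auto
  have box0: "(LINT x|lebesgue_on \<Omega>. h x * indicator (box a b) x) = 0" if ab: "cbox a b \<subseteq> \<Omega>" for a b
  proof -
    obtain \<phi> where \<phi>: "\<And>m::nat. \<phi> m \<in> test_functions \<Omega>" "\<And>m x. 0 \<le> \<phi> m x \<and> \<phi> m x \<le> 1"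
      "\<And>x. (\<lambda>m. \<phi> m x) \<longlonglongrightarrow> indicator (box a b) x"
      using box_test_function_sequence[OF ab] by blast
    have [measurable]: "\<phi> m \<in> borel_measurable (lebesgue_on \<Omega>)" for m
      using test_function_measurable(2)[OF \<phi>(1), of "[]"] by simp
    have [measurable]: "h \<in> borel_measurable (lebesgue_on \<Omega>)" using h by auto
    have [measurable]: "(indicator (box a b) :: _ \<Rightarrow> real) \<in> borel_measurable (lebesgue_on \<Omega>)"
      by (intro measurable_restrict_space1 measurable_completion) simp
    have "(\<lambda>m. LINT x|lebesgue_on \<Omega>. h x * \<phi> m x) \<longlonglongrightarrow> (LINT x|lebesgue_on \<Omega>. h x * indicator (box a b) x)"
    proof (rule integral_dominated_convergence[where w = "\<lambda>x. norm (h x)"])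
      show "AE x in lebesgue_on \<Omega>. (\<lambda>m. h x * \<phi> m x) \<longlonglongrightarrow> h x * indicator (box a b) x"
        by (intro AE_I2 tendsto_mult tendsto_const \<phi>(3))
      show "AE x in lebesgue_on \<Omega>. norm (h x * \<phi> m x) \<le> norm (h x)" for m
        using \<phi>(2)[of m] by (intro AE_I2) (auto simp: abs_mult mult_left_le)
    qed (use h in \<open>auto\<close>)
    then show ?thesis
      using z[OF \<phi>(1)] by (simp add: LIMSEQ_const_iff)
  qed
  have *: "AE x in lebesgue. x \<in> cbox a b \<longrightarrow> h x = 0" if ab: "cbox a b \<subseteq> \<Omega>" for a b
  proof -
    define g where "g x = indicator (box a b) x * h x" for x
    have sub: "box a b \<subseteq> \<Omega>" using ab box_subset_cbox by blast
    have "integrable (lebesgue_on \<Omega>) (\<lambda>x. indicator (box a b) x * h x)"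
      by (subst mult.commute, intro integrable_mult_bounded[OF h, of _ 1])
         (auto intro!: measurable_restrict_space1 measurable_completion split: split_indicator)
    then have "integrable lebesgue (\<lambda>x. indicator \<Omega> x *\<^sub>R (indicator (box a b) x * h x))"
      unfolding integrable_restrict_space[OF sO] .
    moreover have gO: "indicator \<Omega> x *\<^sub>R (indicator (box a b) x * h x) = g x" for x
      using sub by (auto simp: g_def indicator_def)
    ultimately have g: "integrable lebesgue g" by simp
    \<comment> \<open>The box criterion is about \<open>lborel\<close>, while \<open>h\<close> is
      only Lebesgue measurable; a Borel representative bridges the gap.\<close>
    then obtain g' where g'[measurable]: "g' \<in> borel_measurable lborel" and gg: "AE x in lborel. g x = g' x"
      using completion_ex_borel_measurable_real[of g lborel] by auto
    have gg': "AE x in lebesgue. g x = g' x"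
      using gg by (rule AE_completion)
    have ml: "g' \<in> borel_measurable lebesgue" using g' measurable_completion by blast
    have "integrable lebesgue g'"
      using g gg' by (subst integrable_cong_AE[of _ _ g]) (auto simp: ml)
    then have i': "integrable lborel g'"
      using integrable_completion[OF g'] by simp
    have "AE x in lborel. g' x = 0"
    proof (rule AE_eq_0_of_box_integrals[OF i'])
      fix c d :: "real ^ 'n"
      have "(LINT x|lborel. indicator (box c d) x * g' x) = (LINT x|lebesgue. indicator (box c d) x * g' x)"
        by (rule integral_completion[symmetric]) simp
      also have "\<dots> = (LINT x|lebesgue. indicator (box c d) x * g x)"
        using gg' g ml by (intro integral_cong_AE)
          (auto intro!: borel_measurable_times measurable_completion[of "indicator (box c d)" lborel borel])
      also have "\<dots> = (LINT x|lebesgue. indicator \<Omega> x *\<^sub>R (h x * indicator (box c d \<inter> box a b) x))"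
        using sub by (intro Bochner_Integration.integral_cong) (auto simp: g_def indicator_def)
      also have "\<dots> = (LINT x|lebesgue_on \<Omega>. h x * indicator (box c d \<inter> box a b) x)"
        by (rule integral_restrict_space[OF sO, symmetric])
      also have "\<dots> = 0"
      proof (cases "box c d \<inter> box a b = {}")
        case False
        then show ?thesis
          using ab unfolding box_Int_box
          by (intro box0) (auto simp: Int_interval[symmetric])
      qed simp
      finally show "(LINT x|lborel. indicator (box c d) x * g' x) = 0" .
    qed
    then have "AE x in lebesgue. g' x = 0" by (rule AE_completion)
    \<comment> \<open>The cover consists of closed boxes, but \<open>g\<close> carries
      \<open>h\<close> only on the open one; the faces form a null set.\<close>
    moreover have "AE x in lebesgue. x \<notin> cbox a b - box a b"
      using negligible_frontier_interval[of a b] by (intro AE_not_in) (simp add: negligible_iff_null_sets)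
    ultimately show ?thesis
      using gg' by eventually_elim (auto simp: g_def)
  qed
  obtain \<D> where \<D>: "countable \<D>" "\<D> \<subseteq> Pow \<Omega>" "\<And>X. X \<in> \<D> \<Longrightarrow> \<exists>a b. X = cbox a b" "\<Union>\<D> = \<Omega>"
    using open_countable_Union_open_cbox[OF \<Omega>] by metis
  have "AE x in lebesgue. \<forall>X\<in>\<D>. x \<in> X \<longrightarrow> h x = 0"
  proof (subst AE_ball_countable[OF \<D>(1)], intro ballI)
    fix X assume "X \<in> \<D>"
    then obtain a b where "X = cbox a b" "cbox a b \<subseteq> \<Omega>" using \<D> by blast
    then show "AE x in lebesgue. x \<in> X \<longrightarrow> h x = 0" using * by simp
  qed
  then have "AE x in lebesgue. x \<in> \<Omega> \<longrightarrow> h x = 0"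
    by eventually_elim (use \<D>(4) in blast)
  then show ?thesis
    using AE_restrict_space_iff[OF sO] by simp
qed

section \<open>Plancherel's formula for continuous functions\<close>

lemma lborel_product_integral:
  fixes f :: "'a::euclidean_space \<Rightarrow> real \<Rightarrow> 'b::{real_normed_field,banach,second_countable_topology}"
  assumes f: "\<And>b. b \<in> Basis \<Longrightarrow> integrable lborel (f b)"
  shows "integrable lborel (\<lambda>x::'a. \<Prod>b\<in>Basis. f b (x \<bullet> b))" (is ?A)
    and "(LINT x|lborel. (\<Prod>b\<in>Basis. f b (x \<bullet> b))) = (\<Prod>b\<in>Basis. LINT t|lborel. f b t)" (is ?B)
proof -
  interpret product_sigma_finite "\<lambda>b::'a. lborel :: real measure" by standard
  let ?P = "Pi\<^sub>M Basis (\<lambda>b::'a. lborel :: real measure)"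
  let ?T = "\<lambda>g. \<Sum>b\<in>(Basis::'a set). g b *\<^sub>R b"
  have D: "(lborel :: 'a measure) = distr ?P borel ?T"
    by (subst lborel_def) (simp add: lborel_eq_real)
  have [measurable]: "f b \<in> borel_measurable borel" if "b \<in> Basis" for b
    using f[OF that] by auto
  have [measurable]: "?T \<in> measurable ?P borel" by measurable
  have m: "(\<lambda>x::'a. \<Prod>b\<in>Basis. f b (x \<bullet> b)) \<in> borel_measurable borel"
    by (intro borel_measurable_prod) (auto intro: measurable_compose)
  have eq: "(\<Prod>b\<in>Basis. f b (?T g \<bullet> b)) = (\<Prod>b\<in>Basis. f b (g b))" for g
    by (intro prod.cong) (auto simp: inner_sum_left_Basis)
  show ?A
    unfolding D by (subst integrable_distr_eq) (auto simp: m eq intro!: product_integrable_prod f)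
  show ?B
    unfolding D by (subst integral_distr) (auto simp: m eq intro!: product_integral_prod f)
qed

text \<open>Integrability is proved in one direction and applied to the inverse map for the other.
  Knowing the equivalence, the integral formula holds for every \<open>f\<close>, since both
  integrals are 0 by convention if \<open>f\<close> is not integrable.\<close>

lemma lborel_integral_affine:
  fixes f :: "'a::euclidean_space \<Rightarrow> 'b::{banach,second_countable_topology}"
  assumes c: "c \<noteq> 0"
  shows "integrable lborel (\<lambda>x. f (t + c *\<^sub>R x)) \<longleftrightarrow> integrable lborel f" (is ?A)
    and "(LINT x|lborel. f x) = \<bar>c\<bar> ^ DIM('a) *\<^sub>R (LINT x|lborel. f (t + c *\<^sub>R x))" (is ?B)
proof -
  have imp: "integrable lborel (\<lambda>x. f (t + c *\<^sub>R x))"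
    if f: "integrable lborel f" and c: "c \<noteq> 0" for f :: "'a \<Rightarrow> 'b" and t c
  proof -
    have [measurable]: "f \<in> borel_measurable borel" using f by auto
    have "integrable (density (distr lborel borel (\<lambda>x. t + c *\<^sub>R x)) (\<lambda>_. \<bar>c\<bar>^DIM('a))) f"
      using f lborel_affine[OF c, of t] by simp
    then have "integrable lborel (\<lambda>x. \<bar>c\<bar>^DIM('a) *\<^sub>R f (t + c *\<^sub>R x))"
      using c by (subst (asm) integrable_density) (auto simp: integrable_distr_eq)
    then have "integrable lborel (\<lambda>x. (1 / \<bar>c\<bar>^DIM('a)) *\<^sub>R (\<bar>c\<bar>^DIM('a) *\<^sub>R f (t + c *\<^sub>R x)))"
      by (rule integrable_scaleR_right)
    with c show ?thesis by simp
  qed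
  show A: ?A
    using imp[of f c t] imp[of "\<lambda>x. f (t + c *\<^sub>R x)" "1/c" "- t /\<^sub>R c"] c
    by (auto simp: scaleR_right_diff_distrib)
  show ?B
  proof (cases "integrable lborel f")
    case True
    then have [measurable]: "f \<in> borel_measurable borel" by auto
    show ?thesis
      by (subst lborel_affine[OF c, of t], subst integral_density) (auto simp: integral_distr)
  next
    case False
    with A show ?thesis by (simp add: not_integrable_integral_eq)
  qed
qed

lemma cball_measurable [measurable]: "cball a r \<in> sets borel"
  by simp

lemma integrable_mult_indicator_cball:
  "integrable lborel (\<lambda>x. (c::real) * indicator (cball (a::'a::euclidean_space) r) x)"
  using emeasure_bounded_finite[OF bounded_cball, of a r]
  by (intro integrable_mult_right integrable_real_indicator) auto

section \<open>The Gaussian and its Fourier transform\<close>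

definition gauss :: "'a::euclidean_space \<Rightarrow> real" where
  "gauss x = exp (- (norm x)\<^sup>2 / 2)"

lemma gauss_bounds: "0 < gauss x" "gauss x \<le> 1"
  by (auto simp: gauss_def)

lemma gauss_nonneg [simp]: "0 \<le> gauss x" "\<bar>gauss x\<bar> = gauss x"
  using gauss_bounds(1)[of x] by auto

lemma continuous_gauss [continuous_intros]:
  "continuous_on S f \<Longrightarrow> continuous_on S (\<lambda>x. gauss (f x))"
  unfolding gauss_def by (intro continuous_intros) auto

lemma measurable_gauss [measurable]: "gauss \<in> borel_measurable borel"
  by (intro borel_measurable_continuous_onI continuous_intros)

text \<open>Up to the factor sqrt(2 pi) this is the characteristic function of the standard normal
  distribution.\<close>

lemma gauss_real_fourier:
  fixes t :: real
  shows "integrable lborel (\<lambda>x::real. of_real (exp (- x\<^sup>2 / 2)) * cis (t * x))" (is ?A)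
    and "(LINT x|lborel. of_real (exp (- x\<^sup>2 / 2)) * cis (t * x)) = of_real (sqrt (2 * pi) * exp (- t\<^sup>2 / 2))" (is ?B)
proof -
  have eq: "of_real (exp (- x\<^sup>2 / 2)) * cis (t * x)
      = sqrt (2 * pi) *\<^sub>R (std_normal_density x *\<^sub>R iexp (t * x))" for x
    by (simp add: std_normal_density_def scaleR_conv_of_real cis_conv_exp del: of_real_mult)
  have "integrable lborel std_normal_density" by simp
  then have "integrable lborel (\<lambda>x. std_normal_density x *\<^sub>R iexp (t * x))"
    by (rule Bochner_Integration.integrable_bound) auto
  then show ?A unfolding eq by (rule integrable_scaleR_right)
  have "(LINT x|std_normal_distribution. iexp (t * x)) = of_real (exp (- t\<^sup>2 / 2))"
    using fun_cong[OF char_std_normal_distribution, of t] by (simp add: char_def)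
  then have "(LINT x|lborel. std_normal_density x *\<^sub>R iexp (t * x)) = of_real (exp (- t\<^sup>2 / 2))"
    by (subst (asm) integral_density) (auto simp: normal_density_nonneg)
  then show ?B unfolding eq by (simp add: scaleR_conv_of_real)
qed

text \<open>Both the Gaussian and the exponential factorise over an orthonormal basis, which reduces
  the claim to dimension one.\<close>

lemma gauss_fourier:
  fixes z :: "'a::euclidean_space"
  shows "integrable lborel (\<lambda>x::'a. of_real (gauss x) * cis (z \<bullet> x))" (is ?A)
    and "(LINT x|lborel. of_real (gauss x) * cis (z \<bullet> x)) = of_real (sqrt (2 * pi) ^ DIM('a) * gauss z)" (is ?B)
proof -
  let ?f = "\<lambda>b t. of_real (exp (- t\<^sup>2 / 2)) * cis ((z \<bullet> b) * t)"
  have g: "gauss x = (\<Prod>b\<in>Basis. exp (- (x \<bullet> b)\<^sup>2 / 2))" for x :: 'a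
    unfolding gauss_def power2_norm_eq_inner euclidean_inner[of x x]
    by (simp add: power2_eq_square sum_divide_distrib sum_negf flip: exp_sum)
  have c: "cis (z \<bullet> x) = (\<Prod>b\<in>Basis. cis ((z \<bullet> b) * (x \<bullet> b)))" for x :: 'a
    by (simp add: cis_conv_exp euclidean_inner[of z x] flip: exp_sum sum_distrib_left)
  have eq: "of_real (gauss x) * cis (z \<bullet> x) = (\<Prod>b\<in>Basis. ?f b (x \<bullet> b))" for x
    by (simp add: g c prod.distrib)
  have i: "integrable lborel (?f b)" for b
    by (rule gauss_real_fourier)
  show ?A unfolding eq by (intro lborel_product_integral i)
  have "(LINT x|lborel. of_real (gauss x) * cis (z \<bullet> x)) = (\<Prod>b\<in>Basis. LINT t|lborel. ?f b t)"
    unfolding eq by (intro lborel_product_integral i)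
  also have "\<dots> = (\<Prod>b\<in>(Basis::'a set). of_real (sqrt (2 * pi) * exp (- (z \<bullet> b)\<^sup>2 / 2)))"
    by (simp only: gauss_real_fourier)
  also have "\<dots> = of_real (sqrt (2 * pi) ^ DIM('a) * gauss z)"
    by (simp add: g prod.distrib)
  finally show ?B .
qed

lemma gauss_integral:
  "integrable lborel (gauss :: 'a::euclidean_space \<Rightarrow> real)"
  "(LINT x|lborel. gauss (x::'a)) = sqrt (2 * pi) ^ DIM('a)"
proof -
  have "integrable lborel (\<lambda>x::'a. complex_of_real (gauss x))"
    using gauss_fourier(1)[of 0] by simp
  then show "integrable lborel (gauss :: 'a \<Rightarrow> real)"
    by (simp only: complex_of_real_integrable_eq)
  have "complex_of_real (LINT x|lborel. gauss (x::'a)) = of_real (sqrt (2 * pi) ^ DIM('a))"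
    using gauss_fourier(2)[of "0::'a"] by (simp add: gauss_def)
  then show "(LINT x|lborel. gauss (x::'a)) = sqrt (2 * pi) ^ DIM('a)"
    by (simp only: of_real_eq_iff)
qed

section \<open>Boundedness and continuity of the Fourier transform\<close>

text \<open>Fourier transform without normalising factor; \<open>M\<close> is \<^term>\<open>lborel\<close> or Lebesgue measure on a domain.\<close>

definition fourier :: "'a::euclidean_space measure \<Rightarrow> ('a \<Rightarrow> real) \<Rightarrow> 'a \<Rightarrow> complex" where
  "fourier M f \<xi> = (LINT x|M. of_real (f x) * cis (- (\<xi> \<bullet> x)))"

lemma cis_inner_measurable [measurable]:
  "(\<lambda>x. cis (- (\<xi> \<bullet> x))) \<in> borel_measurable borel" "(\<lambda>x. cis (\<xi> \<bullet> x)) \<in> borel_measurable borel"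
  by (intro borel_measurable_continuous_onI continuous_intros)+

lemma norm_cis_diff_le: "norm (cis a - cis b) \<le> \<bar>a - b\<bar>"
proof -
  have "cis a - cis b = cis b * (iexp (a - b) - 1)"
    by (simp add: algebra_simps cis_conv_exp flip: exp_add)
  then have "norm (cis a - cis b) = norm (iexp (a - b) - 1)"
    by (simp add: norm_mult)
  also have "\<dots> \<le> \<bar>a - b\<bar>"
    using iexp_approx1[of "a - b" 0] by simp
  finally show ?thesis .
qed

lemma fourier_integrable:
  assumes f: "integrable M f" and c: "\<And>\<xi>. (\<lambda>x. cis (- (\<xi> \<bullet> x))) \<in> borel_measurable M"
  shows "integrable M (\<lambda>x. complex_of_real (f x) * cis (- (\<xi> \<bullet> x)))"
proof (rule Bochner_Integration.integrable_bound[OF f])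
  have "f \<in> borel_measurable M" using f by auto
  then show "(\<lambda>x. complex_of_real (f x) * cis (- (\<xi> \<bullet> x))) \<in> borel_measurable M"
    using c by (intro borel_measurable_times; simp)
qed (auto simp: norm_mult)

lemma norm_fourier_le:
  "norm (fourier M f \<xi>) \<le> (LINT x|M. \<bar>f x\<bar>)"
  unfolding fourier_def
  by (rule order_trans[OF integral_norm_bound]) (simp add: norm_mult)

lemma continuous_fourier:
  assumes f: "integrable M f" and c: "\<And>\<xi>. (\<lambda>x. cis (- (\<xi> \<bullet> x))) \<in> borel_measurable M"
  shows "continuous_on S (fourier M f)"
proof -
  have "isCont (fourier M f) \<xi>" for \<xi>
    unfolding continuous_at_sequentially comp_def fourier_def
  proof (intro allI impI)
    fix X assume X: "X \<longlonglongrightarrow> \<xi>"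
    show "(\<lambda>n. LINT x|M. of_real (f x) * cis (- (X n \<bullet> x))) \<longlonglongrightarrow> (LINT x|M. of_real (f x) * cis (- (\<xi> \<bullet> x)))"
    proof (rule integral_dominated_convergence[where w = "\<lambda>x. norm (f x)"])
      show "AE x in M. (\<lambda>n. of_real (f x) * cis (- (X n \<bullet> x))) \<longlonglongrightarrow> of_real (f x) * cis (- (\<xi> \<bullet> x))"
        using X by (intro AE_I2 tendsto_intros)
    qed (use f fourier_integrable[OF f c] in \<open>auto simp: norm_mult\<close>)
  qed
  then show ?thesis by (simp add: continuous_at_imp_continuous_on)
qed

text \<open>The double integrand is dominated by |g(x)| |h(y)|. The kernels of interest are the
  exponentials exp(i x.y) and exp(-i x.y).\<close>

lemma Fubini_bounded_kernel:
  fixes g h :: "'a::euclidean_space \<Rightarrow> complex"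
  assumes g: "integrable lborel g" and h: "integrable lborel h"
    and K[measurable]: "case_prod K \<in> borel_measurable borel" and b: "\<And>x y. norm (K x y) \<le> 1"
  shows "(LINT x|lborel. g x * (LINT y|lborel. h y * K x y)) = (LINT y|lborel. h y * (LINT x|lborel. g x * K x y))"
proof -
  have [measurable]: "g \<in> borel_measurable borel" "h \<in> borel_measurable borel" using g h by auto
  have K': "K x \<in> borel_measurable borel" for x
    using measurable_compose[OF _ K, of "\<lambda>y. (x, y)" borel] by (simp add: borel_prod[symmetric])
  have K2: "(\<lambda>(x, y). K x y) \<in> borel_measurable (lborel \<Otimes>\<^sub>M lborel)"
    using K by (simp add: lborel_prod)
  have ih: "integrable lborel (\<lambda>y. h y * K x y)" for x
    by (rule Bochner_Integration.integrable_bound[OF h])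
       (use K' b in \<open>auto simp: norm_mult mult_left_le\<close>)
  have nb: "(LINT y|lborel. norm (h y * K x y)) \<le> (LINT y|lborel. norm (h y))" for x
    by (intro integral_mono integrable_norm h ih) (simp add: norm_mult mult_left_le b)
  have "integrable (lborel \<Otimes>\<^sub>M lborel) (\<lambda>(x, y). g x * (h y * K x y))"
  proof (rule lborel_pair.Fubini_integrable)
    show m: "(\<lambda>(x, y). g x * (h y * K x y)) \<in> borel_measurable (lborel \<Otimes>\<^sub>M lborel)"
      using K2 by (auto simp: split_beta')
    show "integrable lborel (\<lambda>x. LINT y|lborel. norm (case (x, y) of (x, y) \<Rightarrow> g x * (h y * K x y)))"
    proof (rule Bochner_Integration.integrable_bound)
      show "integrable lborel (\<lambda>x. (LINT y|lborel. norm (h y)) * g x)"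
        using g by auto
      show "(\<lambda>x. LINT y|lborel. norm (case (x, y) of (x, y) \<Rightarrow> g x * (h y * K x y))) \<in> borel_measurable lborel"
        using m by (intro lborel.borel_measurable_lebesgue_integral) (simp add: split_beta')
      show "AE x in lborel. norm (LINT y|lborel. norm (case (x, y) of (x, y) \<Rightarrow> g x * (h y * K x y)))
          \<le> norm ((LINT y|lborel. norm (h y)) * g x)"
        using nb by (intro AE_I2) (auto simp: norm_mult mult.commute[of _ "norm (g _)"] intro!: mult_left_mono)
    qed
    show "AE x in lborel. integrable lborel (\<lambda>y. case (x, y) of (x, y) \<Rightarrow> g x * (h y * K x y))"
      using ih by auto
  qed
  from lborel_pair.Fubini_integral[OF this]
  have "(LINT y|lborel. LINT x|lborel. g x * (h y * K x y)) = (LINT x|lborel. LINT y|lborel. g x * (h y * K x y))" .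
  moreover have "h y * (LINT x|lborel. g x * K x y) = (LINT x|lborel. g x * (h y * K x y))" for y
    unfolding mult.left_commute[of "g _"] by simp
  ultimately show ?thesis by simp
qed

text \<open>The Gaussian factor makes the frequency integral absolutely convergent, so the order of
  integration may be exchanged. What appears on the space side is \<open>\<phi>\<close> tested
  against its own average over a Gaussian of width \<open>\<sigma>\<close>; letting
  \<open>\<sigma>\<close> tend to 0 will give Plancherel's formula.\<close>

lemma gauss_regularised_Plancherel:
  fixes \<phi> :: "'a::euclidean_space \<Rightarrow> real"
  assumes \<phi>: "integrable lborel \<phi>" and \<sigma>: "\<sigma> > 0"
  shows "integrable lborel (\<lambda>\<xi>. gauss (\<sigma> *\<^sub>R \<xi>) * (norm (fourier lborel \<phi> \<xi>))\<^sup>2)" (is ?A)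
    and "(LINT \<xi>|lborel. gauss (\<sigma> *\<^sub>R \<xi>) * (norm (fourier lborel \<phi> \<xi>))\<^sup>2) =
      sqrt (2 * pi) ^ DIM('a) * (LINT y|lborel. \<phi> y * (LINT v|lborel. \<phi> (y + \<sigma> *\<^sub>R v) * gauss v))" (is ?B)
proof -
  let ?F = "fourier lborel \<phi>" and ?n = "DIM('a)"
  let ?c = "sqrt (2 * pi) ^ ?n"
  define C where "C = (LINT x|lborel. \<bar>\<phi> x\<bar>)"
  have [measurable]: "\<phi> \<in> borel_measurable borel" using \<phi> by auto
  have cphi: "integrable lborel (\<lambda>x. complex_of_real (\<phi> x))"
    using \<phi> by (simp add: complex_of_real_integrable_eq)
  have contF: "continuous_on UNIV ?F"
    by (rule continuous_fourier[OF \<phi>]) simp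
  then have [measurable]: "?F \<in> borel_measurable borel"
    by (rule borel_measurable_continuous_onI)
  have F: "norm (?F \<xi>) \<le> C" for \<xi> unfolding C_def by (rule norm_fourier_le)
  have C0: "C \<ge> 0" by (simp add: C_def)
  have gs: "integrable lborel (\<lambda>\<xi>::'a. gauss (\<sigma> *\<^sub>R \<xi>))"
    using lborel_integral_affine(1)[of \<sigma> "gauss :: 'a \<Rightarrow> real" 0] \<sigma> gauss_integral(1) by simp
  show ?A
  proof (rule Bochner_Integration.integrable_bound)
    show "integrable lborel (\<lambda>\<xi>::'a. C\<^sup>2 * gauss (\<sigma> *\<^sub>R \<xi>))" using gs by simp
    show "AE \<xi> in lborel. norm (gauss (\<sigma> *\<^sub>R \<xi>) * (norm (?F \<xi>))\<^sup>2) \<le> norm (C\<^sup>2 * gauss (\<sigma> *\<^sub>R \<xi>))"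
      using F C0 gauss_bounds(1)
      by (intro AE_I2) (auto simp: abs_mult less_imp_le mult.commute[of "C\<^sup>2"] intro!: mult_left_mono power_mono)
  qed simp
  define g where "g \<xi> = complex_of_real (gauss (\<sigma> *\<^sub>R \<xi>))" for \<xi> :: 'a
  have g: "integrable lborel g"
    using gs unfolding g_def complex_of_real_integrable_eq .
  have [measurable]: "g \<in> borel_measurable borel" using g by auto
  have gF: "integrable lborel (\<lambda>\<xi>. g \<xi> * ?F \<xi>)"
  proof (rule Bochner_Integration.integrable_bound)
    show "integrable lborel (\<lambda>\<xi>. C * norm (g \<xi>))" using g by simp
    show "AE \<xi> in lborel. norm (g \<xi> * ?F \<xi>) \<le> norm (C * norm (g \<xi>))"
      using F C0 by (intro AE_I2) (auto simp: norm_mult mult.commute[of C] intro!: mult_left_mono)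
  qed simp
  have gc: "integrable lborel (\<lambda>\<xi>. g \<xi> * cis (\<xi> \<bullet> y))" for y
    by (rule Bochner_Integration.integrable_bound[OF g]) (auto simp: norm_mult inner_commute[of _ y])
  \<comment> \<open>The transform of a dilated Gaussian is a Gaussian in y - x that concentrates at
    0 as \<open>\<sigma>\<close> decreases.\<close>
  have kern: "(LINT \<xi>|lborel. g \<xi> * cis (\<xi> \<bullet> y) * cis (- (\<xi> \<bullet> x)))
      = of_real ((1 / \<sigma>) ^ ?n * (?c * gauss ((1 / \<sigma>) *\<^sub>R (y - x))))" for x y
  proof -
    have "(LINT \<xi>|lborel. g \<xi> * cis (\<xi> \<bullet> y) * cis (- (\<xi> \<bullet> x))) = (LINT \<xi>|lborel. g \<xi> * cis ((y - x) \<bullet> \<xi>))"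
      by (simp add: cis_mult mult.assoc inner_diff_left inner_diff_right inner_commute)
    also have "\<dots> = (1 / \<sigma>) ^ ?n *\<^sub>R (LINT \<eta>|lborel. g ((1 / \<sigma>) *\<^sub>R \<eta>) * cis ((y - x) \<bullet> ((1 / \<sigma>) *\<^sub>R \<eta>)))"
      using lborel_integral_affine(2)[of "1 / \<sigma>" "\<lambda>\<xi>. g \<xi> * cis ((y - x) \<bullet> \<xi>)" 0] \<sigma> by simp
    also have "(LINT \<eta>|lborel. g ((1 / \<sigma>) *\<^sub>R \<eta>) * cis ((y - x) \<bullet> ((1 / \<sigma>) *\<^sub>R \<eta>)))
        = (LINT \<eta>|lborel. of_real (gauss \<eta>) * cis (((1 / \<sigma>) *\<^sub>R (y - x)) \<bullet> \<eta>))"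
      using \<sigma> by (simp add: g_def)
    also have "\<dots> = of_real (?c * gauss ((1 / \<sigma>) *\<^sub>R (y - x)))"
      by (rule gauss_fourier(2))
    finally show ?thesis by (simp add: scaleR_conv_of_real)
  qed
  have inner: "(LINT \<xi>|lborel. g \<xi> * ?F \<xi> * cis (\<xi> \<bullet> y))
      = of_real (?c * (LINT v|lborel. \<phi> (y + \<sigma> *\<^sub>R v) * gauss v))" for y
  proof -
    have "(LINT \<xi>|lborel. g \<xi> * ?F \<xi> * cis (\<xi> \<bullet> y)) =
      (LINT \<xi>|lborel. (g \<xi> * cis (\<xi> \<bullet> y)) * (LINT x|lborel. of_real (\<phi> x) * cis (- (\<xi> \<bullet> x))))"
      by (simp add: fourier_def mult_ac)
    also have "\<dots> = (LINT x|lborel. of_real (\<phi> x) * (LINT \<xi>|lborel. (g \<xi> * cis (\<xi> \<bullet> y)) * cis (- (\<xi> \<bullet> x))))"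
      by (intro Fubini_bounded_kernel gc cphi borel_measurable_continuous_onI)
         (auto simp: split_beta' intro!: continuous_intros)
    also have "\<dots> = of_real (LINT x|lborel. \<phi> x * ((1 / \<sigma>) ^ ?n * (?c * gauss ((1 / \<sigma>) *\<^sub>R (y - x)))))"
      unfolding kern by (simp flip: of_real_mult)
    \<comment> \<open>Substituting x = y + \<open>\<sigma>\<close> v cancels the powers of
      \<open>\<sigma>\<close> and moves the dependence on \<open>\<sigma>\<close> into the argument
      of \<open>\<phi>\<close>.\<close>
    also have "(LINT x|lborel. \<phi> x * ((1 / \<sigma>) ^ ?n * (?c * gauss ((1 / \<sigma>) *\<^sub>R (y - x)))))
       = \<sigma> ^ ?n * (LINT v|lborel. \<phi> (y + \<sigma> *\<^sub>R v) * ((1 / \<sigma>) ^ ?n * (?c * gauss ((1 / \<sigma>) *\<^sub>R (y - (y + \<sigma> *\<^sub>R v))))))"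
      using \<sigma> by (subst lborel_integral_affine(2)[of \<sigma> _ y]) auto
    also have "\<dots> = \<sigma> ^ ?n * (LINT v|lborel. ((1 / \<sigma>) ^ ?n * ?c) * (\<phi> (y + \<sigma> *\<^sub>R v) * gauss v))"
      using \<sigma> by (simp add: gauss_def mult_ac)
    also have "\<dots> = ?c * (LINT v|lborel. \<phi> (y + \<sigma> *\<^sub>R v) * gauss v)"
      using \<sigma> by (simp add: power_one_over)
    finally show ?thesis .
  qed
  have cnjF: "cnj (?F \<xi>) = (LINT y|lborel. of_real (\<phi> y) * cis (\<xi> \<bullet> y))" for \<xi>
    unfolding fourier_def by (simp add: cis_cnj flip: Bochner_Integration.integral_cnj)
  have sq: "z * cnj z = complex_of_real ((norm z)\<^sup>2)" for z
    by (rule complex_norm_square[symmetric])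
  have "complex_of_real (LINT \<xi>|lborel. gauss (\<sigma> *\<^sub>R \<xi>) * (norm (?F \<xi>))\<^sup>2)
      = (LINT \<xi>|lborel. (g \<xi> * ?F \<xi>) * cnj (?F \<xi>))"
    by (simp add: g_def sq mult.assoc flip: integral_complex_of_real)
  also have "\<dots> = (LINT y|lborel. of_real (\<phi> y) * (LINT \<xi>|lborel. (g \<xi> * ?F \<xi>) * cis (\<xi> \<bullet> y)))"
    unfolding cnjF
    by (intro Fubini_bounded_kernel gF cphi borel_measurable_continuous_onI)
       (auto simp: split_beta' intro!: continuous_intros)
  also have "\<dots> = of_real (LINT y|lborel. ?c * (\<phi> y * (LINT v|lborel. \<phi> (y + \<sigma> *\<^sub>R v) * gauss v)))"
    unfolding inner by (simp add: mult_ac flip: of_real_mult integral_complex_of_real)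
  finally show ?B by (simp only: of_real_eq_iff) simp
qed

text \<open>In the regularised formula the width tends to 0. On the space side dominated convergence
  applies because \<open>\<phi>\<close> is continuous, bounded and integrable. On the frequency side
  the Gaussian factors increase to 1, so monotone convergence yields the integrability of the
  squared transform together with its value.\<close>

theorem Plancherel_compact_support:
  fixes \<phi> :: "'a::euclidean_space \<Rightarrow> real"
  assumes cont: "continuous_on UNIV \<phi>" and i: "integrable lborel \<phi>" and b: "\<And>x. \<bar>\<phi> x\<bar> \<le> B"
  shows "integrable lborel (\<lambda>\<xi>. (norm (fourier lborel \<phi> \<xi>))\<^sup>2)"
    and "(LINT \<xi>|lborel. (norm (fourier lborel \<phi> \<xi>))\<^sup>2) = (2 * pi) ^ DIM('a) * (LINT x|lborel. (\<phi> x)\<^sup>2)"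
proof -
  let ?F = "fourier lborel \<phi>" and ?n = "DIM('a)"
  let ?c = "sqrt (2 * pi) ^ ?n"
  define s where "s m = 1 / real (Suc m)" for m
  have s: "s m > 0" for m by (simp add: s_def)
  have slim: "s \<longlonglongrightarrow> 0"
    unfolding s_def using LIMSEQ_inverse_real_of_nat by (simp add: inverse_eq_divide)
  have B0: "B \<ge> 0" using b[of 0] by linarith
  have [measurable]: "\<phi> \<in> borel_measurable borel"
    using cont by (rule borel_measurable_continuous_onI)
  have [measurable]: "?F \<in> borel_measurable borel"
    by (intro borel_measurable_continuous_onI continuous_fourier i) simp
  define h where "h m y = (LINT v|lborel. \<phi> (y + s m *\<^sub>R v) * gauss v)" for m y
  have hm [measurable]: "h m \<in> borel_measurable borel" for m
    unfolding h_def by measurable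
  have hlim: "(\<lambda>m. h m y) \<longlonglongrightarrow> (LINT v|lborel. \<phi> y * gauss (v::'a))" for y
    unfolding h_def
  proof (rule integral_dominated_convergence[where w = "\<lambda>v::'a. B * gauss v"])
    show "integrable lborel (\<lambda>v::'a. B * gauss v)"
      by (intro integrable_mult_right gauss_integral)
    have "(\<lambda>m. \<phi> (y + s m *\<^sub>R v)) \<longlonglongrightarrow> \<phi> (y + 0 *\<^sub>R v)" for v
    proof (rule isCont_tendsto_compose[of _ \<phi>])
      show "isCont \<phi> (y + 0 *\<^sub>R v)" using cont by (simp add: continuous_on_eq_continuous_at)
      show "(\<lambda>m. y + s m *\<^sub>R v) \<longlonglongrightarrow> y + 0 *\<^sub>R v" by (intro tendsto_intros slim)
    qed
    then show "AE v in lborel. (\<lambda>m. \<phi> (y + s m *\<^sub>R v) * gauss v) \<longlonglongrightarrow> \<phi> y * gauss v"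
      by (intro AE_I2 tendsto_intros) auto
    show "AE v in lborel. norm (\<phi> (y + s m *\<^sub>R v) * gauss v) \<le> B * gauss v" for m
      using b gauss_bounds(1) by (intro AE_I2) (auto simp: abs_mult less_imp_le intro!: mult_right_mono)
  qed auto
  have hb: "\<bar>h m y\<bar> \<le> B * ?c" for m y
  proof -
    have "\<bar>h m y\<bar> \<le> (LINT v|lborel. norm (\<phi> (y + s m *\<^sub>R v) * gauss v))"
      unfolding h_def using integral_norm_bound by (metis real_norm_def)
    also have "\<dots> \<le> (LINT v|lborel. B * gauss (v::'a))"
      using b gauss_bounds(1) gauss_integral(1) B0
      by (intro integral_mono') (auto simp: abs_mult less_imp_le intro!: mult_right_mono mult_nonneg_nonneg)
    finally show ?thesis by (simp add: gauss_integral)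
  qed
  have "(\<lambda>m. LINT y|lborel. \<phi> y * h m y) \<longlonglongrightarrow> (LINT y|lborel. \<phi> y * (LINT v|lborel. \<phi> y * gauss (v::'a)))"
  proof (rule integral_dominated_convergence[where w = "\<lambda>y. (B * ?c) * norm (\<phi> y)"])
    show "integrable lborel (\<lambda>y. (B * ?c) * norm (\<phi> y))"
      using i by (intro integrable_mult_right integrable_norm)
    show "AE y in lborel. (\<lambda>m. \<phi> y * h m y) \<longlonglongrightarrow> \<phi> y * (LINT v|lborel. \<phi> y * gauss (v::'a))"
      using hlim by (intro AE_I2 tendsto_intros)
    show "AE y in lborel. norm (\<phi> y * h m y) \<le> (B * ?c) * norm (\<phi> y)" for m
      using hb by (intro AE_I2) (auto simp: abs_mult mult.commute[of "B * ?c"] intro!: mult_left_mono)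
  qed (auto simp: gauss_integral)
  also have "(\<lambda>y. \<phi> y * (LINT v|lborel. \<phi> y * gauss (v::'a))) = (\<lambda>y. ?c * (\<phi> y)\<^sup>2)"
    by (auto simp: gauss_integral power2_eq_square)
  finally have "(\<lambda>m. ?c * (LINT y|lborel. \<phi> y * h m y)) \<longlonglongrightarrow> ?c * (LINT y|lborel. ?c * (\<phi> y)\<^sup>2)"
    by (intro tendsto_mult tendsto_const)
  also have "?c * (LINT y|lborel. ?c * (\<phi> y)\<^sup>2) = (2 * pi) ^ ?n * (LINT x|lborel. (\<phi> x)\<^sup>2)"
  proof -
    have "?c * ?c = (2 * pi) ^ ?n"
      by (simp only: power_mult_distrib[symmetric] real_sqrt_mult_self) simp
    then show ?thesis
      unfolding integral_mult_right_zero mult.assoc[symmetric] by (simp only:)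
  qed
  finally have lim: "(\<lambda>m. LINT \<xi>|lborel. gauss (s m *\<^sub>R \<xi>) * (norm (?F \<xi>))\<^sup>2)
      \<longlonglongrightarrow> (2 * pi) ^ ?n * (LINT x|lborel. (\<phi> x)\<^sup>2)"
    unfolding gauss_regularised_Plancherel(2)[OF i s] h_def .
  have mono: "AE \<xi> in lborel. mono (\<lambda>m. gauss (s m *\<^sub>R \<xi>) * (norm (?F \<xi>))\<^sup>2)"
  proof (intro AE_I2 monoI mult_right_mono)
    fix \<xi> :: 'a and m k :: nat assume "m \<le> k"
    then have "s k \<le> s m" by (simp add: s_def frac_le)
    then have "(s k * norm \<xi>)\<^sup>2 \<le> (s m * norm \<xi>)\<^sup>2"
      using s[of k] by (intro power_mono mult_right_mono) auto
    then show "gauss (s m *\<^sub>R \<xi>) \<le> gauss (s k *\<^sub>R \<xi>)"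
      by (simp add: gauss_def power_mult_distrib)
  qed simp
  have pt: "AE \<xi> in lborel. (\<lambda>m. gauss (s m *\<^sub>R \<xi>) * (norm (?F \<xi>))\<^sup>2) \<longlonglongrightarrow> (norm (?F \<xi>))\<^sup>2"
  proof (intro AE_I2)
    fix \<xi> :: 'a
    have "(\<lambda>m. gauss (s m *\<^sub>R \<xi>) * (norm (?F \<xi>))\<^sup>2) \<longlonglongrightarrow> exp (- (norm (0 *\<^sub>R \<xi>))\<^sup>2 / 2) * (norm (?F \<xi>))\<^sup>2"
      unfolding gauss_def by (intro tendsto_intros slim) auto
    then show "(\<lambda>m. gauss (s m *\<^sub>R \<xi>) * (norm (?F \<xi>))\<^sup>2) \<longlonglongrightarrow> (norm (?F \<xi>))\<^sup>2" by simp
  qed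
  note * = integrable_monotone_convergence[OF gauss_regularised_Plancherel(1)[OF i s] mono pt lim]
    integral_monotone_convergence[OF gauss_regularised_Plancherel(1)[OF i s] mono pt lim]
  show "integrable lborel (\<lambda>\<xi>. (norm (?F \<xi>))\<^sup>2)" by (rule *(1)) simp
  show "(LINT \<xi>|lborel. (norm (?F \<xi>))\<^sup>2) = (2 * pi) ^ ?n * (LINT x|lborel. (\<phi> x)\<^sup>2)"
    by (rule *(2)) simp
qed

section \<open>Fourier transforms of test functions\<close>

lemma has_real_derivative_along_axis:
  fixes \<phi> :: "real ^ 'n::finite \<Rightarrow> real"
  assumes "\<phi> differentiable (at (x + t *\<^sub>R axis i 1))"
  shows "((\<lambda>t. \<phi> (x + t *\<^sub>R axis i 1)) has_real_derivative partial i \<phi> (x + t *\<^sub>R axis i 1)) (at t)"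
proof -
  let ?y = "x + t *\<^sub>R axis i 1" and ?D = "frechet_derivative \<phi> (at (x + t *\<^sub>R axis i 1))"
  have D: "(\<phi> has_derivative ?D) (at ?y)"
    using assms by (simp add: frechet_derivative_works)
  have "((\<lambda>t. x + t *\<^sub>R axis i 1) has_derivative (\<lambda>h. h *\<^sub>R axis i 1)) (at t)"
    by (auto intro!: derivative_eq_intros)
  from has_derivative_compose[OF this D]
  have "((\<lambda>t. \<phi> (x + t *\<^sub>R axis i 1)) has_derivative (\<lambda>h. ?D (h *\<^sub>R axis i 1))) (at t)" .
  moreover have "?D (h *\<^sub>R axis i 1) = partial i \<phi> ?y * h" for h
    using linear_frechet_derivative[OF assms] by (simp add: linear_scale partial_def)
  ultimately show ?thesis by (simp add: has_field_derivative_def)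
qed

lemma test_function_integrable:
  assumes "\<phi> \<in> test_functions \<Omega>"
  shows "integrable lborel \<phi>"
proof -
  let ?K = "closure {x. \<phi> x \<noteq> 0}"
  have K: "compact ?K" using assms by (simp add: test_functions_def)
  have "continuous_on ?K \<phi>"
    using test_function_continuous[OF assms, of "[]"] continuous_on_subset by auto
  then have "integrable lborel (\<lambda>x. indicator ?K x *\<^sub>R \<phi> x)"
    by (rule borel_integrable_compact[OF K, unfolded set_integrable_def])
  moreover have "indicator ?K x *\<^sub>R \<phi> x = \<phi> x" for x
    using closure_subset[of "{x. \<phi> x \<noteq> 0}"] by (auto simp: indicator_def)
  ultimately show ?thesis by (simp only:)
qed

text \<open>Integration by parts is replaced by difference quotients. Translation invariance shows
  that the transform of a quotient is the transform of \<open>\<phi>\<close> times (exp(i s xi_i) -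
  1) / s, and the quotients converge boundedly on a fixed ball.\<close>

lemma fourier_partial:
  fixes \<phi> :: "real ^ 'n::finite \<Rightarrow> real"
  assumes \<phi>: "\<phi> \<in> test_functions \<Omega>"
  shows "fourier lborel (partial i \<phi>) \<xi> = \<i> * of_real (\<xi> $ i) * fourier lborel \<phi> \<xi>"
proof -
  let ?e = "axis i 1 :: real ^ 'n"
  define s where "s m = 1 / real (Suc m)" for m
  have s: "s m > 0" "s m \<le> 1" for m by (simp_all add: s_def)
  have slim: "s \<longlonglongrightarrow> 0"
    unfolding s_def using LIMSEQ_inverse_real_of_nat by (simp add: inverse_eq_divide)
  have slim': "filterlim s (at 0) sequentially"
    using slim s by (auto simp: filterlim_at intro!: always_eventually) (metis less_irrefl)
  define D where "D m x = (\<phi> (x + s m *\<^sub>R ?e) - \<phi> x) / s m" for m x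
  have dphi: "\<phi> differentiable (at x)" for x
    using test_function_differentiable[OF \<phi>, of "[]"] by simp
  have [measurable]: "\<phi> \<in> borel_measurable borel" "partial i \<phi> \<in> borel_measurable borel"
    using test_function_measurable(1)[OF \<phi>, of "[]"] test_function_measurable(1)[OF \<phi>, of "[i]"]
    by (simp_all add: partials_Cons)
  have Dm [measurable]: "D m \<in> borel_measurable borel" for m
    unfolding D_def by measurable
  obtain B where B: "B > 0" "\<And>x. \<bar>partial i \<phi> x\<bar> \<le> B"
    using test_function_bounded[OF \<phi>, of "[i]"] by (auto simp: partials_Cons)
  \<comment> \<open>By the mean value theorem a bound for the partial derivative bounds all
    difference quotients at once.\<close>
  have Db: "\<bar>D m x\<bar> \<le> B" for m x
  proof -
    have "\<exists>z. 0 < z \<and> z < s m \<and> \<phi> (x + s m *\<^sub>R ?e) - \<phi> (x + 0 *\<^sub>R ?e) = (s m - 0) * partial i \<phi> (x + z *\<^sub>R ?e)"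
      using s by (intro MVT2 has_real_derivative_along_axis dphi)
    then obtain z where "\<phi> (x + s m *\<^sub>R ?e) - \<phi> x = s m * partial i \<phi> (x + z *\<^sub>R ?e)" by auto
    then have "D m x = partial i \<phi> (x + z *\<^sub>R ?e)"
      using s(1)[of m] by (simp add: D_def)
    then show ?thesis using B(2) by simp
  qed
  have "bounded {x. \<phi> x \<noteq> 0}"
    using \<phi> closure_subset[of "{x. \<phi> x \<noteq> 0}"]
    by (auto simp: test_functions_def intro: bounded_subset compact_imp_bounded)
  then obtain r where r: "\<And>x. \<phi> x \<noteq> 0 \<Longrightarrow> norm x \<le> r"
    unfolding bounded_iff by blast
  \<comment> \<open>The steps \<open>s m\<close> are at most 1, so enlarging the support radius by 1
    contains the supports of all quotients.\<close>
  let ?K = "cball 0 (r + 1) :: (real ^ 'n) set"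
  have Dz: "D m x = 0" if "x \<notin> ?K" for m x
  proof -
    have "norm x \<le> norm (x + s m *\<^sub>R ?e) + norm (s m *\<^sub>R ?e)"
      using norm_triangle_ineq4[of "x + s m *\<^sub>R ?e" "s m *\<^sub>R ?e"] by simp
    also have "norm (s m *\<^sub>R ?e) \<le> 1" using s[of m] by simp
    finally have "norm (x + s m *\<^sub>R ?e) > r" "norm x > r" using that by auto
    then have "\<phi> (x + s m *\<^sub>R ?e) = 0" "\<phi> x = 0" using r by (meson not_le)+
    then show ?thesis by (simp add: D_def)
  qed
  have Dlim: "(\<lambda>m. D m x) \<longlonglongrightarrow> partial i \<phi> x" for x
  proof -
    have "((\<lambda>t. \<phi> (x + t *\<^sub>R ?e)) has_real_derivative partial i \<phi> (x + 0 *\<^sub>R ?e)) (at 0)"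
      by (rule has_real_derivative_along_axis[OF dphi])
    then have "((\<lambda>h. (\<phi> (x + h *\<^sub>R ?e) - \<phi> x) / h) \<longlongrightarrow> partial i \<phi> x) (at 0)"
      by (simp add: DERIV_def)
    then show ?thesis
      unfolding D_def by (rule filterlim_compose[OF _ slim'])
  qed
  let ?c = "\<lambda>x. cis (- (\<xi> \<bullet> x))"
  have "(\<lambda>m. LINT x|lborel. of_real (D m x) * ?c x) \<longlonglongrightarrow> (LINT x|lborel. of_real (partial i \<phi> x) * ?c x)"
  proof (rule integral_dominated_convergence[where w = "\<lambda>x. B * indicator ?K x"])
    show "integrable lborel (\<lambda>x. B * indicator ?K x)"
      by (rule integrable_mult_indicator_cball)
    show "AE x in lborel. (\<lambda>m. of_real (D m x) * ?c x) \<longlonglongrightarrow> of_real (partial i \<phi> x) * ?c x"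
      by (intro AE_I2 tendsto_intros Dlim)
    show "AE x in lborel. norm (of_real (D m x) * ?c x) \<le> B * indicator ?K x" for m
      using Db Dz by (intro AE_I2) (auto simp: norm_mult indicator_def)
  qed auto
  then have "(\<lambda>m. LINT x|lborel. of_real (D m x) * ?c x) \<longlonglongrightarrow> fourier lborel (partial i \<phi>) \<xi>"
    by (simp only: fourier_def)
  moreover have "(LINT x|lborel. of_real (D m x) * ?c x) = fourier lborel \<phi> \<xi> * ((cis (\<xi> $ i * s m) - 1) / of_real (s m))" for m
  proof -
    let ?f = "\<lambda>x. of_real (\<phi> x) * ?c x"
    have i: "integrable lborel ?f"
      by (rule fourier_integrable[OF test_function_integrable[OF \<phi>]]) simp
    have i': "integrable lborel (\<lambda>x. ?f (s m *\<^sub>R ?e + 1 *\<^sub>R x))"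
      by (rule iffD2[OF lborel_integral_affine(1)[of 1 ?f "s m *\<^sub>R ?e", OF one_neq_zero] i])
    have e: "\<xi> \<bullet> ?e = \<xi> $ i" by (simp add: inner_axis)
    have "of_real (D m x) * ?c x = (cis (\<xi> $ i * s m) * ?f (s m *\<^sub>R ?e + 1 *\<^sub>R x) - ?f x) / of_real (s m)" for x
    proof -
      have "cis (\<xi> $ i * s m) * ?c (s m *\<^sub>R ?e + 1 *\<^sub>R x) = ?c x"
        by (simp add: cis_mult inner_add_right e mult.commute)
      then have "cis (\<xi> $ i * s m) * ?f (s m *\<^sub>R ?e + 1 *\<^sub>R x) = of_real (\<phi> (s m *\<^sub>R ?e + 1 *\<^sub>R x)) * ?c x"
        by (metis mult.left_commute)
      then have "(cis (\<xi> $ i * s m) * ?f (s m *\<^sub>R ?e + 1 *\<^sub>R x) - ?f x) / of_real (s m)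
          = (of_real (\<phi> (s m *\<^sub>R ?e + 1 *\<^sub>R x)) * ?c x - ?f x) / of_real (s m)"
        by (simp only:)
      then show ?thesis
        by (simp only:) (simp add: D_def add.commute diff_divide_distrib left_diff_distrib)
    qed
    then have "(LINT x|lborel. of_real (D m x) * ?c x)
        = (LINT x|lborel. (cis (\<xi> $ i * s m) * ?f (s m *\<^sub>R ?e + 1 *\<^sub>R x) - ?f x) / of_real (s m))"
      by simp
    also have "\<dots> = (cis (\<xi> $ i * s m) * (LINT x|lborel. ?f (s m *\<^sub>R ?e + 1 *\<^sub>R x)) - (LINT x|lborel. ?f x)) / of_real (s m)"
      using i i' by simp
    also have "(LINT x|lborel. ?f (s m *\<^sub>R ?e + 1 *\<^sub>R x)) = (LINT x|lborel. ?f x)"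
      using lborel_integral_affine(2)[of 1 ?f "s m *\<^sub>R ?e"] by simp
    finally show ?thesis by (simp add: fourier_def algebra_simps)
  qed
  moreover have "(\<lambda>m. fourier lborel \<phi> \<xi> * ((cis (\<xi> $ i * s m) - 1) / of_real (s m))) \<longlonglongrightarrow> fourier lborel \<phi> \<xi> * (\<i> * of_real (\<xi> $ i))"
  proof -
    let ?a = "\<i> * of_real (\<xi> $ i)"
    have "((\<lambda>z. exp (?a * z)) has_field_derivative ?a) (at 0)"
      by (auto intro!: derivative_eq_intros)
    then have "((\<lambda>z. (exp (?a * z) - 1) / z) \<longlongrightarrow> ?a) (at 0)"
      by (simp add: DERIV_def)
    moreover have "filterlim (\<lambda>m. complex_of_real (s m)) (at 0) sequentially"
      using tendsto_of_real[OF slim, where 'a=complex] s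
      by (auto simp: filterlim_at intro!: always_eventually) (metis less_irrefl)
    ultimately have "(\<lambda>m. (exp (?a * of_real (s m)) - 1) / of_real (s m)) \<longlonglongrightarrow> ?a"
      by (rule filterlim_compose)
    then show ?thesis
      by (intro tendsto_mult tendsto_const) (simp add: cis_conv_exp mult.assoc)
  qed
  ultimately have "fourier lborel (partial i \<phi>) \<xi> = fourier lborel \<phi> \<xi> * (\<i> * of_real (\<xi> $ i))"
    by (intro LIMSEQ_unique) simp_all
  then show ?thesis by (simp add: mult_ac)
qed

lemma words_Suc: "{w::'n list. length w = Suc l} = (\<lambda>(i, w). i # w) ` (UNIV \<times> {w. length w = l})"
  by (auto simp: length_Suc_conv image_iff)

lemma sum_words_Suc:
  "(\<Sum>w | length (w::'n::finite list) = Suc l. f w) = (\<Sum>w | length w = l. \<Sum>i\<in>UNIV. f (i # w))"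
proof -
  have "(\<Sum>w | length (w::'n::finite list) = Suc l. f w) = (\<Sum>(i, w)\<in>UNIV \<times> {w. length w = l}. f (i # w))"
    unfolding words_Suc by (subst sum.reindex) (auto simp: inj_on_def split_beta')
  also have "\<dots> = (\<Sum>i\<in>UNIV. \<Sum>w | length w = l. f (i # w))"
    by (rule sum.cartesian_product[symmetric])
  finally show ?thesis by (simp add: sum.swap[of _ UNIV])
qed

text \<open>Each letter of a word contributes the sum of the squared coordinates of the frequency,
  that is, its squared norm. Summation over words supplies the multinomial weights
  automatically.\<close>

lemma sum_norm_fourier_partials:
  fixes \<phi> :: "real ^ 'n::finite \<Rightarrow> real"
  assumes \<phi>: "\<phi> \<in> test_functions \<Omega>"
  shows "(\<Sum>w | length w = l. (norm (fourier lborel (partials w \<phi>) \<xi>))\<^sup>2) = norm \<xi> ^ (2 * l) * (norm (fourier lborel \<phi> \<xi>))\<^sup>2"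
proof (induction l)
  case (Suc l)
  have "(\<Sum>i\<in>UNIV. (norm (fourier lborel (partials (i # w) \<phi>) \<xi>))\<^sup>2) = (norm \<xi>)\<^sup>2 * (norm (fourier lborel (partials w \<phi>) \<xi>))\<^sup>2" for w
  proof -
    have "(norm \<xi>)\<^sup>2 = (\<Sum>i\<in>UNIV. (\<xi> $ i)\<^sup>2)"
      unfolding power2_norm_eq_inner inner_vec_def by (simp add: power2_eq_square)
    then show ?thesis
      by (simp add: partials_Cons fourier_partial[OF test_function_partials[OF \<phi>]] norm_mult
          power_mult_distrib sum_distrib_right)
  qed
  then have "(\<Sum>w | length w = Suc l. (norm (fourier lborel (partials w \<phi>) \<xi>))\<^sup>2)
      = (norm \<xi>)\<^sup>2 * (norm \<xi> ^ (2 * l) * (norm (fourier lborel \<phi> \<xi>))\<^sup>2)"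
    by (simp add: sum_words_Suc Suc.IH flip: sum_distrib_left)
  then show ?case
    by (simp add: power2_eq_square)
qed simp

lemma test_function_Plancherel:
  fixes \<phi> :: "real ^ 'n::finite \<Rightarrow> real"
  assumes \<phi>: "\<phi> \<in> test_functions \<Omega>"
  shows "integrable lborel (\<lambda>\<xi>. (norm (fourier lborel \<phi> \<xi>))\<^sup>2)"
    and "(LINT \<xi>|lborel. (norm (fourier lborel \<phi> \<xi>))\<^sup>2) = (2 * pi) ^ CARD('n) * (LINT x|lborel. (\<phi> x)\<^sup>2)"
proof -
  obtain B where "\<And>x. \<bar>\<phi> x\<bar> \<le> B"
    using test_function_bounded[OF \<phi>, of "[]"] by auto
  moreover have "continuous_on UNIV \<phi>"
    using test_function_continuous[OF \<phi>, of "[]"] by simp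
  ultimately show "integrable lborel (\<lambda>\<xi>. (norm (fourier lborel \<phi> \<xi>))\<^sup>2)"
    and "(LINT \<xi>|lborel. (norm (fourier lborel \<phi> \<xi>))\<^sup>2) = (2 * pi) ^ CARD('n) * (LINT x|lborel. (\<phi> x)\<^sup>2)"
    using Plancherel_compact_support[OF _ test_function_integrable[OF \<phi>]] by auto
qed

text \<open>By Plancherel the right-hand side is the integral of the weighted squared transform over
  the whole space. Outside the ball the weight is nonnegative because
  \<open>\<mu> \<le> T ^ (2 * l)\<close>, so that part may be discarded.\<close>

lemma test_function_energy:
  fixes \<phi> :: "real ^ 'n::finite \<Rightarrow> real"
  assumes \<phi>: "\<phi> \<in> test_functions \<Omega>" and T: "0 \<le> T" "\<mu> \<le> T ^ (2 * l)"
  shows "(LINT \<xi>|lborel. indicator (cball 0 T) \<xi> * ((norm \<xi> ^ (2 * l) - \<mu>) * (norm (fourier lborel \<phi> \<xi>))\<^sup>2))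
     \<le> (2 * pi) ^ CARD('n) * ((\<Sum>w | length w = l. LINT x|lborel. (partials w \<phi> x)\<^sup>2) - \<mu> * (LINT x|lborel. (\<phi> x)\<^sup>2))"
proof -
  let ?F = "\<lambda>\<xi>. (norm (fourier lborel \<phi> \<xi>))\<^sup>2"
  let ?G = "\<lambda>\<xi>. norm \<xi> ^ (2 * l) * ?F \<xi>"
  note P = test_function_Plancherel
  have G: "?G = (\<lambda>\<xi>. \<Sum>w | length w = l. (norm (fourier lborel (partials w \<phi>) \<xi>))\<^sup>2)"
    using sum_norm_fourier_partials[OF \<phi>] by auto
  have iF: "integrable lborel ?F" by (rule P(1)[OF \<phi>])
  have iG: "integrable lborel ?G"
    unfolding G by (intro Bochner_Integration.integrable_sum P(1)[OF test_function_partials[OF \<phi>]])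
  have "integrable lborel (\<lambda>\<xi>. ?G \<xi> - \<mu> * ?F \<xi>)" using iF iG by auto
  then have i: "integrable lborel (\<lambda>\<xi>. (norm \<xi> ^ (2 * l) - \<mu>) * ?F \<xi>)"
    by (simp add: algebra_simps)
  have "(LINT \<xi>|lborel. indicator (cball 0 T) \<xi> * ((norm \<xi> ^ (2 * l) - \<mu>) * ?F \<xi>))
     \<le> (LINT \<xi>|lborel. (norm \<xi> ^ (2 * l) - \<mu>) * ?F \<xi>)"
  proof (rule integral_mono)
    show "integrable lborel (\<lambda>\<xi>. indicator (cball 0 T) \<xi> * ((norm \<xi> ^ (2 * l) - \<mu>) * ?F \<xi>))"
      using integrable_real_mult_indicator[OF _ i, of "cball 0 T"] by (simp add: mult.commute)
    fix \<xi> :: "real ^ 'n"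
    have "T ^ (2 * l) \<le> norm \<xi> ^ (2 * l)" if "\<xi> \<notin> cball 0 T"
      using that T(1) by (intro power_mono) auto
    then show "indicator (cball 0 T) \<xi> * ((norm \<xi> ^ (2 * l) - \<mu>) * ?F \<xi>) \<le> (norm \<xi> ^ (2 * l) - \<mu>) * ?F \<xi>"
      using T(2) by (cases "\<xi> \<in> cball 0 T") auto
  qed (rule i)
  also have "\<dots> = (LINT \<xi>|lborel. ?G \<xi> - \<mu> * ?F \<xi>)"
    by (simp add: algebra_simps)
  also have "\<dots> = (LINT \<xi>|lborel. ?G \<xi>) - \<mu> * (LINT \<xi>|lborel. ?F \<xi>)"
    using iF iG by simp
  also have "(LINT \<xi>|lborel. ?G \<xi>) = (\<Sum>w | length w = l. (2 * pi) ^ CARD('n) * (LINT x|lborel. (partials w \<phi> x)\<^sup>2))"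
    unfolding G by (subst Bochner_Integration.integral_sum)
      (auto simp: P[OF test_function_partials[OF \<phi>]])
  finally show ?thesis
    by (simp add: P(2)[OF \<phi>] algebra_simps sum_distrib_left)
qed

section \<open>Square integrable functions\<close>

text \<open>The condition of \<open>L2_functions\<close> for an arbitrary measure, since the Hilbert
  space arguments below do not involve a domain.\<close>

definition square_integrable :: "'a measure \<Rightarrow> ('a \<Rightarrow> real) \<Rightarrow> bool" where
  "square_integrable M u \<longleftrightarrow> u \<in> borel_measurable M \<and> integrable M (\<lambda>x. (u x)\<^sup>2)"

lemma L2_functions_iff: "u \<in> L2_functions \<Omega> \<longleftrightarrow> square_integrable (lebesgue_on \<Omega>) u"
  by (simp add: L2_functions_def square_integrable_def)

lemma square_integrable_measurable: "square_integrable M u \<Longrightarrow> u \<in> borel_measurable M"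
  by (simp add: square_integrable_def)

lemma square_integrable_mult:
  assumes "square_integrable M u" "square_integrable M v"
  shows "integrable M (\<lambda>x. u x * v x)"
proof (rule Bochner_Integration.integrable_bound)
  show "integrable M (\<lambda>x. (u x)\<^sup>2 + (v x)\<^sup>2)"
    using assms by (simp add: square_integrable_def)
  have "\<bar>a * b\<bar> \<le> a\<^sup>2 + b\<^sup>2" for a b :: real
    using sum_squares_bound[of "\<bar>a\<bar>" "\<bar>b\<bar>"] mult_nonneg_nonneg[of "\<bar>a\<bar>" "\<bar>b\<bar>"]
    unfolding abs_mult power2_abs by linarith
  then show "AE x in M. norm (u x * v x) \<le> norm ((u x)\<^sup>2 + (v x)\<^sup>2)"
    by (intro AE_I2) (metis abs_ge_self order_trans real_norm_def)
qed (use assms in \<open>auto simp: square_integrable_def\<close>)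

lemma square_integrable_scale:
  "square_integrable M u \<Longrightarrow> square_integrable M (\<lambda>x. c * u x)"
  by (auto simp: square_integrable_def power_mult_distrib)

lemma square_integrable_add:
  assumes "square_integrable M u" "square_integrable M v"
  shows "square_integrable M (\<lambda>x. u x + v x)"
proof -
  have "integrable M (\<lambda>x. (u x)\<^sup>2 + (v x)\<^sup>2 + 2 * (u x * v x))"
    using assms square_integrable_mult[OF assms]
    by (intro Bochner_Integration.integrable_add integrable_mult_right) (auto simp: square_integrable_def)
  then show ?thesis
    using assms by (auto simp: square_integrable_def power2_sum algebra_simps)
qed

lemma square_integrable_diff:
  assumes "square_integrable M u" "square_integrable M v"
  shows "square_integrable M (\<lambda>x. u x - v x)"
  using square_integrable_add[OF assms(1) square_integrable_scale[OF assms(2), of "-1"]] by simp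

lemma square_integrable_sum:
  assumes "\<And>i. i \<in> I \<Longrightarrow> square_integrable M (u i)"
  shows "square_integrable M (\<lambda>x. \<Sum>i\<in>I. c i * u i x)"
proof (cases "finite I")
  case True
  then show ?thesis
    using assms
  proof induction
    case empty
    show ?case by (simp add: square_integrable_def)
  next
    case (insert i I)
    then show ?case by (simp add: square_integrable_add square_integrable_scale)
  qed
qed (simp add: square_integrable_def)

lemma square_integrable_bounded:
  assumes "finite_measure M" "u \<in> borel_measurable M" "\<And>x. x \<in> space M \<Longrightarrow> \<bar>u x\<bar> \<le> B"
  shows "square_integrable M u"
proof -
  interpret finite_measure M by fact
  have "(u x)\<^sup>2 \<le> B\<^sup>2" if "x \<in> space M" for x
    using assms(3)[OF that] by (metis abs_ge_zero power2_abs power_mono)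
  then have "integrable M (\<lambda>x. (u x)\<^sup>2)"
    using assms(2) by (intro integrable_const_bound[of _ "B\<^sup>2"] AE_I2) auto
  with assms(2) show ?thesis by (simp add: square_integrable_def)
qed

lemma square_integrable_integrable:
  assumes "finite_measure M" "square_integrable M u"
  shows "integrable M u"
  using square_integrable_mult[OF assms(2) square_integrable_bounded[OF assms(1), of "\<lambda>_. 1" 1]]
  by simp

lemma square_integrable_abs:
  "square_integrable M u \<Longrightarrow> square_integrable M (\<lambda>x. \<bar>u x\<bar>)"
  by (auto simp: square_integrable_def)

lemma Cauchy_Schwarz_integral:
  assumes u: "square_integrable M u" and v: "square_integrable M v"
  shows "(LINT x|M. u x * v x)\<^sup>2 \<le> (LINT x|M. (u x)\<^sup>2) * (LINT x|M. (v x)\<^sup>2)"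
proof -
  let ?a = "LINT x|M. (u x)\<^sup>2" and ?b = "LINT x|M. u x * v x" and ?c = "LINT x|M. (v x)\<^sup>2"
  have q: "0 \<le> s\<^sup>2 * ?a + 2 * s * t * ?b + t\<^sup>2 * ?c" for s t
  proof -
    have "0 \<le> (LINT x|M. (s * u x + t * v x)\<^sup>2)" by simp
    also have "\<dots> = (LINT x|M. s\<^sup>2 * (u x)\<^sup>2 + 2 * s * t * (u x * v x) + t\<^sup>2 * (v x)\<^sup>2)"
      by (intro Bochner_Integration.integral_cong) (auto simp: power2_eq_square algebra_simps)
    also have "\<dots> = s\<^sup>2 * ?a + 2 * s * t * ?b + t\<^sup>2 * ?c"
      using u v square_integrable_mult[OF u v] by (simp add: square_integrable_def)
    finally show ?thesis .
  qed
  have "?a \<ge> 0" "?c \<ge> 0" by simp_all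
  \<comment> \<open>The nonnegative quadratic form at s = \<open>?c\<close>, t = -\<open>?b\<close>,
    which is its minimum direction up to scaling.\<close>
  have "0 \<le> ?c * (?a * ?c - ?b\<^sup>2)"
    using q[of ?c "- ?b"] by (simp add: power2_eq_square algebra_simps)
  moreover have "?b = 0" if "?c = 0"
  proof (rule ccontr)
    assume "?b \<noteq> 0"
    \<comment> \<open>In the degenerate case \<open>?c = 0\<close> the form is affine in t, and this
      t is chosen to give it the value -1.\<close>
    then show False
      using q[of "1" "- (?a + 1) / (2 * ?b)"] that by (simp add: field_simps)
  qed
  ultimately show ?thesis
    using \<open>?c \<ge> 0\<close> by (cases "?c = 0") (auto simp: zero_le_mult_iff)
qed

text \<open>Expanding the square around \<open>g\<close> leaves a cross term that tends to 0 by the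
  Cauchy-Schwarz inequality.\<close>

lemma square_integrable_tendsto_norm:
  assumes f: "\<And>m. square_integrable M (f m)" and g: "square_integrable M g"
    and lim: "(\<lambda>m::nat. LINT x|M. (f m x - g x)\<^sup>2) \<longlonglongrightarrow> 0"
  shows "(\<lambda>m. LINT x|M. (f m x)\<^sup>2) \<longlonglongrightarrow> (LINT x|M. (g x)\<^sup>2)"
proof -
  let ?d = "\<lambda>m x. f m x - g x"
  have d: "square_integrable M (?d m)" for m by (rule square_integrable_diff[OF f g])
  have eq: "(LINT x|M. (f m x)\<^sup>2) = (LINT x|M. (?d m x)\<^sup>2) + 2 * (LINT x|M. ?d m x * g x) + (LINT x|M. (g x)\<^sup>2)" for m
  proof -
    have "(LINT x|M. (f m x)\<^sup>2) = (LINT x|M. (?d m x)\<^sup>2 + 2 * (?d m x * g x) + (g x)\<^sup>2)"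
      by (intro Bochner_Integration.integral_cong) (auto simp: power2_eq_square algebra_simps)
    also have "\<dots> = (LINT x|M. (?d m x)\<^sup>2) + 2 * (LINT x|M. ?d m x * g x) + (LINT x|M. (g x)\<^sup>2)"
      using d[of m] g square_integrable_mult[OF d g, of m] by (simp add: square_integrable_def)
    finally show ?thesis .
  qed
  have "(\<lambda>m. sqrt ((LINT x|M. (?d m x)\<^sup>2) * (LINT x|M. (g x)\<^sup>2))) \<longlonglongrightarrow> sqrt (0 * (LINT x|M. (g x)\<^sup>2))"
    by (intro tendsto_intros lim)
  then have "(\<lambda>m. sqrt ((LINT x|M. (?d m x)\<^sup>2) * (LINT x|M. (g x)\<^sup>2))) \<longlonglongrightarrow> 0" by simp
  then have "(\<lambda>m. LINT x|M. ?d m x * g x) \<longlonglongrightarrow> 0"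
  proof (rule Lim_null_comparison[rotated])
    show "\<forall>\<^sub>F m in sequentially. norm (LINT x|M. ?d m x * g x) \<le> sqrt ((LINT x|M. (?d m x)\<^sup>2) * (LINT x|M. (g x)\<^sup>2))"
      using Cauchy_Schwarz_integral[OF d g]
      by (intro always_eventually allI) (metis real_norm_def real_sqrt_abs real_sqrt_le_mono)
  qed
  then have "(\<lambda>m. (LINT x|M. (?d m x)\<^sup>2) + 2 * (LINT x|M. ?d m x * g x) + (LINT x|M. (g x)\<^sup>2))
      \<longlonglongrightarrow> 0 + 2 * 0 + (LINT x|M. (g x)\<^sup>2)"
    by (intro tendsto_intros lim)
  then show ?thesis unfolding eq by simp
qed

text \<open>Cauchy-Schwarz against the constant 1. Convergence in L1 is what makes Fourier
  transforms converge uniformly.\<close>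

lemma square_integrable_tendsto_L1:
  assumes M: "finite_measure M"
    and f: "\<And>m. square_integrable M (f m)"
    and lim: "(\<lambda>m::nat. LINT x|M. (f m x)\<^sup>2) \<longlonglongrightarrow> 0"
  shows "(\<lambda>m. LINT x|M. \<bar>f m x\<bar>) \<longlonglongrightarrow> 0"
proof -
  have one: "square_integrable M (\<lambda>_. 1)"
    using square_integrable_bounded[OF M, of "\<lambda>_. 1" 1] by simp
  have "(\<lambda>m. sqrt ((LINT x|M. (f m x)\<^sup>2) * (LINT x|M. 1\<^sup>2))) \<longlonglongrightarrow> sqrt (0 * (LINT x|M. 1\<^sup>2))"
    by (intro tendsto_intros lim)
  then have "(\<lambda>m. sqrt ((LINT x|M. (f m x)\<^sup>2) * (LINT x|M. 1\<^sup>2))) \<longlonglongrightarrow> 0" by simp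
  then show ?thesis
  proof (rule Lim_null_comparison[rotated])
    have "\<bar>LINT x|M. \<bar>f m x\<bar> * 1\<bar> \<le> sqrt ((LINT x|M. \<bar>f m x\<bar>\<^sup>2) * (LINT x|M. 1\<^sup>2))" for m
      using Cauchy_Schwarz_integral[OF square_integrable_abs[OF f] one, of m]
      by (metis real_sqrt_abs real_sqrt_le_mono)
    then show "\<forall>\<^sub>F m in sequentially. norm (LINT x|M. \<bar>f m x\<bar>) \<le> sqrt ((LINT x|M. (f m x)\<^sup>2) * (LINT x|M. 1\<^sup>2))"
      by (intro always_eventually allI) simp
  qed
qed

section \<open>Orthonormal systems: Bessel's inequality and orthonormalisation\<close>

definition orthonormal_in :: "'a measure \<Rightarrow> nat \<Rightarrow> (nat \<Rightarrow> 'a \<Rightarrow> real) \<Rightarrow> bool" where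
  "orthonormal_in M m v \<longleftrightarrow> (\<forall>i<m. square_integrable M (v i)) \<and>
     (\<forall>i<m. \<forall>j<m. (LINT x|M. v i x * v j x) = of_bool (i = j))"

lemma integral_mult_lincomb:
  assumes "\<And>i. i < m \<Longrightarrow> square_integrable M (v i)" "square_integrable M e"
  shows "(LINT x|M. e x * (\<Sum>i<m. c i * v i x)) = (\<Sum>i<m. c i * (LINT x|M. e x * v i x))"
proof -
  have "(LINT x|M. e x * (\<Sum>i<m. c i * v i x)) = (LINT x|M. (\<Sum>i<m. c i * (e x * v i x)))"
    by (simp add: sum_distrib_left mult_ac)
  also have "\<dots> = (\<Sum>i<m. LINT x|M. c i * (e x * v i x))"
    using assms by (intro Bochner_Integration.integral_sum integrable_mult_right square_integrable_mult) auto
  finally show ?thesis by simp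
qed

lemma Bessel_integral:
  assumes v: "orthonormal_in M m v" and e: "square_integrable M e"
  shows "(\<Sum>i<m. (LINT x|M. v i x * e x)\<^sup>2) \<le> (LINT x|M. (e x)\<^sup>2)"
proof -
  have vs: "\<And>i. i < m \<Longrightarrow> square_integrable M (v i)" using v by (simp add: orthonormal_in_def)
  define c where "c i = (LINT x|M. e x * v i x)" for i
  define s where "s x = (\<Sum>i<m. c i * v i x)" for x
  have s: "square_integrable M s"
    unfolding s_def[abs_def] using vs by (intro square_integrable_sum) auto
  have es: "(LINT x|M. e x * s x) = (\<Sum>i<m. (c i)\<^sup>2)"
    using integral_mult_lincomb[where v = v and m = m, OF vs e, of c] by (simp add: s_def c_def power2_eq_square)
  have sv: "(LINT x|M. s x * v i x) = c i" if "i < m" for i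
  proof -
    have "(LINT x|M. v i x * s x) = (\<Sum>j<m. c j * (LINT x|M. v i x * v j x))"
      using integral_mult_lincomb[where v = v and m = m and c = c, OF vs vs[OF that]] by (simp only: s_def)
    also have "\<dots> = (\<Sum>j<m. c j * of_bool (i = j))"
      using v that by (intro sum.cong) (auto simp: orthonormal_in_def)
    finally show ?thesis using that by (simp add: mult.commute sum.delta if_distrib of_bool_def cong: if_cong)
  qed
  have ss: "(LINT x|M. s x * s x) = (\<Sum>i<m. (c i)\<^sup>2)"
  proof -
    have "(LINT x|M. s x * (\<Sum>i<m. c i * v i x)) = (\<Sum>i<m. c i * c i)"
      using integral_mult_lincomb[where v = v and m = m and c = c, OF vs s] by (simp add: sv)
    then show ?thesis by (simp add: s_def[symmetric] power2_eq_square)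
  qed
  have "0 \<le> (LINT x|M. (e x - s x)\<^sup>2)" by simp
  also have "\<dots> = (LINT x|M. (e x)\<^sup>2 - 2 * (e x * s x) + s x * s x)"
    by (intro Bochner_Integration.integral_cong) (auto simp: power2_eq_square algebra_simps)
  also have "\<dots> = (LINT x|M. (e x)\<^sup>2) - (\<Sum>i<m. (c i)\<^sup>2)"
    using e square_integrable_mult[OF e s] square_integrable_mult[OF s s]
    by (simp add: square_integrable_def es ss)
  finally show ?thesis by (simp add: c_def mult.commute)
qed

text \<open>The new system is described by its coefficients \<open>a\<close>, so that it visibly
  stays in the span and thus in an eigenspace. Independence is modulo null sets, which is exactly
  what keeps the residual of each step from having norm 0.\<close>

lemma Gram_Schmidt_integral:
  assumes "\<And>i. i < m \<Longrightarrow> square_integrable M (u i)"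
    and "\<And>c. (AE x in M. (\<Sum>i<m. c i * u i x) = 0) \<Longrightarrow> \<forall>i<m. c i = 0"
  shows "\<exists>a. orthonormal_in M m (\<lambda>i x. \<Sum>p<m. a i p * u p x)"
  using assms
proof (induction m)
  case 0
  show ?case by (simp add: orthonormal_in_def)
next
  case (Suc m)
  have us: "\<And>i. i < m \<Longrightarrow> square_integrable M (u i)" and um: "square_integrable M (u m)"
    using Suc.prems(1) by auto
  have "\<forall>i<m. c i = 0" if "AE x in M. (\<Sum>i<m. c i * u i x) = 0" for c
  proof -
    \<comment> \<open>A relation among the first \<open>m\<close> functions is extended by the
      coefficient 0.\<close>
    have "AE x in M. (\<Sum>i<Suc m. (c(m := 0)) i * u i x) = 0"
      using that by eventually_elim simp
    from Suc.prems(2)[OF this] have "(c(m := 0)) i = 0" if "i < m" for i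
      using that less_SucI by blast
    then show ?thesis by (simp add: fun_upd_def)
  qed
  with Suc.IH us obtain a where a: "orthonormal_in M m (\<lambda>i x. \<Sum>p<m. a i p * u p x)" by blast
  define v where "v i x = (\<Sum>p<m. a i p * u p x)" for i x
  have von: "(LINT x|M. v i x * v j x) = of_bool (i = j)" if "i < m" "j < m" for i j
    using a that by (simp add: orthonormal_in_def v_def[symmetric])
  have vs: "\<And>i. i < m \<Longrightarrow> square_integrable M (v i)"
    unfolding v_def[abs_def] using us by (intro square_integrable_sum) auto
  define b where "b i = (LINT x|M. u m x * v i x)" for i
  define w where "w x = u m x - (\<Sum>i<m. b i * v i x)" for x
  have ws: "square_integrable M w"
    unfolding w_def[abs_def] using um vs by (intro square_integrable_diff square_integrable_sum) auto
  \<comment> \<open>Coefficients of the residual \<open>w\<close> in the original functions. The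
    entry 1 at \<open>m\<close> will contradict independence if \<open>w\<close> vanishes almost
    everywhere.\<close>
  define c where "c p = (if p = m then 1 else - (\<Sum>i<m. b i * a i p))" for p
  have wc: "w x = (\<Sum>p<Suc m. c p * u p x)" for x
  proof -
    have "(\<Sum>i<m. b i * v i x) = (\<Sum>p<m. (\<Sum>i<m. b i * a i p) * u p x)"
      unfolding v_def sum_distrib_left sum_distrib_right by (subst sum.swap) (simp add: mult_ac)
    then show ?thesis by (simp add: w_def c_def sum_negf)
  qed
  have wv: "(LINT x|M. w x * v i x) = 0" if "i < m" for i
  proof -
    have "(LINT x|M. w x * v i x) = (LINT x|M. u m x * v i x - v i x * (\<Sum>j<m. b j * v j x))"
      by (intro Bochner_Integration.integral_cong) (auto simp: w_def algebra_simps)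
    also have "\<dots> = b i - (\<Sum>j<m. b j * (LINT x|M. v i x * v j x))"
      using square_integrable_mult[OF um vs[OF that]]
        square_integrable_mult[OF vs[OF that] square_integrable_sum[of "{..<m}" M v b]] vs
      by (subst Bochner_Integration.integral_diff) (auto simp: b_def[symmetric] integral_mult_lincomb[where v = v and m = m and c = b, OF vs vs[OF that]])
    also have "(\<Sum>j<m. b j * (LINT x|M. v i x * v j x)) = (\<Sum>j<m. b j * of_bool (i = j))"
      using von that by (intro sum.cong) auto
    also have "\<dots> = b i"
      using that by (simp add: sum.delta if_distrib of_bool_def cong: if_cong)
    finally show ?thesis by simp
  qed
  define N where "N = (LINT x|M. (w x)\<^sup>2)"
  have N: "N > 0"
  proof (rule ccontr)
    assume "\<not> N > 0"
    moreover have "N \<ge> 0" by (simp add: N_def)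
    ultimately have "N = 0" by linarith
    then have "AE x in M. (w x)\<^sup>2 = 0"
      unfolding N_def using ws by (subst (asm) integral_nonneg_eq_0_iff_AE) (auto simp: square_integrable_def)
    then have "AE x in M. (\<Sum>p<Suc m. c p * u p x) = 0"
      unfolding wc by simp
    from Suc.prems(2)[OF this] show False by (auto simp: c_def)
  qed
  \<comment> \<open>The old rows are padded by 0; the last row is the normalised residual.\<close>
  define a' where "a' i p = (if i < m then if p < m then a i p else 0 else c p / sqrt N)" for i p
  have a'v: "(\<Sum>p<Suc m. a' i p * u p x) = v i x" if "i < m" for i x
    using that by (simp add: a'_def v_def)
  have a'w: "(\<Sum>p<Suc m. a' m p * u p x) = w x / sqrt N" for x
    unfolding wc by (simp add: a'_def sum_divide_distrib add_divide_distrib)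
  have "orthonormal_in M (Suc m) (\<lambda>i x. \<Sum>p<Suc m. a' i p * u p x)"
    unfolding orthonormal_in_def
  proof (intro conjI allI impI)
    fix i assume "i < Suc m"
    show "square_integrable M (\<lambda>x. \<Sum>p<Suc m. a' i p * u p x)"
      using Suc.prems(1) by (intro square_integrable_sum) auto
    fix j assume "j < Suc m"
    have ww: "(LINT x|M. w x / sqrt N * (w x / sqrt N)) = 1"
    proof -
      have "(LINT x|M. w x / sqrt N * (w x / sqrt N)) = (LINT x|M. (w x)\<^sup>2 / N)"
        using N by (simp add: power2_eq_square)
      then show ?thesis using N by (simp add: N_def)
    qed
    consider "i < m" "j < m" | "i = m" "j < m" | "i < m" "j = m" | "i = m" "j = m"
      using \<open>i < Suc m\<close> \<open>j < Suc m\<close> by linarith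
    then show "(LINT x|M. (\<Sum>p<Suc m. a' i p * u p x) * (\<Sum>p<Suc m. a' j p * u p x)) = of_bool (i = j)"
    proof cases
      case 1 then show ?thesis by (simp only: a'v von)
    next
      case 2 then show ?thesis unfolding \<open>i = m\<close> a'w a'v[OF 2(2)] using wv[of j] by simp
    next
      case 3 then show ?thesis unfolding \<open>j = m\<close> a'w a'v[OF 3(1)] using wv[of i] by (simp add: mult.commute)
    next
      case 4 then show ?thesis unfolding \<open>i = m\<close> \<open>j = m\<close> a'w ww by simp
    qed
  qed
  then show ?case by blast
qed

section \<open>Sobolev spaces and eigenspaces\<close>

lemma finite_measure_lebesgue_on_bounded_open:
  fixes \<Omega> :: "(real ^ 'n::finite) set"
  assumes "open \<Omega>" "bounded \<Omega>"
  shows "finite_measure (lebesgue_on \<Omega>)"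
  using assms by (intro finite_measure_lebesgue_on lmeasurable_open)

text \<open>Connects the two settings: Sobolev spaces use Lebesgue measure on the domain,
  Plancherel's formula uses \<open>lborel\<close> on the whole space.\<close>

lemma lebesgue_on_integral_eq_lborel:
  fixes g :: "'a::euclidean_space \<Rightarrow> 'b::{banach,second_countable_topology}"
  assumes "open \<Omega>" "g \<in> borel_measurable borel" "\<And>x. x \<notin> \<Omega> \<Longrightarrow> g x = 0"
  shows "(LINT x|lebesgue_on \<Omega>. g x) = (LINT x|lborel. g x)"
proof -
  have O: "\<Omega> \<inter> space lebesgue \<in> sets lebesgue" using assms(1) by auto
  have "(LINT x|lebesgue_on \<Omega>. g x) = (LINT x|lebesgue. indicator \<Omega> x *\<^sub>R g x)"
    by (rule integral_restrict_space[OF O])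
  also have "\<dots> = (LINT x|lebesgue. g x)"
    using assms(3) by (intro Bochner_Integration.integral_cong) (auto simp: indicator_def)
  also have "\<dots> = (LINT x|lborel. g x)"
    using assms(2) by (intro integral_completion) simp
  finally show ?thesis .
qed

lemma partial_lincomb:
  fixes f g :: "real ^ 'n::finite \<Rightarrow> real"
  assumes "\<And>x. f differentiable (at x)" "\<And>x. g differentiable (at x)"
  shows "partial i (\<lambda>x. a * f x + b * g x) = (\<lambda>x. a * partial i f x + b * partial i g x)"
proof
  fix x
  have "(f has_derivative frechet_derivative f (at x)) (at x)" "(g has_derivative frechet_derivative g (at x)) (at x)"
    using assms by (simp_all add: frechet_derivative_works)
  then have "((\<lambda>x. a * f x + b * g x) has_derivative
      (\<lambda>h. a * frechet_derivative f (at x) h + b * frechet_derivative g (at x) h)) (at x)"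
    by (auto intro!: derivative_eq_intros)
  then show "partial i (\<lambda>x. a * f x + b * g x) x = a * partial i f x + b * partial i g x"
    by (simp add: partial_eq) (simp add: partial_def)
qed

lemma partials_lincomb:
  assumes "smooth_fun f" "smooth_fun g"
  shows "partials w (\<lambda>x. a * f x + b * g x) = (\<lambda>x. a * partials w f x + b * partials w g x)"
  using assms
  by (induction w) (simp_all add: partials_Cons partial_lincomb smooth_fun_def)

lemma test_function_lincomb:
  assumes "\<phi> \<in> test_functions \<Omega>" "\<psi> \<in> test_functions \<Omega>"
  shows "(\<lambda>x. a * \<phi> x + b * \<psi> x) \<in> test_functions \<Omega>"
proof -
  let ?K = "closure {x. \<phi> x \<noteq> 0} \<union> closure {x. \<psi> x \<noteq> 0}"
  have s: "smooth_fun \<phi>" "smooth_fun \<psi>" and K: "compact ?K" "?K \<subseteq> \<Omega>"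
    using assms by (auto simp: test_functions_def)
  have sub: "closure {x. a * \<phi> x + b * \<psi> x \<noteq> 0} \<subseteq> ?K"
    unfolding closure_Un[symmetric] by (intro closure_mono) auto
  have "compact (closure {x. a * \<phi> x + b * \<psi> x \<noteq> 0})"
    using compact_Int_closed[OF K(1) closed_closure, of "{x. a * \<phi> x + b * \<psi> x \<noteq> 0}"] sub
    by (simp add: Int_absorb1)
  moreover have "smooth_fun (\<lambda>x. a * \<phi> x + b * \<psi> x)"
    using s unfolding smooth_fun_def partials_lincomb[OF s]
    by (auto intro!: derivative_intros)
  ultimately show ?thesis
    using subset_trans[OF sub K(2)] by (simp add: test_functions_def)
qed

context
  fixes \<Omega> :: "(real ^ 'n::finite) set"
  assumes \<Omega>: "open \<Omega>" "bounded \<Omega>"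
begin

lemma finite_Omega: "finite_measure (lebesgue_on \<Omega>)"
  using \<Omega> by (rule finite_measure_lebesgue_on_bounded_open)

lemma test_function_square_integrable:
  assumes "\<phi> \<in> test_functions \<Omega>"
  shows "square_integrable (lebesgue_on \<Omega>) (partials w \<phi>)"
proof -
  obtain B where "\<And>x. \<bar>partials w \<phi> x\<bar> \<le> B" using test_function_bounded[OF assms] by blast
  then show ?thesis
    by (intro square_integrable_bounded[OF finite_Omega, of _ B] test_function_measurable[OF assms])
qed

text \<open>Tested against any test function the difference of two candidates gives 0, so the
  fundamental lemma applies. This is what makes the arbitrary choice in
  \<open>weak_derivative\<close> manageable.\<close>

lemma weak_derivative_unique:
  assumes "has_weak_derivative \<Omega> w u g" "has_weak_derivative \<Omega> w u h"
    and L: "g \<in> L2_functions \<Omega>" "h \<in> L2_functions \<Omega>"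
  shows "AE x in lebesgue_on \<Omega>. g x = h x"
proof -
  have s: "square_integrable (lebesgue_on \<Omega>) g" "square_integrable (lebesgue_on \<Omega>) h"
    using L by (simp_all add: L2_functions_iff)
  have "AE x in lebesgue_on \<Omega>. g x - h x = 0"
  proof (rule AE_zero_of_test_integrals[OF \<Omega>(1)])
    show "integrable (lebesgue_on \<Omega>) (\<lambda>x. g x - h x)"
      by (rule square_integrable_integrable[OF finite_Omega square_integrable_diff[OF s]])
    fix \<phi> assume \<phi>: "\<phi> \<in> test_functions \<Omega>"
    have p: "square_integrable (lebesgue_on \<Omega>) \<phi>"
      using test_function_square_integrable[OF \<phi>, of "[]"] by simp
    have "(LINT x|lebesgue_on \<Omega>. g x * \<phi> x) = (LINT x|lebesgue_on \<Omega>. h x * \<phi> x)"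
      using assms(1,2) \<phi> by (auto simp: has_weak_derivative_def)
    then show "(LINT x|lebesgue_on \<Omega>. (g x - h x) * \<phi> x) = 0"
      using square_integrable_mult[OF s(1) p] square_integrable_mult[OF s(2) p]
      by (simp add: left_diff_distrib)
  qed
  then show ?thesis by simp
qed

lemma weak_derivative:
  assumes "u \<in> sobolev l \<Omega>" "length w \<le> l"
  shows "weak_derivative \<Omega> w u \<in> L2_functions \<Omega>" "has_weak_derivative \<Omega> w u (weak_derivative \<Omega> w u)"
proof -
  have "\<exists>g. g \<in> L2_functions \<Omega> \<and> has_weak_derivative \<Omega> w u g"
    using assms by (auto simp: sobolev_def)
  from someI_ex[OF this] show "weak_derivative \<Omega> w u \<in> L2_functions \<Omega>"
    "has_weak_derivative \<Omega> w u (weak_derivative \<Omega> w u)"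
    by (auto simp: weak_derivative_def)
qed

text \<open>The empty word is among those in \<open>sobolev0\<close>; this lemma turns its clause
  into L2 convergence to \<open>u\<close> itself.\<close>

lemma weak_derivative_Nil:
  assumes "u \<in> sobolev l \<Omega>"
  shows "AE x in lebesgue_on \<Omega>. weak_derivative \<Omega> [] u x = u x"
proof (rule weak_derivative_unique)
  show "has_weak_derivative \<Omega> [] u u" by (simp add: has_weak_derivative_def)
qed (use assms in \<open>auto intro!: weak_derivative[OF assms] simp: sobolev_def\<close>)

lemma has_weak_derivative_lincomb:
  assumes "has_weak_derivative \<Omega> w u g" "has_weak_derivative \<Omega> w v h"
    and "u \<in> L2_functions \<Omega>" "v \<in> L2_functions \<Omega>" "g \<in> L2_functions \<Omega>" "h \<in> L2_functions \<Omega>"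
  shows "has_weak_derivative \<Omega> w (\<lambda>x. a * u x + b * v x) (\<lambda>x. a * g x + b * h x)"
  unfolding has_weak_derivative_def
proof
  fix \<phi> assume \<phi>: "\<phi> \<in> test_functions \<Omega>"
  have lin: "(LINT x|lebesgue_on \<Omega>. (a * f x + b * k x) * p x) =
      a * (LINT x|lebesgue_on \<Omega>. f x * p x) + b * (LINT x|lebesgue_on \<Omega>. k x * p x)"
    if "f \<in> L2_functions \<Omega>" "k \<in> L2_functions \<Omega>" "square_integrable (lebesgue_on \<Omega>) p" for f k p
  proof -
    have "integrable (lebesgue_on \<Omega>) (\<lambda>x. f x * p x)" "integrable (lebesgue_on \<Omega>) (\<lambda>x. k x * p x)"
      using that by (auto simp: L2_functions_iff intro: square_integrable_mult)
    then show ?thesis by (simp add: distrib_right mult.assoc)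
  qed
  have "(LINT x|lebesgue_on \<Omega>. u x * partials w \<phi> x) = (-1) ^ length w * (LINT x|lebesgue_on \<Omega>. g x * \<phi> x)"
    "(LINT x|lebesgue_on \<Omega>. v x * partials w \<phi> x) = (-1) ^ length w * (LINT x|lebesgue_on \<Omega>. h x * \<phi> x)"
    using assms(1,2) \<phi> by (auto simp: has_weak_derivative_def)
  then show "(LINT x|lebesgue_on \<Omega>. (a * u x + b * v x) * partials w \<phi> x) =
      (-1) ^ length w * (LINT x|lebesgue_on \<Omega>. (a * g x + b * h x) * \<phi> x)"
    using lin[OF assms(3,4) test_function_square_integrable[OF \<phi>, of w]]
      lin[OF assms(5,6) test_function_square_integrable[OF \<phi>, of "[]"]]
    by (simp add: algebra_simps)
qed

lemma L2_functions_lincomb: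
  "u \<in> L2_functions \<Omega> \<Longrightarrow> v \<in> L2_functions \<Omega> \<Longrightarrow> (\<lambda>x. a * u x + b * v x) \<in> L2_functions \<Omega>"
  by (simp add: L2_functions_iff square_integrable_add square_integrable_scale)

text \<open>The linear combination of weak derivatives is a weak derivative of the combination, but
  \<open>weak_derivative\<close> may have selected another representative; hence linearity only
  almost everywhere.\<close>

lemma sobolev_lincomb:
  assumes u: "u \<in> sobolev l \<Omega>" and v: "v \<in> sobolev l \<Omega>"
  shows "(\<lambda>x. a * u x + b * v x) \<in> sobolev l \<Omega>" (is "?s \<in> _")
    and "length w \<le> l \<Longrightarrow> AE x in lebesgue_on \<Omega>.
      weak_derivative \<Omega> w (\<lambda>x. a * u x + b * v x) x = a * weak_derivative \<Omega> w u x + b * weak_derivative \<Omega> w v x"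
proof -
  have L: "u \<in> L2_functions \<Omega>" "v \<in> L2_functions \<Omega>"
    using u v by (auto simp: sobolev_def)
  let ?D = "\<lambda>w x. a * weak_derivative \<Omega> w u x + b * weak_derivative \<Omega> w v x"
  have D: "?D w \<in> L2_functions \<Omega>" "has_weak_derivative \<Omega> w ?s (?D w)" if "length w \<le> l" for w
    using weak_derivative[OF u that] weak_derivative[OF v that] L
    by (auto intro: L2_functions_lincomb has_weak_derivative_lincomb)
  show s: "?s \<in> sobolev l \<Omega>"
    using L D by (auto simp: sobolev_def intro!: L2_functions_lincomb)
  show "AE x in lebesgue_on \<Omega>. weak_derivative \<Omega> w ?s x = ?D w x" if "length w \<le> l"
    using that by (intro weak_derivative_unique[OF _ D(2)] weak_derivative[OF s] D(1))
qed

lemma sobolev0_lincomb: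
  assumes u: "u \<in> sobolev0 l \<Omega>" and v: "v \<in> sobolev0 l \<Omega>"
  shows "(\<lambda>x. a * u x + b * v x) \<in> sobolev0 l \<Omega>"
proof -
  let ?M = "lebesgue_on \<Omega>" and ?s = "\<lambda>x. a * u x + b * v x"
  obtain \<phi> where \<phi>: "\<And>m. \<phi> m \<in> test_functions \<Omega>" "\<And>w. length w \<le> l \<Longrightarrow>
      (\<lambda>m::nat. LINT x|?M. (partials w (\<phi> m) x - weak_derivative \<Omega> w u x)\<^sup>2) \<longlonglongrightarrow> 0"
    using u unfolding sobolev0_def by blast
  obtain \<psi> where \<psi>: "\<And>m. \<psi> m \<in> test_functions \<Omega>" "\<And>w. length w \<le> l \<Longrightarrow>
      (\<lambda>m::nat. LINT x|?M. (partials w (\<psi> m) x - weak_derivative \<Omega> w v x)\<^sup>2) \<longlonglongrightarrow> 0"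
    using v unfolding sobolev0_def by blast
  have S: "u \<in> sobolev l \<Omega>" "v \<in> sobolev l \<Omega>" using u v by (auto simp: sobolev0_def)
  define \<eta> where "\<eta> m x = a * \<phi> m x + b * \<psi> m x" for m x
  have \<eta>: "\<eta> m \<in> test_functions \<Omega>" for m
    unfolding \<eta>_def using \<phi>(1) \<psi>(1) by (rule test_function_lincomb)
  have "(\<lambda>m. LINT x|?M. (partials w (\<eta> m) x - weak_derivative \<Omega> w ?s x)\<^sup>2) \<longlonglongrightarrow> 0" if w: "length w \<le> l" for w
  proof -
    let ?f = "\<lambda>m x. partials w (\<phi> m) x - weak_derivative \<Omega> w u x"
    let ?g = "\<lambda>m x. partials w (\<psi> m) x - weak_derivative \<Omega> w v x"
    have fg: "square_integrable ?M (?f m)" "square_integrable ?M (?g m)" for m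
      using weak_derivative(1)[OF S(1) w] weak_derivative(1)[OF S(2) w]
      by (auto simp: L2_functions_iff intro!: square_integrable_diff test_function_square_integrable \<phi> \<psi>)
    have p: "partials w (\<eta> m) x = a * partials w (\<phi> m) x + b * partials w (\<psi> m) x" for m x
      unfolding \<eta>_def using \<phi>(1)[of m] \<psi>(1)[of m]
      by (subst partials_lincomb) (auto simp: test_functions_def)
    have "(LINT x|?M. (partials w (\<eta> m) x - weak_derivative \<Omega> w ?s x)\<^sup>2)
       = (LINT x|?M. (a * ?f m x + b * ?g m x)\<^sup>2)" for m
    proof (rule integral_cong_AE)
      show "(\<lambda>x. (partials w (\<eta> m) x - weak_derivative \<Omega> w ?s x)\<^sup>2) \<in> borel_measurable ?M"
        using weak_derivative(1)[OF sobolev_lincomb(1)[OF S, of a b] w] test_function_measurable(2)[OF \<eta>, of w m]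
        by (auto simp: L2_functions_def)
      show "(\<lambda>x. (a * ?f m x + b * ?g m x)\<^sup>2) \<in> borel_measurable ?M"
        using fg[THEN square_integrable_measurable, of m] by auto
      show "AE x in ?M. (partials w (\<eta> m) x - weak_derivative \<Omega> w ?s x)\<^sup>2 = (a * ?f m x + b * ?g m x)\<^sup>2"
        using sobolev_lincomb(2)[OF S w, of a b] by eventually_elim (simp add: p algebra_simps)
    qed
    also have "\<dots> m \<le> 2 * a\<^sup>2 * (LINT x|?M. (?f m x)\<^sup>2) + 2 * b\<^sup>2 * (LINT x|?M. (?g m x)\<^sup>2)" for m
    proof -
      have "(LINT x|?M. (a * ?f m x + b * ?g m x)\<^sup>2) \<le> (LINT x|?M. 2 * a\<^sup>2 * (?f m x)\<^sup>2 + 2 * b\<^sup>2 * (?g m x)\<^sup>2)"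
      proof (rule integral_mono)
        show "integrable ?M (\<lambda>x. (a * ?f m x + b * ?g m x)\<^sup>2)"
          using square_integrable_add[OF square_integrable_scale[OF fg(1), of a] square_integrable_scale[OF fg(2), of b]]
          by (simp add: square_integrable_def)
        show "integrable ?M (\<lambda>x. 2 * a\<^sup>2 * (?f m x)\<^sup>2 + 2 * b\<^sup>2 * (?g m x)\<^sup>2)"
          using fg[of m] by (intro Bochner_Integration.integrable_add integrable_mult_right) (auto simp: square_integrable_def)
        have "(s + t)\<^sup>2 \<le> 2 * s\<^sup>2 + 2 * t\<^sup>2" for s t :: real
          using zero_le_power2[of "s - t"] by (simp add: power2_eq_square algebra_simps)
        from this[of "a * ?f m x" "b * ?g m x" for x]
        show "(a * ?f m x + b * ?g m x)\<^sup>2 \<le> 2 * a\<^sup>2 * (?f m x)\<^sup>2 + 2 * b\<^sup>2 * (?g m x)\<^sup>2" for x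
          by (simp add: power_mult_distrib mult.assoc)
      qed
      also have "\<dots> = 2 * a\<^sup>2 * (LINT x|?M. (?f m x)\<^sup>2) + 2 * b\<^sup>2 * (LINT x|?M. (?g m x)\<^sup>2)"
        using fg[of m] by (simp add: square_integrable_def)
      finally show ?thesis .
    qed
    finally have le: "(LINT x|?M. (partials w (\<eta> m) x - weak_derivative \<Omega> w ?s x)\<^sup>2)
        \<le> 2 * a\<^sup>2 * (LINT x|?M. (?f m x)\<^sup>2) + 2 * b\<^sup>2 * (LINT x|?M. (?g m x)\<^sup>2)" for m .
    have "(\<lambda>m. 2 * a\<^sup>2 * (LINT x|?M. (?f m x)\<^sup>2) + 2 * b\<^sup>2 * (LINT x|?M. (?g m x)\<^sup>2)) \<longlonglongrightarrow> 2 * a\<^sup>2 * 0 + 2 * b\<^sup>2 * 0"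
      by (intro tendsto_intros \<phi>(2) \<psi>(2) w)
    then have "(\<lambda>m. 2 * a\<^sup>2 * (LINT x|?M. (?f m x)\<^sup>2) + 2 * b\<^sup>2 * (LINT x|?M. (?g m x)\<^sup>2)) \<longlonglongrightarrow> 0" by simp
    then show ?thesis
      by (rule Lim_null_comparison[rotated]) (intro always_eventually allI, simp add: le)
  qed
  then show ?thesis
    using \<eta> sobolev_lincomb(1)[OF S] unfolding sobolev0_def by blast
qed

lemma polylaplace_form_integrable:
  assumes "u \<in> sobolev l \<Omega>" "v \<in> sobolev l \<Omega>" "length w \<le> l"
  shows "integrable (lebesgue_on \<Omega>) (\<lambda>x. weak_derivative \<Omega> w u x * weak_derivative \<Omega> w v x)"
  using weak_derivative(1)[OF assms(1,3)] weak_derivative(1)[OF assms(2,3)]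
  by (auto simp: L2_functions_iff intro: square_integrable_mult)

lemma polylaplace_form_lincomb:
  assumes S: "u \<in> sobolev l \<Omega>" "v \<in> sobolev l \<Omega>" and z: "z \<in> sobolev l \<Omega>"
  shows "polylaplace_form l \<Omega> (\<lambda>x. a * u x + b * v x) z = a * polylaplace_form l \<Omega> u z + b * polylaplace_form l \<Omega> v z"
  unfolding polylaplace_form_def sum_distrib_left sum.distrib[symmetric]
proof (intro sum.cong refl)
  fix w :: "'n list" assume "w \<in> {w. length w = l}"
  then have w: "length w \<le> l" by simp
  let ?M = "lebesgue_on \<Omega>" and ?D = "weak_derivative \<Omega> w" and ?s = "\<lambda>x. a * u x + b * v x"
  have "(LINT x|?M. ?D ?s x * ?D z x) = (LINT x|?M. a * (?D u x * ?D z x) + b * (?D v x * ?D z x))"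
  proof (rule integral_cong_AE)
    show "AE x in ?M. ?D ?s x * ?D z x = a * (?D u x * ?D z x) + b * (?D v x * ?D z x)"
      using sobolev_lincomb(2)[OF S w, of a b] by eventually_elim (simp add: algebra_simps)
  qed (use polylaplace_form_integrable[OF sobolev_lincomb(1)[OF S, of a b] z w]
        polylaplace_form_integrable[OF S(1) z w] polylaplace_form_integrable[OF S(2) z w] in auto)
  then show "(LINT x|?M. ?D ?s x * ?D z x) = a * (LINT x|?M. ?D u x * ?D z x) + b * (LINT x|?M. ?D v x * ?D z x)"
    using polylaplace_form_integrable[OF S(1) z w] polylaplace_form_integrable[OF S(2) z w] by simp
qed

lemma sobolev0_L2: "u \<in> sobolev0 l \<Omega> \<Longrightarrow> square_integrable (lebesgue_on \<Omega>) u"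
  by (auto simp: sobolev0_def sobolev_def L2_functions_iff)

lemma eigenspace_L2: "u \<in> dirichlet_eigenspace l \<Omega> t \<Longrightarrow> square_integrable (lebesgue_on \<Omega>) u"
  by (auto simp: dirichlet_eigenspace_def intro: sobolev0_L2)

lemma eigenspace_lincomb:
  assumes u: "u \<in> dirichlet_eigenspace l \<Omega> t" and v: "v \<in> dirichlet_eigenspace l \<Omega> t"
  shows "(\<lambda>x. a * u x + b * v x) \<in> dirichlet_eigenspace l \<Omega> t"
proof -
  have S: "u \<in> sobolev0 l \<Omega>" "v \<in> sobolev0 l \<Omega>" using u v by (auto simp: dirichlet_eigenspace_def)
  have "polylaplace_form l \<Omega> (\<lambda>x. a * u x + b * v x) z = t * (LINT x|lebesgue_on \<Omega>. (a * u x + b * v x) * z x)"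
    if z: "z \<in> sobolev0 l \<Omega>" for z
  proof -
    have "integrable (lebesgue_on \<Omega>) (\<lambda>x. u x * z x)" "integrable (lebesgue_on \<Omega>) (\<lambda>x. v x * z x)"
      using S z by (auto intro: square_integrable_mult sobolev0_L2)
    then have "(LINT x|lebesgue_on \<Omega>. (a * u x + b * v x) * z x)
        = a * (LINT x|lebesgue_on \<Omega>. u x * z x) + b * (LINT x|lebesgue_on \<Omega>. v x * z x)"
      by (simp add: distrib_right mult.assoc)
    moreover have "polylaplace_form l \<Omega> u z = t * (LINT x|lebesgue_on \<Omega>. u x * z x)"
      "polylaplace_form l \<Omega> v z = t * (LINT x|lebesgue_on \<Omega>. v x * z x)"
      using u v z by (auto simp: dirichlet_eigenspace_def)
    ultimately show ?thesis
      using polylaplace_form_lincomb[of u l v z a b] S z by (simp add: sobolev0_def algebra_simps)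
  qed
  with sobolev0_lincomb[OF S] show ?thesis by (simp add: dirichlet_eigenspace_def)
qed

lemma eigenspace_sum:
  assumes "\<And>i. i < (m::nat) \<Longrightarrow> u i \<in> dirichlet_eigenspace l \<Omega> t" "m > 0"
  shows "(\<lambda>x. \<Sum>i<m. c i * u i x) \<in> dirichlet_eigenspace l \<Omega> t"
  using assms(2,1)
proof (induction m rule: nat_induct_non_zero)
  case 1
  \<comment> \<open>A single multiple is obtained as a combination whose second term has coefficient
    0.\<close>
  then show ?case using eigenspace_lincomb[of "u 0" l t "u 0" "c 0" 0] by simp
next
  case (Suc m)
  then show ?case using eigenspace_lincomb[of "\<lambda>x. \<Sum>i<m. c i * u i x" l t "u m" 1 "c m"] by simp
qed

text \<open>The form is symmetric, so it can be evaluated with either function in the role of the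
  eigenfunction, which produces both factors \<open>s\<close> and \<open>t\<close>.\<close>

lemma eigenspaces_orthogonal:
  assumes u: "u \<in> dirichlet_eigenspace l \<Omega> s" and v: "v \<in> dirichlet_eigenspace l \<Omega> t" and "s \<noteq> t"
  shows "(LINT x|lebesgue_on \<Omega>. u x * v x) = 0"
proof -
  have "polylaplace_form l \<Omega> u v = polylaplace_form l \<Omega> v u"
    by (simp add: polylaplace_form_def mult.commute)
  then have "s * (LINT x|lebesgue_on \<Omega>. u x * v x) = t * (LINT x|lebesgue_on \<Omega>. u x * v x)"
    using u v by (auto simp: dirichlet_eigenspace_def mult.commute)
  with \<open>s \<noteq> t\<close> show ?thesis by simp
qed

section \<open>The energy inequality in frequency space\<close>

lemma fourier_test_function:
  assumes "\<phi> \<in> test_functions \<Omega>"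
  shows "fourier (lebesgue_on \<Omega>) \<phi> \<xi> = fourier lborel \<phi> \<xi>"
  unfolding fourier_def
  using test_function_measurable(1)[OF assms, of "[]"] test_function_zero_outside[OF assms]
  by (intro lebesgue_on_integral_eq_lborel \<Omega>(1)) auto

lemma test_function_integral_square:
  assumes "\<phi> \<in> test_functions \<Omega>"
  shows "(LINT x|lebesgue_on \<Omega>. (partials w \<phi> x)\<^sup>2) = (LINT x|lborel. (partials w \<phi> x)\<^sup>2)"
  using test_function_measurable(1)[OF assms, of w] test_function_zero_outside[OF test_function_partials[OF assms, of w]]
  by (intro lebesgue_on_integral_eq_lborel \<Omega>(1)) auto

lemma cis_inner_measurable_on [measurable]:
  "(\<lambda>x. cis (- (\<xi> \<bullet> x))) \<in> borel_measurable (lebesgue_on \<Omega>)"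
  by (intro measurable_restrict_space1 measurable_completion) simp

lemma fourier_measurable_on:
  assumes "integrable (lebesgue_on \<Omega>) f"
  shows "fourier (lebesgue_on \<Omega>) f \<in> borel_measurable borel"
  by (intro borel_measurable_continuous_onI continuous_fourier assms cis_inner_measurable_on)

lemma fourier_diff:
  assumes "integrable (lebesgue_on \<Omega>) f" "integrable (lebesgue_on \<Omega>) g"
  shows "fourier (lebesgue_on \<Omega>) (\<lambda>x. f x - g x) \<xi> = fourier (lebesgue_on \<Omega>) f \<xi> - fourier (lebesgue_on \<Omega>) g \<xi>"
  unfolding fourier_def
  using fourier_integrable[OF assms(1) cis_inner_measurable_on] fourier_integrable[OF assms(2) cis_inner_measurable_on]
  by (simp add: left_diff_distrib)

text \<open>Limit of the inequality for test functions. On a bounded domain L2 convergence implies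
  L1 convergence, hence uniform convergence of the transforms, and the integrals over the ball
  converge by domination. The right-hand sides converge because every derivative up to order
  \<open>l\<close> converges in L2.\<close>

theorem sobolev0_energy:
  assumes u: "u \<in> sobolev0 l \<Omega>" and T: "0 \<le> T" "\<mu> \<le> T ^ (2 * l)"
  shows "(LINT \<xi>|lborel. indicator (cball 0 T) \<xi> * ((norm \<xi> ^ (2 * l) - \<mu>) * (norm (fourier (lebesgue_on \<Omega>) u \<xi>))\<^sup>2))
     \<le> (2 * pi) ^ CARD('n) * (polylaplace_form l \<Omega> u u - \<mu> * (LINT x|lebesgue_on \<Omega>. (u x)\<^sup>2))"
proof -
  let ?M = "lebesgue_on \<Omega>" and ?D = "\<lambda>w. weak_derivative \<Omega> w u"
  obtain \<phi> where \<phi>: "\<And>m. \<phi> m \<in> test_functions \<Omega>" and lim: "\<And>w. length w \<le> l \<Longrightarrow>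
      (\<lambda>m::nat. LINT x|?M. (partials w (\<phi> m) x - ?D w x)\<^sup>2) \<longlonglongrightarrow> 0"
    using u unfolding sobolev0_def by blast
  have uS: "u \<in> sobolev l \<Omega>" using u by (auto simp: sobolev0_def)
  have u2: "square_integrable ?M u" using u by (rule sobolev0_L2)
  have u1: "integrable ?M u" by (rule square_integrable_integrable[OF finite_Omega u2])
  have \<phi>2: "square_integrable ?M (\<phi> m)" for m
    using test_function_square_integrable[OF \<phi>, of "[]" m] by simp
  have \<phi>1: "integrable ?M (\<phi> m)" for m by (rule square_integrable_integrable[OF finite_Omega \<phi>2])
  have \<phi>u2: "square_integrable ?M (\<lambda>x. \<phi> m x - u x)" for m
    by (rule square_integrable_diff[OF \<phi>2 u2])
  have D2: "square_integrable ?M (?D w)" if "length w \<le> l" for w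
    using weak_derivative(1)[OF uS that] by (simp add: L2_functions_iff)
  have lim0: "(\<lambda>m. LINT x|?M. (\<phi> m x - u x)\<^sup>2) \<longlonglongrightarrow> 0"
  proof -
    have "(LINT x|?M. (partials [] (\<phi> m) x - ?D [] x)\<^sup>2) = (LINT x|?M. (\<phi> m x - u x)\<^sup>2)" for m
    proof (rule integral_cong_AE)
      show "AE x in ?M. (partials [] (\<phi> m) x - ?D [] x)\<^sup>2 = (\<phi> m x - u x)\<^sup>2"
        using weak_derivative_Nil[OF uS] by eventually_elim simp
    qed (use D2[of "[]", THEN square_integrable_measurable] u2[THEN square_integrable_measurable]
          \<phi>2[THEN square_integrable_measurable, of m] in auto)
    then show ?thesis using lim[of "[]"] by simp
  qed
  let ?F = "fourier ?M u" and ?Fm = "\<lambda>m. fourier ?M (\<phi> m)"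
  have L1: "(\<lambda>m. LINT x|?M. \<bar>\<phi> m x - u x\<bar>) \<longlonglongrightarrow> 0"
    by (rule square_integrable_tendsto_L1[OF finite_Omega \<phi>u2 lim0])
  have dF: "norm (?Fm m \<xi> - ?F \<xi>) \<le> (LINT x|?M. \<bar>\<phi> m x - u x\<bar>)" for m \<xi>
    using norm_fourier_le[of ?M "\<lambda>x. \<phi> m x - u x" \<xi>] by (simp add: fourier_diff[OF \<phi>1 u1])
  have Flim: "(\<lambda>m. ?Fm m \<xi>) \<longlonglongrightarrow> ?F \<xi>" for \<xi>
    by (rule LIM_zero_cancel, rule Lim_null_comparison[OF _ L1]) (intro always_eventually allI dF)
  have [measurable]: "?F \<in> borel_measurable borel" "?Fm m \<in> borel_measurable borel" for m
    by (intro fourier_measurable_on u1 \<phi>1)+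
  obtain K where K: "\<And>m. norm (LINT x|?M. \<bar>\<phi> m x - u x\<bar>) \<le> K"
    using convergent_imp_Bseq[OF convergentI[OF L1]] by (auto simp: Bseq_def)
  define C where "C = K + (LINT x|?M. \<bar>u x\<bar>)"
  have Fb: "norm (?Fm m \<xi>) \<le> C" for m \<xi>
  proof -
    have "norm (?Fm m \<xi>) \<le> norm (?Fm m \<xi> - ?F \<xi>) + norm (?F \<xi>)"
      using norm_triangle_ineq[of "?Fm m \<xi> - ?F \<xi>" "?F \<xi>"] by simp
    also have "\<dots> \<le> K + (LINT x|?M. \<bar>u x\<bar>)"
      using dF[of m \<xi>] K[of m] norm_fourier_le[of ?M u \<xi>] by (intro add_mono) auto
    finally show ?thesis by (simp add: C_def)
  qed
  let ?i = "indicator (cball 0 T) :: real ^ 'n \<Rightarrow> real"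
  have lhs: "(\<lambda>m. LINT \<xi>|lborel. ?i \<xi> * ((norm \<xi> ^ (2 * l) - \<mu>) * (norm (?Fm m \<xi>))\<^sup>2))
      \<longlonglongrightarrow> (LINT \<xi>|lborel. ?i \<xi> * ((norm \<xi> ^ (2 * l) - \<mu>) * (norm (?F \<xi>))\<^sup>2))"
  proof (rule integral_dominated_convergence[where w = "\<lambda>\<xi>. ((T ^ (2 * l) + \<bar>\<mu>\<bar>) * C\<^sup>2) * ?i \<xi>"])
    show "integrable lborel (\<lambda>\<xi>. ((T ^ (2 * l) + \<bar>\<mu>\<bar>) * C\<^sup>2) * ?i \<xi>)"
      by (rule integrable_mult_indicator_cball)
    show "AE \<xi> in lborel. (\<lambda>m. ?i \<xi> * ((norm \<xi> ^ (2 * l) - \<mu>) * (norm (?Fm m \<xi>))\<^sup>2))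
        \<longlonglongrightarrow> ?i \<xi> * ((norm \<xi> ^ (2 * l) - \<mu>) * (norm (?F \<xi>))\<^sup>2)"
      by (intro AE_I2 tendsto_intros Flim)
    show "AE \<xi> in lborel. norm (?i \<xi> * ((norm \<xi> ^ (2 * l) - \<mu>) * (norm (?Fm m \<xi>))\<^sup>2))
        \<le> ((T ^ (2 * l) + \<bar>\<mu>\<bar>) * C\<^sup>2) * ?i \<xi>" for m
    proof (intro AE_I2)
      fix \<xi> :: "real ^ 'n"
      have "\<bar>norm \<xi> ^ (2 * l) - \<mu>\<bar> * (norm (?Fm m \<xi>))\<^sup>2 \<le> (T ^ (2 * l) + \<bar>\<mu>\<bar>) * C\<^sup>2" if "norm \<xi> \<le> T"
      proof (intro mult_mono power_mono Fb)
        have "norm \<xi> ^ (2 * l) \<le> T ^ (2 * l)" using that by (intro power_mono) auto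
        then show "\<bar>norm \<xi> ^ (2 * l) - \<mu>\<bar> \<le> T ^ (2 * l) + \<bar>\<mu>\<bar>"
          using zero_le_power[OF norm_ge_zero, of \<xi> "2 * l"] unfolding abs_le_iff by linarith
      qed (use T(1) in auto)
      then show "norm (?i \<xi> * ((norm \<xi> ^ (2 * l) - \<mu>) * (norm (?Fm m \<xi>))\<^sup>2)) \<le> ((T ^ (2 * l) + \<bar>\<mu>\<bar>) * C\<^sup>2) * ?i \<xi>"
        by (cases "\<xi> \<in> cball 0 T") (auto simp: abs_mult)
    qed
  qed simp_all
  have rhs: "(\<lambda>m. (2 * pi) ^ CARD('n) * ((\<Sum>w | length w = l. LINT x|?M. (partials w (\<phi> m) x)\<^sup>2) - \<mu> * (LINT x|?M. (\<phi> m x)\<^sup>2)))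
     \<longlonglongrightarrow> (2 * pi) ^ CARD('n) * ((\<Sum>w | length w = l. LINT x|?M. (?D w x)\<^sup>2) - \<mu> * (LINT x|?M. (u x)\<^sup>2))"
  proof (intro tendsto_intros)
    fix w :: "'n list" assume "w \<in> {w. length w = l}"
    then have w: "length w \<le> l" by simp
    show "(\<lambda>m. LINT x|?M. (partials w (\<phi> m) x)\<^sup>2) \<longlonglongrightarrow> (LINT x|?M. (?D w x)\<^sup>2)"
      by (rule square_integrable_tendsto_norm[OF test_function_square_integrable[OF \<phi>] D2[OF w] lim[OF w]])
  next
    show "(\<lambda>m. LINT x|?M. (\<phi> m x)\<^sup>2) \<longlonglongrightarrow> (LINT x|?M. (u x)\<^sup>2)"
      by (rule square_integrable_tendsto_norm[OF \<phi>2 u2 lim0])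
  qed
  have "(LINT \<xi>|lborel. ?i \<xi> * ((norm \<xi> ^ (2 * l) - \<mu>) * (norm (?Fm m \<xi>))\<^sup>2))
     \<le> (2 * pi) ^ CARD('n) * ((\<Sum>w | length w = l. LINT x|?M. (partials w (\<phi> m) x)\<^sup>2) - \<mu> * (LINT x|?M. (\<phi> m x)\<^sup>2))" for m
    using test_function_energy[OF \<phi> T, of m] test_function_integral_square[OF \<phi>, of "[]" m]
    by (simp add: fourier_test_function[OF \<phi>] test_function_integral_square[OF \<phi>])
  then have "(LINT \<xi>|lborel. ?i \<xi> * ((norm \<xi> ^ (2 * l) - \<mu>) * (norm (?F \<xi>))\<^sup>2))
     \<le> (2 * pi) ^ CARD('n) * ((\<Sum>w | length w = l. LINT x|?M. (?D w x)\<^sup>2) - \<mu> * (LINT x|?M. (u x)\<^sup>2))"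
    by (intro LIMSEQ_le[OF lhs rhs]) auto
  then show ?thesis by (simp add: polylaplace_form_def power2_eq_square)
qed

end

section \<open>The spectral density of the first eigenfunctions\<close>

lemma dirichlet_eigenvalues_finite_level:
  assumes "dirichlet_eigenvalues l \<Omega> lam"
  shows "finite {j. 1 \<le> j \<and> lam j = t}"
proof -
  have "eventually (\<lambda>j. lam j > t) sequentially"
    using assms by (auto simp: dirichlet_eigenvalues_def filterlim_at_top_dense)
  then obtain N where "\<And>j. j \<ge> N \<Longrightarrow> lam j > t"
    unfolding eventually_sequentially by blast
  then have "{j. 1 \<le> j \<and> lam j = t} \<subseteq> {..<N}"
    by (auto simp: not_le[symmetric]) (metis less_irrefl not_le)
  then show ?thesis by (rule finite_subset) simp
qed

text \<open>For every value t an orthonormal system with as many elements as t has indices in the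
  list is fixed. An index then takes the member given by its rank among the indices with the same
  eigenvalue. Equal eigenvalues thus give different members of one system, and different eigenvalues
  are orthogonal anyway.\<close>

lemma orthonormal_eigenfunctions:
  fixes \<Omega> :: "(real ^ 'n::finite) set"
  assumes \<Omega>: "open \<Omega>" "bounded \<Omega>" and ev: "dirichlet_eigenvalues l \<Omega> lam"
  shows "\<exists>v. orthonormal_in (lebesgue_on \<Omega>) k v \<and> (\<forall>j<k. v j \<in> dirichlet_eigenspace l \<Omega> (lam (Suc j)))"
proof -
  let ?M = "lebesgue_on \<Omega>"
  define m where "m t = card {j. 1 \<le> j \<and> lam j = t}" for t
  have "\<exists>V. orthonormal_in ?M (m t) V \<and> (\<forall>i<m t. V i \<in> dirichlet_eigenspace l \<Omega> t)" for t
  proof -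
    have "has_multiplicity l \<Omega> t (m t)"
      using ev by (simp add: dirichlet_eigenvalues_def m_def)
    then obtain u where u: "\<And>i. i < m t \<Longrightarrow> u i \<in> dirichlet_eigenspace l \<Omega> t"
      and ind: "\<And>c :: nat \<Rightarrow> real. (AE x in ?M. (\<Sum>i<m t. c i * u i x) = 0) \<Longrightarrow> \<forall>i<m t. c i = 0"
      unfolding has_multiplicity_def by blast
    have "square_integrable ?M (u i)" if "i < m t" for i
      using eigenspace_L2[OF \<Omega> u[OF that]] .
    then obtain a where a: "orthonormal_in ?M (m t) (\<lambda>i x. \<Sum>p<m t. a i p * u p x)"
      using Gram_Schmidt_integral[of "m t" ?M u] ind by blast
    have "(\<lambda>x. \<Sum>p<m t. a i p * u p x) \<in> dirichlet_eigenspace l \<Omega> t" if "i < m t" for i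
      using that u by (intro eigenspace_sum[OF \<Omega>]) auto
    with a show ?thesis by blast
  qed
  then obtain V where V: "\<And>t. orthonormal_in ?M (m t) (V t)"
    "\<And>t i. i < m t \<Longrightarrow> V t i \<in> dirichlet_eigenspace l \<Omega> t"
    by metis
  \<comment> \<open>Functions are indexed from 0 but eigenvalues from 1, so \<open>j\<close> stands
    for \<open>lam (Suc j)\<close>, and the value \<open>lam 0\<close> must not be counted.\<close>
  define R where "R j = {i. 1 \<le> i \<and> i < Suc j \<and> lam i = lam (Suc j)}" for j
  define r where "r j = card (R j)" for j
  have r: "r j < m (lam (Suc j))" for j
    unfolding r_def m_def R_def
    by (intro psubset_card_mono dirichlet_eigenvalues_finite_level[OF ev]) auto
  have inj: "r i < r j" if "i < j" "lam (Suc i) = lam (Suc j)" for i j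
  proof -
    have "Suc i \<in> R j" "Suc i \<notin> R i" "R i \<subseteq> R j" "finite (R j)"
      using that by (auto simp: R_def)
    then show ?thesis unfolding r_def by (intro psubset_card_mono) auto
  qed
  define v where "v j = V (lam (Suc j)) (r j)" for j
  have ve: "v j \<in> dirichlet_eigenspace l \<Omega> (lam (Suc j))" for j
    unfolding v_def by (intro V(2) r)
  have "(LINT x|?M. v i x * v j x) = of_bool (i = j)" for i j
  proof (cases "lam (Suc i) = lam (Suc j)")
    case True
    have "(r i = r j) = (i = j)"
      using inj[of i j] inj[of j i] True by (metis less_irrefl linorder_neqE_nat)
    then show ?thesis
      using V(1)[of "lam (Suc j)"] r[of i] r[of j] True by (simp add: v_def orthonormal_in_def)
  next
    case False
    then show ?thesis using eigenspaces_orthogonal[OF \<Omega> ve ve] by auto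
  qed
  then have "orthonormal_in ?M k v"
    using eigenspace_L2[OF \<Omega> ve] by (simp add: orthonormal_in_def)
  with ve show ?thesis by blast
qed

section \<open>Bounds for the spectral density from Bessel's inequality\<close>

text \<open>The functions \<open>v j\<close> are real, so each squared modulus splits into the
  coefficients of the real and the imaginary part, and the real inequality applies to both.\<close>

lemma Bessel_integral_complex:
  assumes v: "orthonormal_in M k v"
    and e: "square_integrable M (\<lambda>x. Re (e x))" "square_integrable M (\<lambda>x. Im (e x))"
  shows "(\<Sum>j<k. (norm (LINT x|M. of_real (v j x) * e x))\<^sup>2) \<le> (LINT x|M. (norm (e x))\<^sup>2)"
proof -
  have c: "(norm (LINT x|M. of_real (v j x) * e x))\<^sup>2 = (LINT x|M. v j x * Re (e x))\<^sup>2 + (LINT x|M. v j x * Im (e x))\<^sup>2"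
    if "j < k" for j
  proof -
    have v: "square_integrable M (v j)" using assms that by (simp add: orthonormal_in_def)
    have i: "integrable M (\<lambda>x. v j x * Re (e x))" "integrable M (\<lambda>x. v j x * Im (e x))"
      by (rule square_integrable_mult[OF v e(1)], rule square_integrable_mult[OF v e(2)])
    have eq: "of_real (v j x) * e x = of_real (v j x * Re (e x)) + \<i> * of_real (v j x * Im (e x))" for x
      by (simp add: complex_eq_iff)
    have "(LINT x|M. of_real (v j x) * e x) = of_real (LINT x|M. v j x * Re (e x)) + \<i> * of_real (LINT x|M. v j x * Im (e x))"
      unfolding eq using i by (subst Bochner_Integration.integral_add)
        (auto simp: complex_of_real_integrable_eq simp del: of_real_mult)
    then show ?thesis by (simp add: cmod_power2)
  qed
  have "(\<Sum>j<k. (norm (LINT x|M. of_real (v j x) * e x))\<^sup>2)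
      = (\<Sum>j<k. (LINT x|M. v j x * Re (e x))\<^sup>2) + (\<Sum>j<k. (LINT x|M. v j x * Im (e x))\<^sup>2)"
    by (simp add: c sum.distrib)
  also have "\<dots> \<le> (LINT x|M. (Re (e x))\<^sup>2) + (LINT x|M. (Im (e x))\<^sup>2)"
    by (intro add_mono Bessel_integral v e)
  also have "\<dots> = (LINT x|M. (norm (e x))\<^sup>2)"
    using e by (simp add: square_integrable_def cmod_power2)
  finally show ?thesis .
qed

lemma moment_integrable:
  fixes \<Omega> :: "(real ^ 'n::finite) set"
  assumes \<Omega>: "open \<Omega>" "bounded \<Omega>"
  shows "integrable (lebesgue_on \<Omega>) (\<lambda>x. (norm (x - c))\<^sup>2)"
proof -
  obtain B where B: "\<And>x. x \<in> \<Omega> \<Longrightarrow> norm x \<le> B"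
    using \<Omega>(2) unfolding bounded_iff by blast
  have "square_integrable (lebesgue_on \<Omega>) (\<lambda>x. norm (x - c))"
  proof (rule square_integrable_bounded[OF finite_Omega[OF \<Omega>], of _ "B + norm c"])
    show "(\<lambda>x. norm (x - c)) \<in> borel_measurable (lebesgue_on \<Omega>)"
      by (intro measurable_restrict_space1 measurable_completion) simp
    show "\<bar>norm (x - c)\<bar> \<le> B + norm c" if "x \<in> space (lebesgue_on \<Omega>)" for x
      using B[of x] that norm_triangle_ineq4[of x c] by (simp add: space_restrict_space)
  qed
  then show ?thesis by (simp add: square_integrable_def)
qed

context
  fixes \<Omega> :: "(real ^ 'n::finite) set" and k :: nat and v :: "nat \<Rightarrow> real ^ 'n \<Rightarrow> real"
  assumes \<Omega>: "open \<Omega>" "bounded \<Omega>" and v: "orthonormal_in (lebesgue_on \<Omega>) k v"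
begin

text \<open>The squared norm of the projection of the plane wave with frequency \<open>\<xi>\<close>
  onto the span of \<open>v 0\<close>, ..., \<open>v (k - 1)\<close>.\<close>

definition spectral_density :: "real ^ 'n \<Rightarrow> real" where
  "spectral_density \<xi> = (\<Sum>j<k. (norm (fourier (lebesgue_on \<Omega>) (v j) \<xi>))\<^sup>2)"

lemma spectral_density_nonneg: "0 \<le> spectral_density \<xi>"
  by (simp add: spectral_density_def sum_nonneg)

text \<open>The coefficients \<open>a\<close> and \<open>b\<close> let one lemma serve for a single
  wave (1 and 0) and for a difference of waves (1 and 1).\<close>

lemma square_integrable_trig_difference:
  "square_integrable (lebesgue_on \<Omega>) (\<lambda>x. Re (a * cis (- (\<xi> \<bullet> (x - c))) - b * cis (- (\<eta> \<bullet> (x - c)))))"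
  "square_integrable (lebesgue_on \<Omega>) (\<lambda>x. Im (a * cis (- (\<xi> \<bullet> (x - c))) - b * cis (- (\<eta> \<bullet> (x - c)))))"
proof -
  let ?e = "\<lambda>x. a * cis (- (\<xi> \<bullet> (x - c))) - b * cis (- (\<eta> \<bullet> (x - c)))"
  have b: "norm (?e x) \<le> norm a + norm b" for x
    using norm_triangle_ineq4[of "a * cis (- (\<xi> \<bullet> (x - c)))" "b * cis (- (\<eta> \<bullet> (x - c)))"] by (simp add: norm_mult)
  have "f \<in> borel_measurable (lebesgue_on \<Omega>)" if "continuous_on UNIV f" for f :: "real ^ 'n \<Rightarrow> real"
    using borel_measurable_continuous_onI[OF that]
    by (intro measurable_restrict_space1 measurable_completion) simp
  moreover have "continuous_on UNIV (\<lambda>x. Re (?e x))" "continuous_on UNIV (\<lambda>x. Im (?e x))"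
    by (intro continuous_intros)+
  ultimately have "(\<lambda>x. Re (?e x)) \<in> borel_measurable (lebesgue_on \<Omega>)" "(\<lambda>x. Im (?e x)) \<in> borel_measurable (lebesgue_on \<Omega>)"
    by blast+
  moreover have "\<bar>Re (?e x)\<bar> \<le> norm a + norm b" "\<bar>Im (?e x)\<bar> \<le> norm a + norm b" for x
    using b[of x] abs_Re_le_cmod[of "?e x"] abs_Im_le_cmod[of "?e x"] by linarith+
  ultimately show "square_integrable (lebesgue_on \<Omega>) (\<lambda>x. Re (?e x))" "square_integrable (lebesgue_on \<Omega>) (\<lambda>x. Im (?e x))"
    by (blast intro: square_integrable_bounded[OF finite_Omega[OF \<Omega>]])+
qed

lemma volume_eq: "volume \<Omega> = (LINT x|lebesgue_on \<Omega>. 1)"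
  using \<Omega> by (simp add: volume_def measure_restrict_space)

text \<open>Moving the centre to \<open>c\<close> only multiplies the transform by a phase. The
  density is therefore unchanged, while differences of waves can be estimated by the distance to
  \<open>c\<close>.\<close>

lemma shifted_fourier:
  "(LINT x|lebesgue_on \<Omega>. of_real (f x) * cis (- (\<xi> \<bullet> (x - c)))) = cis (\<xi> \<bullet> c) * fourier (lebesgue_on \<Omega>) f \<xi>"
proof -
  have "of_real (f x) * cis (- (\<xi> \<bullet> (x - c))) = cis (\<xi> \<bullet> c) * (of_real (f x) * cis (- (\<xi> \<bullet> x)))" for x
    by (simp add: inner_diff_right cis_mult mult.left_commute)
  then show ?thesis by (simp only: fourier_def integral_mult_right_zero)
qed

lemma spectral_density_le: "spectral_density \<xi> \<le> volume \<Omega>"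
  using Bessel_integral_complex[OF v square_integrable_trig_difference[of 1 \<xi> 0 0 0]]
  by (simp add: spectral_density_def fourier_def volume_eq)

text \<open>With the coefficient vectors a and b of the two centred waves, the difference of |a|^2
  and |b|^2 is bounded by |a - b| (|a| + |b|), using Cauchy-Schwarz over \<open>j\<close>. Bessel's
  inequality bounds |a - b| through |exp(i s) - exp(i t)| <= |s - t|, and the second factor by 2
  sqrt V.\<close>

lemma spectral_density_Lipschitz_centre:
  "\<bar>spectral_density \<xi> - spectral_density \<eta>\<bar>
     \<le> 2 * sqrt (volume \<Omega> * (LINT x|lebesgue_on \<Omega>. (norm (x - c))\<^sup>2)) * norm (\<xi> - \<eta>)"
proof -
  let ?M = "lebesgue_on \<Omega>" and ?F = "\<lambda>j. fourier (lebesgue_on \<Omega>) (v j)"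
  let ?J = "LINT x|?M. (norm (x - c))\<^sup>2"
  define a where "a j = cis (\<xi> \<bullet> c) * ?F j \<xi>" for j
  define b where "b j = cis (\<eta> \<bullet> c) * ?F j \<eta>" for j
  have ab: "spectral_density \<xi> = (\<Sum>j<k. (norm (a j))\<^sup>2)" "spectral_density \<eta> = (\<Sum>j<k. (norm (b j))\<^sup>2)"
    by (simp_all add: spectral_density_def a_def b_def norm_mult)
  let ?e = "\<lambda>x. cis (- (\<xi> \<bullet> (x - c))) - cis (- (\<eta> \<bullet> (x - c)))"
  have vi: "integrable ?M (\<lambda>x. of_real (v j x) * cis (- (\<xi> \<bullet> (x - c))))" if "j < k" for j \<xi>
  proof -
    have i: "integrable ?M (v j)"
      using v that by (intro square_integrable_integrable[OF finite_Omega[OF \<Omega>]]) (simp add: orthonormal_in_def)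
    have "integrable ?M (\<lambda>x. cis (\<xi> \<bullet> c) * (of_real (v j x) * cis (- (\<xi> \<bullet> x))))"
      by (intro integrable_mult_right fourier_integrable[OF i] cis_inner_measurable_on[OF \<Omega>])
    moreover have "cis (\<xi> \<bullet> c) * (of_real (v j x) * cis (- (\<xi> \<bullet> x))) = of_real (v j x) * cis (- (\<xi> \<bullet> (x - c)))" for x
      by (simp add: inner_diff_right cis_mult mult.left_commute)
    ultimately show ?thesis by simp
  qed
  have amb: "a j - b j = (LINT x|?M. of_real (v j x) * ?e x)" if "j < k" for j
    unfolding a_def b_def shifted_fourier[symmetric] right_diff_distrib
    using vi[OF that] by simp
  have d: "(\<Sum>j<k. (norm (a j - b j))\<^sup>2) \<le> ?J * (norm (\<xi> - \<eta>))\<^sup>2"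
  proof -
    have "(\<Sum>j<k. (norm (a j - b j))\<^sup>2) \<le> (LINT x|?M. (norm (?e x))\<^sup>2)"
      using Bessel_integral_complex[OF v square_integrable_trig_difference[of 1 \<xi> c 1 \<eta>]] by (simp add: amb)
    also have "\<dots> \<le> (LINT x|?M. (norm (\<xi> - \<eta>))\<^sup>2 * (norm (x - c))\<^sup>2)"
    proof (rule integral_mono)
      show "integrable ?M (\<lambda>x. (norm (?e x))\<^sup>2)"
        using square_integrable_trig_difference[of 1 \<xi> c 1 \<eta>] by (simp add: square_integrable_def cmod_power2)
      show "integrable ?M (\<lambda>x. (norm (\<xi> - \<eta>))\<^sup>2 * (norm (x - c))\<^sup>2)"
        by (intro integrable_mult_right moment_integrable \<Omega>)
      fix x
      have "norm (?e x) \<le> \<bar>- (\<xi> \<bullet> (x - c)) - - (\<eta> \<bullet> (x - c))\<bar>" by (rule norm_cis_diff_le)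
      also have "\<dots> = \<bar>(\<xi> - \<eta>) \<bullet> (x - c)\<bar>" by (simp add: inner_diff_left)
      also have "\<dots> \<le> norm (\<xi> - \<eta>) * norm (x - c)" by (rule Cauchy_Schwarz_ineq2)
      finally have "norm (?e x) \<le> norm (\<xi> - \<eta>) * norm (x - c)" .
      then show "(norm (?e x))\<^sup>2 \<le> (norm (\<xi> - \<eta>))\<^sup>2 * (norm (x - c))\<^sup>2"
        by (metis norm_ge_zero power_mono power_mult_distrib)
    qed
    finally show ?thesis by (simp add: mult.commute)
  qed
  have pt: "\<bar>(norm (a j))\<^sup>2 - (norm (b j))\<^sup>2\<bar> \<le> \<bar>norm (a j - b j)\<bar> * \<bar>norm (a j) + norm (b j)\<bar>" for j
  proof -
    have "(norm (a j))\<^sup>2 - (norm (b j))\<^sup>2 = (norm (a j) - norm (b j)) * (norm (a j) + norm (b j))"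
      by (simp add: power2_eq_square algebra_simps)
    then show ?thesis
      using norm_triangle_ineq3[of "a j" "b j"] by (simp add: abs_mult mult_right_mono)
  qed
  let ?S = "{..<k}"
  have "\<bar>spectral_density \<xi> - spectral_density \<eta>\<bar> \<le> (\<Sum>j<k. \<bar>(norm (a j))\<^sup>2 - (norm (b j))\<^sup>2\<bar>)"
    unfolding ab sum_subtractf[symmetric] by (rule sum_abs)
  also have "\<dots> \<le> (\<Sum>j<k. \<bar>norm (a j - b j)\<bar> * \<bar>norm (a j) + norm (b j)\<bar>)"
    by (intro sum_mono pt)
  also have "\<dots> \<le> L2_set (\<lambda>j. norm (a j - b j)) ?S * L2_set (\<lambda>j. norm (a j) + norm (b j)) ?S"
    by (rule L2_set_mult_ineq)
  also have "\<dots> \<le> sqrt (?J * (norm (\<xi> - \<eta>))\<^sup>2) * (sqrt (volume \<Omega>) + sqrt (volume \<Omega>))"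
  proof (intro mult_mono)
    show "L2_set (\<lambda>j. norm (a j - b j)) ?S \<le> sqrt (?J * (norm (\<xi> - \<eta>))\<^sup>2)"
      using d by (simp add: L2_set_def)
    have "L2_set (\<lambda>j. norm (a j) + norm (b j)) ?S \<le> L2_set (\<lambda>j. norm (a j)) ?S + L2_set (\<lambda>j. norm (b j)) ?S"
      by (rule L2_set_triangle_ineq)
    also have "\<dots> \<le> sqrt (volume \<Omega>) + sqrt (volume \<Omega>)"
      using spectral_density_le[of \<xi>] spectral_density_le[of \<eta>] by (intro add_mono) (simp_all add: L2_set_def ab)
    finally show "L2_set (\<lambda>j. norm (a j) + norm (b j)) ?S \<le> sqrt (volume \<Omega>) + sqrt (volume \<Omega>)" .
  qed auto
  also have "\<dots> = 2 * sqrt (volume \<Omega> * ?J) * norm (\<xi> - \<eta>)"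
    by (simp add: real_sqrt_mult)
  finally show ?thesis .
qed

text \<open>The inequality for a fixed centre is solved for the moment about that centre. The
  left-hand side is then a common lower bound for all centres and passes to the infimum, so no
  minimising centre has to be found.\<close>

lemma spectral_density_Lipschitz:
  assumes V: "volume \<Omega> > 0"
  shows "\<bar>spectral_density \<xi> - spectral_density \<eta>\<bar> \<le> 2 * sqrt (volume \<Omega> * moment_of_inertia \<Omega>) * norm (\<xi> - \<eta>)"
proof (cases "\<xi> = \<eta>")
  case False
  let ?d = "norm (\<xi> - \<eta>)" and ?D = "\<bar>spectral_density \<xi> - spectral_density \<eta>\<bar>"
  let ?J = "\<lambda>c. LINT x|lebesgue_on \<Omega>. (norm (x - c))\<^sup>2"
  have d: "?d > 0" using False by simp
  have "(?D / (2 * ?d))\<^sup>2 / volume \<Omega> \<le> moment_of_inertia \<Omega>"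
    unfolding moment_of_inertia_def
  proof (rule cINF_greatest)
    fix c
    have "?D / (2 * ?d) \<le> sqrt (volume \<Omega> * ?J c)"
      using spectral_density_Lipschitz_centre[of \<xi> \<eta> c] d by (simp add: field_simps)
    then have "(?D / (2 * ?d))\<^sup>2 \<le> (sqrt (volume \<Omega> * ?J c))\<^sup>2"
      using d by (intro power_mono) auto
    also have "\<dots> = volume \<Omega> * ?J c" using V by simp
    finally show "(?D / (2 * ?d))\<^sup>2 / volume \<Omega> \<le> ?J c"
      using V by (subst pos_divide_le_eq) (simp_all only: mult.commute)
  qed simp
  then have "(?D / (2 * ?d))\<^sup>2 \<le> volume \<Omega> * moment_of_inertia \<Omega>"
    using V by (subst (asm) pos_divide_le_eq) (simp_all only: mult.commute)
  then have "?D / (2 * ?d) \<le> sqrt (volume \<Omega> * moment_of_inertia \<Omega>)"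
    by (rule real_le_rsqrt)
  then show ?thesis using d by (simp add: field_simps)
qed simp

text \<open>Testing the eigenvalue equation with the normalised eigenfunction itself evaluates its
  quadratic form as the eigenvalue; the energy inequalities are then summed.\<close>

lemma spectral_density_energy:
  assumes ev: "\<And>j. j < k \<Longrightarrow> v j \<in> dirichlet_eigenspace l \<Omega> (lam (Suc j))"
    and T: "0 \<le> T" "\<mu> \<le> T ^ (2 * l)"
  shows "(LINT \<xi>|lborel. indicator (cball 0 T) \<xi> * ((norm \<xi> ^ (2 * l) - \<mu>) * spectral_density \<xi>))
     \<le> (2 * pi) ^ CARD('n) * ((\<Sum>j=1..k. lam j) - \<mu> * real k)"
proof -
  let ?M = "lebesgue_on \<Omega>" and ?i = "indicator (cball 0 T) :: real ^ 'n \<Rightarrow> real"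
  let ?g = "\<lambda>j \<xi>. ?i \<xi> * ((norm \<xi> ^ (2 * l) - \<mu>) * (norm (fourier ?M (v j) \<xi>))\<^sup>2)"
  have v1: "integrable ?M (v j)" if "j < k" for j
    using v that by (intro square_integrable_integrable[OF finite_Omega[OF \<Omega>]]) (simp add: orthonormal_in_def)
  have gi: "integrable lborel (?g j)" if "j < k" for j
  proof -
    have "continuous_on (cball 0 T) (\<lambda>\<xi>. (norm \<xi> ^ (2 * l) - \<mu>) * (norm (fourier ?M (v j) \<xi>))\<^sup>2)"
      by (intro continuous_intros continuous_fourier v1 that cis_inner_measurable_on \<Omega>)
    from borel_integrable_compact[OF compact_cball this] show ?thesis
      by (simp add: set_integrable_def)
  qed
  have "?i \<xi> * ((norm \<xi> ^ (2 * l) - \<mu>) * spectral_density \<xi>) = (\<Sum>j<k. ?g j \<xi>)" for \<xi>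
    by (simp add: spectral_density_def sum_distrib_left)
  then have "(LINT \<xi>|lborel. ?i \<xi> * ((norm \<xi> ^ (2 * l) - \<mu>) * spectral_density \<xi>)) = (LINT \<xi>|lborel. (\<Sum>j<k. ?g j \<xi>))"
    by simp
  also have "\<dots> = (\<Sum>j<k. LINT \<xi>|lborel. ?g j \<xi>)"
    using gi by (intro Bochner_Integration.integral_sum) auto
  also have "\<dots> \<le> (\<Sum>j<k. (2 * pi) ^ CARD('n) * (lam (Suc j) - \<mu>))"
  proof (rule sum_mono)
    fix j assume "j \<in> {..<k}"
    then have j: "j < k" by simp
    have u: "v j \<in> sobolev0 l \<Omega>" using ev[OF j] by (simp add: dirichlet_eigenspace_def)
    have n: "(LINT x|?M. v j x * v j x) = 1" using v j by (simp add: orthonormal_in_def)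
    have "polylaplace_form l \<Omega> (v j) (v j) = lam (Suc j)"
      using ev[OF j] u n by (simp add: dirichlet_eigenspace_def)
    then show "(LINT \<xi>|lborel. ?g j \<xi>) \<le> (2 * pi) ^ CARD('n) * (lam (Suc j) - \<mu>)"
      using sobolev0_energy[OF \<Omega> u T] n by (simp add: power2_eq_square)
  qed
  also have "\<dots> = (2 * pi) ^ CARD('n) * ((\<Sum>j<k. lam (Suc j)) - \<mu> * real k)"
    by (simp add: sum_distrib_left[symmetric] sum_subtractf)
  also have "(\<Sum>j<k. lam (Suc j)) = (\<Sum>j=1..k. lam j)"
    by (rule sum.reindex_bij_witness[of _ "\<lambda>j. j - 1" Suc]) auto
  finally show ?thesis .
qed

end

section \<open>Positivity of the volume and the moment of inertia\<close>

lemma volume_pos: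
  assumes "open \<Omega>" "bounded \<Omega>" "\<Omega> \<noteq> {}"
  shows "volume \<Omega> > 0"
proof -
  have "volume \<Omega> \<noteq> 0"
    using assms open_not_negligible[of \<Omega>] negligible_iff_measure0[OF lmeasurable_open[OF assms(2,1)]]
    by (auto simp: volume_def)
  then show ?thesis by (simp add: volume_def measure_nonneg order_less_le)
qed

text \<open>A ball of half the volume of the domain misses half of it, whatever its centre is.\<close>

lemma moment_of_inertia_pos:
  fixes \<Omega> :: "(real ^ 'n::finite) set"
  assumes \<Omega>: "open \<Omega>" "bounded \<Omega>" "\<Omega> \<noteq> {}"
  shows "moment_of_inertia \<Omega> > 0"
proof -
  let ?n = "CARD('n)" and ?V = "volume \<Omega>"
  let ?w = "unit_ball_vol (real ?n)"
  have V: "?V > 0" using \<Omega> by (rule volume_pos)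
  have w: "?w > 0" by simp
  define r where "r = root ?n (?V / (2 * ?w))"
  have r: "r > 0" unfolding r_def using V w by simp
  have rn: "?w * r ^ ?n = ?V / 2"
    unfolding r_def using V w less_imp_neq[OF w] by (simp add: real_root_pow_pos)
  have lm: "\<Omega> \<in> lmeasurable" using \<Omega> by (intro lmeasurable_open)
  have "r\<^sup>2 * (?V / 2) \<le> (LINT x|lebesgue_on \<Omega>. (norm (x - c))\<^sup>2)" for c
  proof -
    have "measure lebesgue (\<Omega> - cball c r) \<ge> measure lebesgue \<Omega> - measure lebesgue (cball c r)"
      using lm by (intro measure_diff_le_measure_setdiff) auto
    moreover have "measure lebesgue (cball c r) = ?V / 2"
      using content_cball[of r c] r rn by simp
    ultimately have half: "?V / 2 \<le> measure lebesgue (\<Omega> - cball c r)"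
      by (simp add: volume_def)
    have "r\<^sup>2 * measure lebesgue (\<Omega> - cball c r) = (LINT x|lebesgue_on \<Omega>. r\<^sup>2 * indicator (\<Omega> - cball c r) x)"
      using lm by (simp add: measure_restrict_space Int_absorb1 Int_absorb2)
    also have "\<dots> \<le> (LINT x|lebesgue_on \<Omega>. (norm (x - c))\<^sup>2)"
    proof (rule integral_mono_AE)
      show "AE x in lebesgue_on \<Omega>. r\<^sup>2 * indicator (\<Omega> - cball c r) x \<le> (norm (x - c))\<^sup>2"
        using r by (intro AE_I2) (auto simp: indicator_def dist_norm norm_minus_commute intro!: power_mono)
      interpret finite_measure "lebesgue_on \<Omega>" using finite_Omega[OF \<Omega>(1,2)] .
      have "\<Omega> - cball c r \<in> sets (lebesgue_on \<Omega>)"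
        using \<Omega>(1) by (auto simp: sets_restrict_space_iff)
      then show "integrable (lebesgue_on \<Omega>) (\<lambda>x. r\<^sup>2 * indicator (\<Omega> - cball c r) x)"
        by (intro integrable_mult_right integrable_real_indicator) (auto simp: emeasure_eq_measure)
    qed (rule moment_integrable[OF \<Omega>(1,2)])
    finally show ?thesis
      using half r by (smt (verit) mult_left_mono zero_le_power2)
  qed
  then have "r\<^sup>2 * (?V / 2) \<le> moment_of_inertia \<Omega>"
    unfolding moment_of_inertia_def by (intro cINF_greatest) auto
  moreover have "r\<^sup>2 * (?V / 2) > 0" using r V by simp
  ultimately show ?thesis by linarith
qed

section \<open>Minimality of the truncated cone\<close>

lemma sgn_measurable [measurable]: "sgn \<in> borel_measurable (borel :: 'a::euclidean_space measure)"
  unfolding sgn_div_norm[abs_def] by measurable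

lemma integrable_indicator_cball_bounded:
  fixes f :: "'a::euclidean_space \<Rightarrow> real"
  assumes [measurable]: "f \<in> borel_measurable borel" and b: "\<And>x. norm x \<le> T \<Longrightarrow> \<bar>f x\<bar> \<le> B"
  shows "integrable lborel (\<lambda>x. indicator (cball 0 T) x * f x)"
proof (rule Bochner_Integration.integrable_bound[where f = "\<lambda>x. B * indicator (cball 0 T) x"])
  have "\<bar>f x\<bar> \<le> \<bar>B\<bar>" if "norm x \<le> T" for x
    using b[OF that] by linarith
  then show "AE x in lborel. norm (indicator (cball 0 T) x * f x) \<le> norm (B * indicator (cball 0 T) (x::'a))"
    by (intro AE_I2) (auto simp: indicator_def)
qed (rule integrable_mult_indicator_cball, simp)

text \<open>The weight depends on the direction only, hence is invariant under dilation, and a ball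
  of radius t has weighted mass C t^N. Both measures therefore have the same distribution function,
  which determines them.\<close>

lemma distr_norm_angular_density:
  fixes q :: "'a::euclidean_space \<Rightarrow> real"
  assumes q[measurable]: "q \<in> borel_measurable borel" and q0: "\<And>x. 0 \<le> q x" and qB: "\<And>x. q x \<le> B"
  defines "C \<equiv> LINT x|lborel. indicator (cball 0 1) x * q (sgn x)"
  shows "distr (density lborel (\<lambda>x. ennreal (q (sgn x)))) borel norm
    = density lborel (\<lambda>r. ennreal (indicator {0..} r * (C * (real DIM('a) * r ^ (DIM('a) - 1)))))"
    (is "?M1 = ?M2")
proof -
  let ?N = "DIM('a)"
  have int1: "integrable lborel (\<lambda>x::'a. indicator (cball 0 1) x * q (sgn x))"
    using q0 qB by (intro integrable_indicator_cball_bounded[of _ _ B]) (auto simp: abs_le_iff order_trans[OF _ q0])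
  have C0: "C \<ge> 0" unfolding C_def using q0 by (intro Bochner_Integration.integral_nonneg) auto
  have nnC: "(\<integral>\<^sup>+x. ennreal (indicator (cball 0 1) x * q (sgn x)) \<partial>lborel) = ennreal C"
    unfolding C_def using q0 by (intro nn_integral_eq_integral int1) auto
  have cdf1: "emeasure ?M1 {..t} = ennreal (if t \<ge> 0 then C * t ^ ?N else 0)" for t
  proof -
    have "emeasure ?M1 {..t} = (\<integral>\<^sup>+x. ennreal (indicator (cball 0 t) x * q (sgn x)) \<partial>(lborel :: 'a measure))"
    proof -
      have "norm -` {..t} = cball (0 :: 'a) t" by auto
      then show ?thesis
        by (subst emeasure_distr) (auto simp: emeasure_density indicator_def intro!: nn_integral_cong)
    qed
    also have "\<dots> = ennreal (if t \<ge> 0 then C * t ^ ?N else 0)"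
    proof -
      consider "t < 0" | "t = 0" | "t > 0" by linarith
      then show ?thesis
      proof cases
        case 1 then show ?thesis by simp
      next
        case 2
        have "AE x in lborel. (x::'a) \<noteq> 0" by (rule AE_lborel_singleton)
        then have "(\<integral>\<^sup>+x. ennreal (indicator (cball 0 t) x * q (sgn x)) \<partial>(lborel :: 'a measure)) = (\<integral>\<^sup>+x. 0 \<partial>(lborel :: 'a measure))"
          by (intro nn_integral_cong_AE) (auto simp: 2)
        then show ?thesis using 2 by (simp add: zero_power[OF DIM_positive])
      next
        case 3
        have "(\<integral>\<^sup>+x. ennreal (indicator (cball 0 t) x * q (sgn x)) \<partial>(lborel :: 'a measure))
          = (\<integral>\<^sup>+x. ennreal (t ^ ?N) * ennreal (indicator (cball 0 t) (t *\<^sub>R x) * q (sgn (t *\<^sub>R x))) \<partial>(lborel :: 'a measure))"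
          using 3 by (subst lborel_affine[of t 0]) (auto simp: nn_integral_density nn_integral_distr)
        also have "\<dots> = (\<integral>\<^sup>+x. ennreal (t ^ ?N) * ennreal (indicator (cball 0 1) x * q (sgn x)) \<partial>(lborel :: 'a measure))"
          using 3 by (intro nn_integral_cong) (auto simp: indicator_def sgn_scaleR)
        also have "\<dots> = ennreal (t ^ ?N) * ennreal C"
          by (simp add: nn_integral_cmult nnC)
        finally show ?thesis using 3 C0 by (simp add: ennreal_mult mult.commute)
      qed
    qed
    finally show ?thesis .
  qed
  have cdf2: "emeasure ?M2 {..t} = ennreal (if t \<ge> 0 then C * t ^ ?N else 0)" for t
  proof -
    have "emeasure ?M2 {..t} = (\<integral>\<^sup>+r. ennreal (C * (real ?N * r ^ (?N - 1))) * indicator {0..t} r \<partial>lborel)"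
      by (subst emeasure_density) (auto simp: indicator_def intro!: nn_integral_cong)
    also have "\<dots> = ennreal (if t \<ge> 0 then C * t ^ ?N else 0)"
    proof (cases "t \<ge> 0")
      case True
      have "(\<integral>\<^sup>+r. ennreal (C * (real ?N * r ^ (?N - 1))) * indicator {0..t} r \<partial>lborel) = ennreal (C * t ^ ?N - C * 0 ^ ?N)"
        using True C0 by (intro nn_integral_FTC_Icc) (auto intro!: derivative_eq_intros)
      then show ?thesis using True by (simp add: zero_power[OF DIM_positive])
    qed simp
    finally show ?thesis .
  qed
  show ?thesis
  proof (rule measure_eqI_generator_eq)
    let ?E = "range (\<lambda>t::real. {..t})"
    show "Int_stable ?E" by (auto simp: Int_stable_def)
    show "?E \<subseteq> Pow UNIV" by simp
    show "sets ?M1 = sigma_sets UNIV ?E" "sets ?M2 = sigma_sets UNIV ?E"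
      by (simp_all add: borel_eq_atMost)
    show "emeasure ?M1 X = emeasure ?M2 X" if "X \<in> ?E" for X
      using that cdf1 cdf2 by auto
    show "range (\<lambda>n::nat. {..real n}) \<subseteq> ?E" by auto
    show "(\<Union>n::nat. {..real n}) = UNIV" using real_arch_simple by auto
    show "emeasure ?M1 {..real n} \<noteq> \<infinity>" for n by (simp add: cdf1)
  qed
qed

text \<open>Polar integration for a product of a radial and an angular factor, without surface
  measure: the angular factor is integrated over the unit ball, which is 1/N of its integral over
  the sphere, and the radial density carries the compensating N.\<close>

theorem integral_polar_angular:
  fixes q :: "'a::euclidean_space \<Rightarrow> real" and g :: "real \<Rightarrow> real"
  assumes q[measurable]: "q \<in> borel_measurable borel" and q0: "\<And>x. 0 \<le> q x" and qB: "\<And>x. q x \<le> B"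
    and g[measurable]: "g \<in> borel_measurable borel"
  shows "(LINT x|lborel. g (norm x) * q (sgn x)) =
    (LINT x|lborel. indicator (cball 0 1) x * q (sgn x)) *
    (LINT r|lborel. indicator {0..} r * (g r * (real DIM('a) * r ^ (DIM('a) - 1))))"
proof -
  let ?N = "DIM('a)"
  define C where "C = (LINT x|lborel. indicator (cball 0 1) x * q (sgn x))"
  have C0: "C \<ge> 0" unfolding C_def using q0 by (intro Bochner_Integration.integral_nonneg) auto
  have "(LINT x|lborel. g (norm x) * q (sgn x)) = (LINT x|density lborel (\<lambda>x. ennreal (q (sgn x))). g (norm x))"
    using q0 by (subst integral_density) (auto simp: mult.commute)
  also have "\<dots> = (LINT r|distr (density lborel (\<lambda>x. ennreal (q (sgn x)))) borel norm. g r)"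
    by (subst integral_distr) auto
  also have "\<dots> = (LINT r|density lborel (\<lambda>r. ennreal (indicator {0..} r * (C * (real ?N * r ^ (?N - 1))))). g r)"
    unfolding C_def distr_norm_angular_density[OF q q0 qB] ..
  also have "\<dots> = (LINT r|lborel. C * (indicator {0..} r * (g r * (real ?N * r ^ (?N - 1)))))"
    using C0 by (subst integral_density) (auto simp: mult_ac indicator_def intro!: AE_I2 Bochner_Integration.integral_cong)
  finally show ?thesis by (simp add: C_def)
qed

lemma integral_indicator_unit_cball:
  "(LINT x|lborel. indicator (cball 0 1) (x::'a::euclidean_space) * (1::real)) = unit_ball_vol (real DIM('a))"
  using content_cball[of 1 "0 :: 'a"] by simp

lemma integral_Icc_FTC:
  fixes f F :: "real \<Rightarrow> real"
  assumes "a \<le> b" "\<And>x. a \<le> x \<Longrightarrow> x \<le> b \<Longrightarrow> (F has_real_derivative f x) (at x)"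
    "continuous_on {a..b} f"
  shows "integrable lborel (\<lambda>x. indicator {a..b} x * f x)" "(LINT x|lborel. indicator {a..b} x * f x) = F b - F a"
proof -
  have F: "(F has_vector_derivative f x) (at x within {a..b})" if "a \<le> x" "x \<le> b" for x
    using assms(2)[OF that] by (simp add: has_real_derivative_iff_has_vector_derivative has_vector_derivative_at_within)
  from has_bochner_integral_FTC_Icc[OF assms(1) F assms(3)]
  show "integrable lborel (\<lambda>x. indicator {a..b} x * f x)" "(LINT x|lborel. indicator {a..b} x * f x) = F b - F a"
    by (auto simp: has_bochner_integral_iff)
qed

text \<open>
  Among densities with values in \<open>[0, V]\<close> and Lipschitz constant \<open>L\<close>, the truncated cone
  \<open>\<Phi>\<close> minimises the integral of the weight \<open>|x|\<^sup>2\<^sup>l - R\<^sup>2\<^sup>l\<close>. On the slope the competitor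
  \<open>G\<close> is compared on each ray with the parallel translate of \<open>\<Phi>\<close> through its value at radius
  \<open>R\<close>; the translation contributes nothing because the weight has mean zero on the slope.
\<close>

theorem truncated_cone_minimal:
  fixes G :: "'a::euclidean_space \<Rightarrow> real"
  defines "N \<equiv> DIM('a)"
  assumes G0: "\<And>x. 0 \<le> G x" and GV: "\<And>x. G x \<le> V"
    and L: "L > 0" and Lip: "\<And>x y. \<bar>G x - G y\<bar> \<le> L * norm (x - y)"
    and s: "0 \<le> s" "s \<le> R" "R \<le> T" and T: "T = s + V / L" and \<mu>: "\<mu> = R ^ (2 * l)"
  defines "W \<equiv> \<lambda>r. real N * r ^ (N + 2 * l) / real (N + 2 * l) - \<mu> * r ^ N"
    and "Z \<equiv> \<lambda>r. real N * r ^ (N + 2 * l + 1) / (real (N + 2 * l) * real (N + 2 * l + 1)) - \<mu> * r ^ (N + 1) / real (N + 1)"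
  assumes W: "W T = W s"
  shows "unit_ball_vol (real N) * (L * (Z T - Z s))
     \<le> (LINT x|lborel. indicator (cball 0 T) x * ((norm x ^ (2 * l) - \<mu>) * G x))"
proof -
  have N: "N > 0" by (simp add: N_def)
  define p where "p r = r ^ (2 * l) - \<mu>" for r :: real
  define \<Phi> where "\<Phi> r = V - L * max 0 (r - s)" for r
  \<comment> \<open>Used only at \<open>sgn x\<close>: the value of \<open>G\<close> where the ray
    through \<open>x\<close> meets the sphere of radius \<open>R\<close>, on which the weight
    vanishes.\<close>
  define q where "q x = G (R *\<^sub>R x)" for x :: 'a
  have contG: "continuous_on UNIV G"
  proof (rule lipschitz_on_continuous_on[of L], rule lipschitz_onI)
    show "dist (G x) (G y) \<le> L * dist x y" for x y
      using Lip[of x y] by (simp add: dist_norm)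
  qed (use L in simp)
  have [measurable]: "G \<in> borel_measurable borel"
    using contG by (rule borel_measurable_continuous_onI)
  have q[measurable]: "q \<in> borel_measurable borel"
    unfolding q_def by measurable
  have q0: "0 \<le> q x" and qV: "q x \<le> V" for x
    by (simp_all add: q_def G0 GV)
  have [measurable]: "p \<in> borel_measurable borel" "\<Phi> \<in> borel_measurable borel"
    unfolding p_def[abs_def] \<Phi>_def[abs_def] by measurable
  have VL: "L * (T - s) = V" using T L by simp
  note int = integrable_indicator_cball_bounded
  have pb: "\<bar>p (norm x)\<bar> \<le> T ^ (2 * l) + \<bar>\<mu>\<bar>" if "norm x \<le> T" for x :: 'a
  proof -
    have "norm x ^ (2 * l) \<le> T ^ (2 * l)" using that by (intro power_mono) auto
    then show ?thesis
      using zero_le_power[OF norm_ge_zero, of x "2 * l"] unfolding p_def abs_le_iff by linarith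
  qed
  let ?P = "T ^ (2 * l) + \<bar>\<mu>\<bar>"
  have P0: "?P \<ge> 0" using s by simp
  define S where "S r = (if s < r then 1 else 0 :: real)" for r
  have [measurable]: "S \<in> borel_measurable borel"
    unfolding S_def[abs_def] by measurable
  have \<Phi>b: "\<bar>\<Phi> (norm x)\<bar> \<le> V" if "norm x \<le> T" for x :: 'a
  proof -
    have "L * max 0 (norm x - s) \<le> L * (T - s)" "0 \<le> L * max 0 (norm x - s)"
      using that L s by (auto intro!: mult_left_mono)
    then show ?thesis unfolding \<Phi>_def using VL by linarith
  qed
  \<comment> \<open>For radius at most \<open>s\<close> this is the weight times V. On the slope it
    is the weight times \<open>\<Phi> (norm x) - \<Phi> R + q (sgn x)\<close>, arranged so that each
    summand is radial or a radial factor times a function of the direction.\<close>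
  let ?lower = "\<lambda>x::'a. p (norm x) * \<Phi> (norm x) + (p (norm x) * S (norm x) * q (sgn x) - \<Phi> R * (p (norm x) * S (norm x)))"
  \<comment> \<open>The Lipschitz bound along the ray puts \<open>G\<close> below the translated
    slope inside radius \<open>R\<close> and above it outside. The weight changes sign at
    \<open>R\<close> from nonpositive to nonnegative, so both cases give the same
    inequality.\<close>
  have pt: "?lower x \<le> p (norm x) * G x" if x: "norm x \<le> T" for x
  proof (cases "norm x \<le> s")
    case True
    have "norm x ^ (2 * l) \<le> R ^ (2 * l)"
      using True s by (intro power_mono) auto
    then have "p (norm x) \<le> 0" by (simp add: p_def \<mu>)
    then have "p (norm x) * V \<le> p (norm x) * G x"
      using GV by (intro mult_left_mono_neg)
    then show ?thesis using True by (simp add: \<Phi>_def S_def)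
  next
    case False
    then have x0: "norm x > 0" using s by linarith
    have "x - R *\<^sub>R sgn x = (norm x - R) *\<^sub>R sgn x"
      using x0 by (simp add: scaleR_left_diff_distrib) (simp add: sgn_div_norm)
    then have nd: "norm (x - R *\<^sub>R sgn x) = \<bar>norm x - R\<bar>"
      using x0 by (simp add: norm_sgn)
    have \<Phi>d: "\<Phi> (norm x) - \<Phi> R = L * (R - norm x)"
      using False s by (simp add: \<Phi>_def algebra_simps)
    have eq: "?lower x = p (norm x) * (\<Phi> (norm x) - \<Phi> R + q (sgn x))"
      using False by (simp add: S_def algebra_simps)
    show ?thesis
    proof (cases "norm x \<le> R")
      case True
      have "norm x ^ (2 * l) \<le> R ^ (2 * l)" using True by (intro power_mono) auto
      then have "p (norm x) \<le> 0" by (simp add: p_def \<mu>)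
      moreover have "G x \<le> \<Phi> (norm x) - \<Phi> R + q (sgn x)"
        using Lip[of x "R *\<^sub>R sgn x"] True unfolding nd \<Phi>d q_def by (auto simp: abs_le_iff)
      ultimately show ?thesis unfolding eq by (intro mult_left_mono_neg)
    next
      case False
      have "R ^ (2 * l) \<le> norm x ^ (2 * l)" using False s by (intro power_mono) auto
      then have "p (norm x) \<ge> 0" by (simp add: p_def \<mu>)
      moreover have "\<Phi> (norm x) - \<Phi> R + q (sgn x) \<le> G x"
        using Lip[of x "R *\<^sub>R sgn x"] False unfolding nd \<Phi>d q_def by (auto simp: abs_le_iff algebra_simps)
      ultimately show ?thesis unfolding eq by (intro mult_left_mono)
    qed
  qed
  let ?i = "indicator (cball 0 T) :: 'a \<Rightarrow> real"
  have i1: "integrable lborel (\<lambda>x. ?i x * (p (norm x) * \<Phi> (norm x)))"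
    using pb \<Phi>b P0 by (intro int[of _ _ "?P * V"]) (auto simp: abs_mult intro!: mult_mono)
  have i2: "integrable lborel (\<lambda>x. ?i x * (p (norm x) * S (norm x) * q (sgn x)))"
    using pb q0 qV P0 by (intro int[of _ _ "?P * V"])
      (auto simp: abs_mult S_def intro!: mult_mono mult_nonneg_nonneg order_trans[OF q0 qV])
  have i3: "integrable lborel (\<lambda>x. ?i x * (p (norm x) * S (norm x)))"
    using pb P0 by (intro int[of _ _ "?P"]) (auto simp: abs_mult S_def)
  have i4: "integrable lborel (\<lambda>x. ?i x * (p (norm x) * G x))"
    using pb G0 GV P0 by (intro int[of _ _ "?P * V"]) (auto simp: abs_mult intro!: mult_mono)
  have ls: "?i x * ?lower x = ?i x * (p (norm x) * \<Phi> (norm x)) +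
      (?i x * (p (norm x) * S (norm x) * q (sgn x)) - \<Phi> R * (?i x * (p (norm x) * S (norm x))))" for x
    by (simp add: algebra_simps)
  have "(LINT x|lborel. ?i x * ?lower x) \<le> (LINT x|lborel. ?i x * (p (norm x) * G x))"
  proof (rule integral_mono)
    show "integrable lborel (\<lambda>x. ?i x * ?lower x)"
      unfolding ls using i1 i2 i3
      by (intro Bochner_Integration.integrable_add Bochner_Integration.integrable_diff integrable_mult_right)
    show "?i x * ?lower x \<le> ?i x * (p (norm x) * G x)" for x
      using pt[of x] by (auto simp: indicator_def)
  qed (rule i4)
  also have "(LINT x|lborel. ?i x * ?lower x) = (LINT x|lborel. ?i x * (p (norm x) * \<Phi> (norm x))) +
      ((LINT x|lborel. ?i x * (p (norm x) * S (norm x) * q (sgn x))) - \<Phi> R * (LINT x|lborel. ?i x * (p (norm x) * S (norm x))))"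
    unfolding ls using i1 i2 i3 by simp
  finally have main: "(LINT x|lborel. ?i x * (p (norm x) * \<Phi> (norm x))) +
      ((LINT x|lborel. ?i x * (p (norm x) * S (norm x) * q (sgn x))) - \<Phi> R * (LINT x|lborel. ?i x * (p (norm x) * S (norm x))))
      \<le> (LINT x|lborel. ?i x * (p (norm x) * G x))" .
  let ?w = "\<lambda>r. p r * (real N * r ^ (N - 1))"
  \<comment> \<open>\<open>W\<close> is the antiderivative of the weight times the radial density,
    and \<open>Z\<close> that of \<open>W\<close>.\<close>
  have dW: "(W has_real_derivative ?w r) (at r)" for r
  proof -
    have pw: "r ^ (N + 2 * l - 1) = r ^ (2 * l) * r ^ (N - 1)"
      using N by (simp flip: power_add) (simp add: algebra_simps)
    have "(W has_real_derivative real N * (real (N + 2 * l) * r ^ (N + 2 * l - 1)) / real (N + 2 * l) - \<mu> * (real N * r ^ (N - 1))) (at r)"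
      unfolding W_def by (auto intro!: derivative_eq_intros)
    moreover have "real N * (real (N + 2 * l) * r ^ (N + 2 * l - 1)) / real (N + 2 * l) = real N * (r ^ (2 * l) * r ^ (N - 1))"
      using N unfolding pw by (simp del: of_nat_add)
    ultimately show ?thesis by (simp add: p_def algebra_simps)
  qed
  have dZ: "(Z has_real_derivative W r) (at r)" for r
  proof -
    have "(Z has_real_derivative real N * (real (N + 2 * l + 1) * r ^ (N + 2 * l + 1 - Suc 0)) / (real (N + 2 * l) * real (N + 2 * l + 1))
        - \<mu> * (real (N + 1) * r ^ (N + 1 - Suc 0)) / real (N + 1)) (at r)"
      unfolding Z_def by (intro DERIV_diff DERIV_cdivide DERIV_cmult DERIV_pow)
    moreover have "real N * (real (N + 2 * l + 1) * r ^ (N + 2 * l)) / (real (N + 2 * l) * real (N + 2 * l + 1)) = real N * r ^ (N + 2 * l) / real (N + 2 * l)"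
      "\<mu> * (real (N + 1) * r ^ N) / real (N + 1) = \<mu> * r ^ N"
      by (simp_all del: of_nat_add)
    ultimately show ?thesis unfolding W_def by (simp del: of_nat_add)
  qed
  have cont_w: "continuous_on A ?w" for A
    unfolding p_def by (intro continuous_intros)
  \<comment> \<open>The hypothesis that \<open>W\<close> agrees at \<open>s\<close> and
    \<open>T\<close> says exactly that the weight has integral 0 over the slope, in every direction
    alike.\<close>
  have slope0: "(LINT r|lborel. indicator {0..} r * (indicator {..T} r * (p r * S r) * (real N * r ^ (N - 1)))) = 0"
  proof -
    have "(LINT r|lborel. indicator {0..} r * (indicator {..T} r * (p r * S r) * (real N * r ^ (N - 1))))
        = (LINT r|lborel. indicator {s..T} r * ?w r)"
    proof (rule integral_cong_AE)
      have "AE r in lborel. r \<noteq> s" by (rule AE_lborel_singleton)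
      then show "AE r in lborel. indicator {0..} r * (indicator {..T} r * (p r * S r) * (real N * r ^ (N - 1))) = indicator {s..T} r * ?w r"
        by eventually_elim (use s in \<open>auto simp: indicator_def S_def\<close>)
    qed simp_all
    also have "\<dots> = W T - W s"
      using s by (intro integral_Icc_FTC(2) dW cont_w) auto
    finally show ?thesis using W by simp
  qed
  have ind: "?i x = indicator {..T} (norm x)" for x by (simp add: indicator_def)
  have z1: "(LINT x|lborel. ?i x * (p (norm x) * S (norm x) * q (sgn x))) = 0"
    using integral_polar_angular[OF q q0 qV, of "\<lambda>r. indicator {..T} r * (p r * S r)"] slope0
    by (simp add: ind mult.assoc N_def)
  have z2: "(LINT x|lborel. ?i x * (p (norm x) * S (norm x))) = 0"
    using integral_polar_angular[of "\<lambda>_::'a. 1" 1 "\<lambda>r. indicator {..T} r * (p r * S r)"] slope0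
    by (simp add: ind mult.assoc N_def)
  have "(LINT x|lborel. ?i x * (p (norm x) * \<Phi> (norm x))) = unit_ball_vol (real N) *
      (LINT r|lborel. indicator {0..} r * (indicator {..T} r * (p r * \<Phi> r) * (real N * r ^ (N - 1))))"
    using integral_polar_angular[of "\<lambda>_::'a. 1" 1 "\<lambda>r. indicator {..T} r * (p r * \<Phi> r)"]
    by (simp add: ind mult.assoc N_def integral_indicator_unit_cball[simplified])
  also have "(LINT r|lborel. indicator {0..} r * (indicator {..T} r * (p r * \<Phi> r) * (real N * r ^ (N - 1))))
      = (LINT r|lborel. indicator {0..s} r * (V * ?w r) + indicator {s..T} r * ((V - L * (r - s)) * ?w r))"
  proof (rule integral_cong_AE)
    have "AE r in lborel. r \<noteq> s" by (rule AE_lborel_singleton)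
    then show "AE r in lborel. indicator {0..} r * (indicator {..T} r * (p r * \<Phi> r) * (real N * r ^ (N - 1)))
        = indicator {0..s} r * (V * ?w r) + indicator {s..T} r * ((V - L * (r - s)) * ?w r)"
      by eventually_elim (use s in \<open>auto simp: indicator_def \<Phi>_def\<close>)
  qed simp_all
  \<comment> \<open>Integration by parts: (V - L (r - s)) W + L Z is an antiderivative on the slope.
    Since the profile is continuous at \<open>s\<close>, equals 0 at \<open>T\<close>, and
    \<open>W 0 = 0\<close>, only the \<open>Z\<close> terms survive.\<close>
  also have "\<dots> = (V * W s - V * W 0) + (((V - L * (T - s)) * W T + L * Z T) - ((V - L * (s - s)) * W s + L * Z s))"
  proof (subst Bochner_Integration.integral_add)
    have d1: "((\<lambda>r. V * W r) has_real_derivative V * ?w r) (at r)" for r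
      by (rule DERIV_cmult[OF dW])
    have d2: "((\<lambda>r. (V - L * (r - s)) * W r + L * Z r) has_real_derivative (V - L * (r - s)) * ?w r) (at r)" for r
      by (auto intro!: derivative_eq_intros dW dZ simp: algebra_simps)
    have c: "continuous_on A (\<lambda>r. V * ?w r)" "continuous_on A (\<lambda>r. (V - L * (r - s)) * ?w r)" for A
      by (intro continuous_intros cont_w)+
    show "integrable lborel (\<lambda>r. indicator {0..s} r * (V * ?w r))"
      "integrable lborel (\<lambda>r. indicator {s..T} r * ((V - L * (r - s)) * ?w r))"
      by (rule integral_Icc_FTC(1)[OF s(1) d1 c(1)],
          rule integral_Icc_FTC(1)[OF order_trans[OF s(2,3)] d2 c(2)])
    show "(LINT r|lborel. indicator {0..s} r * (V * ?w r)) + (LINT r|lborel. indicator {s..T} r * ((V - L * (r - s)) * ?w r))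
      = (V * W s - V * W 0) + (((V - L * (T - s)) * W T + L * Z T) - ((V - L * (s - s)) * W s + L * Z s))"
      using s integral_Icc_FTC(2)[OF _ d1 c(1), of 0 s] integral_Icc_FTC(2)[OF _ d2 c(2), of s T] by simp
  qed
  also have "\<dots> = L * (Z T - Z s)"
  proof -
    have "W 0 = 0" using N by (simp add: W_def zero_power)
    then show ?thesis unfolding VL W by (simp add: algebra_simps)
  qed
  finally show ?thesis
    using main z1 z2 by (simp add: p_def)
qed

section \<open>Expansion of the truncated cone bound\<close>

text \<open>The mean of t^(p-1) over the interval [1 - h, 1 + h].\<close>

definition power_mean :: "nat \<Rightarrow> real \<Rightarrow> real" where
  "power_mean p h = ((1 + h) ^ p - (1 - h) ^ p) / (2 * h * real p)"

text \<open>Binomial expansion of the odd part (divided by h) and the even part of (1 + h)^p, with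
  coefficients binomial(p, 3) and binomial(p, 2). The two are treated jointly because raising p by 1
  mixes them: P becomes P + Q, and Q becomes Q + h^2 P. The lower bounds later allow division by a
  power mean.\<close>

lemma power_difference_expansion:
  "\<exists>C. \<forall>h::real. 0 < h \<and> h \<le> 1 \<longrightarrow>
    \<bar>((1 + h) ^ p - (1 - h) ^ p) / (2 * h) - (real p + real p * (real p - 1) * (real p - 2) / 6 * h\<^sup>2)\<bar> \<le> C * h ^ 4 \<and>
    \<bar>((1 + h) ^ p + (1 - h) ^ p) / 2 - (1 + real p * (real p - 1) / 2 * h\<^sup>2)\<bar> \<le> C * h ^ 4 \<and>
    real p \<le> ((1 + h) ^ p - (1 - h) ^ p) / (2 * h) \<and> 1 \<le> ((1 + h) ^ p + (1 - h) ^ p) / 2"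
proof (induction p)
  case 0
  show ?case by (rule exI[of _ 0]) simp
next
  case (Suc p)
  let ?P = "\<lambda>p h. ((1 + h) ^ p - (1 - h) ^ p) / (2 * h) :: real"
  let ?Q = "\<lambda>p h. ((1 + h) ^ p + (1 - h) ^ p) / 2 :: real"
  let ?a = "real p * (real p - 1) * (real p - 2) / 6"
  let ?b = "real p * (real p - 1) / 2"
  obtain C where C: "\<And>h. 0 < h \<Longrightarrow> h \<le> 1 \<Longrightarrow> \<bar>?P p h - (real p + ?a * h\<^sup>2)\<bar> \<le> C * h ^ 4"
    "\<And>h. 0 < h \<Longrightarrow> h \<le> 1 \<Longrightarrow> \<bar>?Q p h - (1 + ?b * h\<^sup>2)\<bar> \<le> C * h ^ 4"
    "\<And>h. 0 < h \<Longrightarrow> h \<le> 1 \<Longrightarrow> real p \<le> ?P p h" "\<And>h. 0 < h \<Longrightarrow> h \<le> 1 \<Longrightarrow> 1 \<le> ?Q p h"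
    using Suc.IH by blast
  show ?case
  proof (rule exI[of _ "2 * \<bar>C\<bar> + \<bar>?a\<bar>"], intro allI impI)
    fix h :: real assume h: "0 < h \<and> h \<le> 1"
    have P: "?P (Suc p) h = ?P p h + ?Q p h" and Q: "?Q (Suc p) h = ?Q p h + h\<^sup>2 * ?P p h"
      using h by (simp_all add: field_simps power2_eq_square)
    define x where "x = ?P p h - (real p + ?a * h\<^sup>2)"
    define y where "y = ?Q p h - (1 + ?b * h\<^sup>2)"
    have h4: "0 \<le> h ^ 4" by simp
    have "C * h ^ 4 \<le> \<bar>C\<bar> * h ^ 4" by (intro mult_right_mono) auto
    then have xy: "\<bar>x\<bar> \<le> \<bar>C\<bar> * h ^ 4" "\<bar>y\<bar> \<le> \<bar>C\<bar> * h ^ 4"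
      using C(1)[of h] C(2)[of h] h unfolding x_def y_def by linarith+
    have "\<bar>?a\<bar> * h ^ 4 \<ge> 0" by simp
    have 1: "?P (Suc p) h - (real (Suc p) + real (Suc p) * (real (Suc p) - 1) * (real (Suc p) - 2) / 6 * h\<^sup>2) = x + y"
      unfolding P x_def y_def by (simp add: field_simps)
    have 2: "?Q (Suc p) h - (1 + real (Suc p) * (real (Suc p) - 1) / 2 * h\<^sup>2) = y + h\<^sup>2 * x + ?a * h ^ 4"
      unfolding Q x_def y_def by (simp add: field_simps power2_eq_square power4_eq_xxxx)
    have "\<bar>h\<^sup>2 * x\<bar> \<le> \<bar>x\<bar>"
      using h by (simp add: abs_mult mult_left_le_one_le power_le_one)
    moreover have "\<bar>?a * h ^ 4\<bar> = \<bar>?a\<bar> * h ^ 4" by (simp only: abs_mult abs_of_nonneg[OF h4])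
    ultimately have "\<bar>x + y\<bar> \<le> (2 * \<bar>C\<bar> + \<bar>?a\<bar>) * h ^ 4" "\<bar>y + h\<^sup>2 * x + ?a * h ^ 4\<bar> \<le> (2 * \<bar>C\<bar> + \<bar>?a\<bar>) * h ^ 4"
      using xy \<open>\<bar>?a\<bar> * h ^ 4 \<ge> 0\<close> unfolding distrib_right mult.assoc by linarith+
    moreover have "real (Suc p) \<le> ?P (Suc p) h"
      using C(3)[of h] C(4)[of h] h unfolding P of_nat_Suc by linarith
    moreover have "1 \<le> ?Q (Suc p) h"
      using C(3,4)[of h] h zero_le_mult_iff[of "h\<^sup>2" "?P p h"] unfolding Q by (smt (verit) of_nat_0_le_iff zero_le_power2)
    ultimately show "\<bar>?P (Suc p) h - (real (Suc p) + real (Suc p) * (real (Suc p) - 1) * (real (Suc p) - 2) / 6 * h\<^sup>2)\<bar> \<le> (2 * \<bar>C\<bar> + \<bar>?a\<bar>) * h ^ 4 \<and>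
      \<bar>?Q (Suc p) h - (1 + real (Suc p) * (real (Suc p) - 1) / 2 * h\<^sup>2)\<bar> \<le> (2 * \<bar>C\<bar> + \<bar>?a\<bar>) * h ^ 4 \<and>
      real (Suc p) \<le> ?P (Suc p) h \<and> 1 \<le> ?Q (Suc p) h"
      unfolding 1 2 by blast
  qed
qed

lemma power_mean_expansion:
  assumes "p > 0"
  shows "\<exists>C\<ge>0. \<forall>h. 0 < h \<and> h \<le> 1 \<longrightarrow>
    \<bar>power_mean p h - (1 + (real p - 1) * (real p - 2) / 6 * h\<^sup>2)\<bar> \<le> C * h ^ 4 \<and> 1 \<le> power_mean p h"
proof -
  obtain C where C: "\<And>h. 0 < h \<Longrightarrow> h \<le> 1 \<Longrightarrow>
      \<bar>((1 + h) ^ p - (1 - h) ^ p) / (2 * h) - (real p + real p * (real p - 1) * (real p - 2) / 6 * h\<^sup>2)\<bar> \<le> C * h ^ 4"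
    "\<And>h. 0 < h \<Longrightarrow> h \<le> 1 \<Longrightarrow> real p \<le> ((1 + h) ^ p - (1 - h) ^ p) / (2 * h)"
    using power_difference_expansion[of p] by blast
  show ?thesis
  proof (intro exI[of _ "\<bar>C\<bar> / real p"] conjI allI impI)
    fix h :: real assume h: "0 < h \<and> h \<le> 1"
    let ?X = "((1 + h) ^ p - (1 - h) ^ p) / (2 * h)"
    have X: "power_mean p h = ?X / real p" by (simp add: power_mean_def)
    have "\<bar>?X / real p - (1 + (real p - 1) * (real p - 2) / 6 * h\<^sup>2)\<bar>
        = \<bar>(?X - (real p + real p * (real p - 1) * (real p - 2) / 6 * h\<^sup>2)) / real p\<bar>"
      using assms by (intro arg_cong[where f = abs]) (simp add: diff_divide_distrib add_divide_distrib)
    also have "\<dots> = \<bar>?X - (real p + real p * (real p - 1) * (real p - 2) / 6 * h\<^sup>2)\<bar> / real p"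
      by simp
    also have "\<dots> \<le> C * h ^ 4 / real p"
      using C(1)[of h] h by (intro divide_right_mono) auto
    also have "\<dots> \<le> \<bar>C\<bar> / real p * h ^ 4"
      by (simp add: divide_right_mono mult_right_mono)
    finally show "\<bar>power_mean p h - (1 + (real p - 1) * (real p - 2) / 6 * h\<^sup>2)\<bar> \<le> \<bar>C\<bar> / real p * h ^ 4"
      unfolding X .
    show "1 \<le> power_mean p h"
      using C(2)[of h] h assms unfolding X by (simp add: le_divide_eq mult_ac)
  qed simp
qed

text \<open>The factor \<open>1 - power_mean (N + 1) h\<close> is already of order h^2, so replacing
  the quotient in front by 1 costs only order h^4. The h^2 terms are then N (N + 2 l - 1) / 6 and -N
  (N - 1) / 6, with sum N l / 3.\<close>

lemma truncated_cone_expansion: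
  assumes N: "N > 0"
  shows "\<exists>C\<ge>0. \<forall>h. 0 < h \<and> h \<le> 1 \<longrightarrow>
    real N / real (N + 2 * l) + real N * real l / 3 * h\<^sup>2 - C * h ^ 4 \<le>
    power_mean (N + 2 * l) h / power_mean N h * (1 - power_mean (N + 1) h)
      + real N / real (N + 2 * l) * power_mean (N + 2 * l + 1) h"
proof -
  let ?c = "\<lambda>p. (real p - 1) * (real p - 2) / 6"
  obtain C0 where C0: "C0 \<ge> 0" "\<And>h. 0 < h \<and> h \<le> 1 \<Longrightarrow> \<bar>power_mean N h - (1 + ?c N * h\<^sup>2)\<bar> \<le> C0 * h ^ 4 \<and> 1 \<le> power_mean N h"
    using power_mean_expansion[of N] N by blast
  obtain C1 where C1: "C1 \<ge> 0" "\<And>h. 0 < h \<and> h \<le> 1 \<Longrightarrow> \<bar>power_mean (N + 2 * l) h - (1 + ?c (N + 2 * l) * h\<^sup>2)\<bar> \<le> C1 * h ^ 4 \<and> 1 \<le> power_mean (N + 2 * l) h"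
    using power_mean_expansion[of "N + 2 * l"] N by (metis add_gr_0)
  obtain C2 where C2: "C2 \<ge> 0" "\<And>h. 0 < h \<and> h \<le> 1 \<Longrightarrow> \<bar>power_mean (N + 1) h - (1 + ?c (N + 1) * h\<^sup>2)\<bar> \<le> C2 * h ^ 4 \<and> 1 \<le> power_mean (N + 1) h"
    using power_mean_expansion[of "N + 1"] by (metis add_gr_0 zero_less_one)
  obtain C3 where C3: "C3 \<ge> 0" "\<And>h. 0 < h \<and> h \<le> 1 \<Longrightarrow> \<bar>power_mean (N + 2 * l + 1) h - (1 + ?c (N + 2 * l + 1) * h\<^sup>2)\<bar> \<le> C3 * h ^ 4 \<and> 1 \<le> power_mean (N + 2 * l + 1) h"
    using power_mean_expansion[of "N + 2 * l + 1"] by (metis add_gr_0 zero_less_one)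
  define r where "r = real N / real (N + 2 * l)"
  define A where "A = \<bar>?c (N + 2 * l)\<bar> + C1 + \<bar>?c N\<bar> + C0"
  define B where "B = \<bar>?c (N + 1)\<bar> + C2"
  have r: "r \<ge> 0" by (simp add: r_def)
  have AB: "A \<ge> 0" "B \<ge> 0" using C0 C1 C2 by (simp_all add: A_def B_def)
  show ?thesis
  proof (intro exI[of _ "C2 + r * C3 + A * B"] conjI allI impI)
    show "0 \<le> C2 + r * C3 + A * B" using C2(1) C3(1) r AB by simp
    fix h :: real assume h: "0 < h \<and> h \<le> 1"
    let ?m0 = "power_mean N h" and ?m1 = "power_mean (N + 2 * l) h"
      and ?m2 = "power_mean (N + 1) h" and ?m3 = "power_mean (N + 2 * l + 1) h"
    note E = C0(2)[OF h] C1(2)[OF h] C2(2)[OF h] C3(2)[OF h]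
    have h4: "0 \<le> h ^ 4" "h ^ 4 = h\<^sup>2 * h\<^sup>2" by simp (simp add: power2_eq_square power4_eq_xxxx)
    have h2: "0 \<le> h\<^sup>2" "h\<^sup>2 \<le> 1" using h by (auto intro: power_le_one)
    have h42: "h ^ 4 \<le> h\<^sup>2" using mult_right_mono[OF h2(2,1)] unfolding h4(2) by simp
    have small: "\<bar>m - 1\<bar> \<le> (\<bar>c\<bar> + K) * h\<^sup>2" if "\<bar>m - (1 + c * h\<^sup>2)\<bar> \<le> K * h ^ 4" "K \<ge> 0" for m c K
    proof -
      have "K * h ^ 4 \<le> K * h\<^sup>2" using h42 that(2) by (rule mult_left_mono)
      moreover have "\<bar>c * h\<^sup>2\<bar> = \<bar>c\<bar> * h\<^sup>2" by (simp add: abs_mult)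
      ultimately show ?thesis using that(1) unfolding distrib_right by linarith
    qed
    have m0: "\<bar>?m0 - 1\<bar> \<le> (\<bar>?c N\<bar> + C0) * h\<^sup>2" and m1: "\<bar>?m1 - 1\<bar> \<le> (\<bar>?c (N + 2 * l)\<bar> + C1) * h\<^sup>2"
      and m2: "\<bar>?m2 - 1\<bar> \<le> B * h\<^sup>2"
      using E C0(1) C1(1) C2(1) unfolding B_def by (intro small; simp)+
    have "\<bar>?m1 / ?m0 - 1\<bar> = \<bar>?m1 - ?m0\<bar> / ?m0"
    proof -
      have "?m0 > 0" using E(1) by linarith
      then show ?thesis by (simp add: field_simps)
    qed
    also have "\<dots> \<le> \<bar>?m1 - ?m0\<bar>"
      using E(1) by (simp add: divide_le_eq mult_left_le_one_le mult_le_cancel_left1)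
    also have "\<dots> \<le> A * h\<^sup>2"
      using m0 m1 unfolding A_def distrib_right by linarith
    finally have nu: "\<bar>?m1 / ?m0 - 1\<bar> \<le> A * h\<^sup>2" .
    have "\<bar>(?m1 / ?m0 - 1) * (1 - ?m2)\<bar> \<le> (A * h\<^sup>2) * (B * h\<^sup>2)"
      unfolding abs_mult using nu m2 AB h2 by (intro mult_mono) (auto simp: abs_minus_commute)
    then have "\<bar>(?m1 / ?m0 - 1) * (1 - ?m2)\<bar> \<le> A * B * h ^ 4"
      unfolding h4(2) by (simp only: mult_ac)
    moreover have "?m1 / ?m0 * (1 - ?m2) = (1 - ?m2) + (?m1 / ?m0 - 1) * (1 - ?m2)"
      by (simp add: algebra_simps)
    ultimately have l1: "?m1 / ?m0 * (1 - ?m2) \<ge> - (?c (N + 1) * h\<^sup>2) - C2 * h ^ 4 - A * B * h ^ 4"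
      using E(3) by linarith
    have "r * ?m3 \<ge> r * (1 + ?c (N + 2 * l + 1) * h\<^sup>2 - C3 * h ^ 4)"
      using E(4) r by (intro mult_left_mono) linarith
    moreover have "r * (1 + ?c (N + 2 * l + 1) * h\<^sup>2 - C3 * h ^ 4) = r + real N * (real (N + 2 * l) - 1) / 6 * h\<^sup>2 - r * C3 * h ^ 4"
    proof -
      define x where "x = real (N + 2 * l)"
      have rM: "r * x = real N" using N by (simp add: r_def x_def)
      have c: "?c (N + 2 * l + 1) = x * (x - 1) / 6" by (simp add: x_def)
      have "r * (1 + x * (x - 1) / 6 * h\<^sup>2 - C3 * h ^ 4) = r + (r * x) * (x - 1) / 6 * h\<^sup>2 - r * C3 * h ^ 4"
        by (simp add: field_simps)
      then show ?thesis unfolding c rM unfolding x_def .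
    qed
    moreover have "real N * (real (N + 2 * l) - 1) / 6 * h\<^sup>2 - ?c (N + 1) * h\<^sup>2 = real N * real l / 3 * h\<^sup>2"
      by (simp add: field_simps)
    ultimately have "r + real N * real l / 3 * h\<^sup>2 - (C2 + r * C3 + A * B) * h ^ 4 \<le> ?m1 / ?m0 * (1 - ?m2) + r * ?m3"
      using l1 unfolding distrib_right by linarith
    then show "real N / real (N + 2 * l) + real N * real l / 3 * h\<^sup>2 - (C2 + r * C3 + A * B) * h ^ 4 \<le>
      ?m1 / ?m0 * (1 - ?m2) + real N / real (N + 2 * l) * ?m3"
      by (simp only: r_def)
  qed
qed

section \<open>The eigenvalue bound\<close>

text \<open>The lower bound by the truncated cone, expressed by the ratio \<open>h\<close> of half the width of
  the slope to the mean radius \<open>\<kappa>\<close>.\<close>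

lemma eigenvalue_sum_truncated_cone:
  fixes \<Omega> :: "(real ^ 'n::finite) set"
  assumes \<Omega>: "open \<Omega>" "bounded \<Omega>" "\<Omega> \<noteq> {}" and l: "l \<ge> 1" and ev: "dirichlet_eigenvalues l \<Omega> lam"
  defines "N \<equiv> CARD('n)" and "V \<equiv> volume \<Omega>"
  assumes \<kappa>: "\<kappa> > 0" and k: "real k = unit_ball_vol (real N) * V / (2 * pi) ^ N * \<kappa> ^ N"
    and h: "h = V / (2 * sqrt (V * moment_of_inertia \<Omega>)) / (2 * \<kappa>)" "h < 1"
  shows "(\<Sum>j=1..k. lam j) \<ge> real k * \<kappa> ^ (2 * l) *
    (power_mean (N + 2 * l) h / power_mean N h * (1 - power_mean (N + 1) h)
      + real N / real (N + 2 * l) * power_mean (N + 2 * l + 1) h)"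
proof -
  have N: "N > 0" by (simp add: N_def)
  have V: "V > 0" unfolding V_def using \<Omega> by (rule volume_pos)
  have I: "moment_of_inertia \<Omega> > 0" using \<Omega> by (rule moment_of_inertia_pos)
  define L where "L = 2 * sqrt (V * moment_of_inertia \<Omega>)"
  have L: "L > 0" using V I by (simp add: L_def)
  have h0: "h > 0" using V L \<kappa> by (simp add: h L_def)
  \<comment> \<open>The slope is centred at radius \<open>\<kappa>\<close>; \<open>h\<close> is
    defined so that its width V / L equals 2 \<open>\<kappa>\<close> h.\<close>
  define s where "s = \<kappa> * (1 - h)"
  define T where "T = \<kappa> * (1 + h)"
  have VL: "V / L = 2 * \<kappa> * h" using \<kappa> by (simp add: h L_def)
  have sT: "0 < s" "s < T" "T = s + V / L"
    using \<kappa> h(2) h0 VL by (simp_all add: s_def T_def algebra_simps)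
  let ?M = "\<lambda>p. power_mean p h"
  have diff: "T ^ p - s ^ p = \<kappa> ^ p * (2 * h * real p * ?M p)" if "p > 0" for p
  proof -
    have "T ^ p - s ^ p = \<kappa> ^ p * ((1 + h) ^ p - (1 - h) ^ p)"
      unfolding T_def s_def power_mult_distrib by (rule right_diff_distrib[symmetric])
    also have "(1 + h) ^ p - (1 - h) ^ p = 2 * h * real p * ?M p"
      using h0 that by (simp add: power_mean_def)
    finally show ?thesis .
  qed
  have M0: "?M N > 0"
  proof -
    have "T ^ N - s ^ N > 0" using sT N by (simp add: power_strict_mono)
    then have "0 < (\<kappa> ^ N * (2 * h * real N)) * ?M N"
      unfolding diff[OF N] by (simp only: mult.assoc)
    moreover have "0 < \<kappa> ^ N * (2 * h * real N)" using \<kappa> h0 N by simp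
    ultimately show ?thesis by (rule zero_less_mult_pos)
  qed
  \<comment> \<open>The volume average of |x|^(2l) over the shell between the radii \<open>s\<close>
    and \<open>T\<close>.\<close>
  define \<mu> where "\<mu> = \<kappa> ^ (2 * l) * (?M (N + 2 * l) / ?M N)"
  define W where "W r = real N * r ^ (N + 2 * l) / real (N + 2 * l) - \<mu> * r ^ N" for r :: real
  define Z where "Z r = real N * r ^ (N + 2 * l + 1) / (real (N + 2 * l) * real (N + 2 * l + 1)) - \<mu> * r ^ (N + 1) / real (N + 1)" for r :: real
  have WT: "W T = W s"
  proof -
    have "W T - W s = real N / real (N + 2 * l) * (T ^ (N + 2 * l) - s ^ (N + 2 * l)) - \<mu> * (T ^ N - s ^ N)"
      by (simp add: W_def diff_divide_distrib right_diff_distrib)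
    also have "\<dots> = real N / real (N + 2 * l) * (\<kappa> ^ (N + 2 * l) * (2 * h * real (N + 2 * l) * ?M (N + 2 * l)))
        - \<mu> * (\<kappa> ^ N * (2 * h * real N * ?M N))"
      unfolding diff[OF N] diff[OF trans_less_add1[OF N]] ..
    also have "\<dots> = 0"
      using N M0 by (simp add: \<mu>_def power_add del: of_nat_add)
    finally show ?thesis by simp
  qed
  have dW: "(W has_real_derivative (r ^ (2 * l) - \<mu>) * (real N * r ^ (N - 1))) (at r)" for r
  proof -
    have "(W has_real_derivative real N * (real (N + 2 * l) * r ^ (N + 2 * l - Suc 0)) / real (N + 2 * l) - \<mu> * (real N * r ^ (N - Suc 0))) (at r)"
      unfolding W_def by (intro DERIV_diff DERIV_cdivide DERIV_cmult DERIV_pow)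
    moreover have "r ^ (N + 2 * l - Suc 0) = r ^ (2 * l) * r ^ (N - 1)"
      using N by (simp flip: power_add) (simp add: algebra_simps)
    ultimately show ?thesis using N by (simp add: algebra_simps del: of_nat_add)
  qed
  \<comment> \<open>Rolle's theorem for \<open>W\<close> produces the radius \<open>R\<close> at
    which the weight vanishes, as required for the comparison with the cone.\<close>
  have "\<exists>z>s. z < T \<and> (\<lambda>x. x * ((z ^ (2 * l) - \<mu>) * (real N * z ^ (N - 1)))) = (\<lambda>v. 0)"
  proof (rule Rolle_deriv[OF sT(2) WT[symmetric]])
    show "continuous_on {s..T} W" unfolding W_def by (intro continuous_intros) (use N in auto)
    show "(W has_derivative (\<lambda>x. x * ((r ^ (2 * l) - \<mu>) * (real N * r ^ (N - 1))))) (at r)" for r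
      by (rule has_derivative_eq_rhs[OF dW[of r, unfolded has_field_derivative_def]]) (rule ext, rule mult.commute)
  qed
  then obtain R where R: "s < R" "R < T" "(\<lambda>x. x * ((R ^ (2 * l) - \<mu>) * (real N * R ^ (N - 1)))) = (\<lambda>v. 0)" by blast
  have "(R ^ (2 * l) - \<mu>) * (real N * R ^ (N - 1)) = 0"
    using fun_cong[OF R(3), of 1] by simp
  then have \<mu>R: "\<mu> = R ^ (2 * l)"
    using N R(1) sT(1) by auto
  obtain v where v: "orthonormal_in (lebesgue_on \<Omega>) k v"
    and e: "\<And>j. j < k \<Longrightarrow> v j \<in> dirichlet_eigenspace l \<Omega> (lam (Suc j))"
    using orthonormal_eigenfunctions[OF \<Omega>(1,2) ev, of k] by blast
  let ?G = "spectral_density \<Omega> k v"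
  note G = \<Omega>(1,2) v
  have "unit_ball_vol (real N) * (L * (Z T - Z s))
     \<le> (LINT x|lborel. indicator (cball 0 T) x * ((norm x ^ (2 * l) - \<mu>) * ?G x))"
  proof -
    have D: "DIM(real ^ 'n) = N" by (simp add: N_def)
    have Lip: "\<bar>?G x - ?G y\<bar> \<le> L * norm (x - y)" for x y
      using spectral_density_Lipschitz[OF G V[unfolded V_def], of x y] by (simp add: L_def V_def)
    show ?thesis
      using truncated_cone_minimal[where G = ?G and V = V and L = L and s = s and R = R and T = T and \<mu> = \<mu> and l = l, unfolded D,
        OF spectral_density_nonneg[OF G] spectral_density_le[OF G, folded V_def] L Lip _ _ _ sT(3) \<mu>R]
        WT R sT(1) unfolding W_def Z_def by simp
  qed
  also have "\<dots> \<le> (2 * pi) ^ N * ((\<Sum>j=1..k. lam j) - \<mu> * real k)"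
    unfolding N_def
  proof (rule spectral_density_energy[OF G e])
    show "0 \<le> T" using sT by simp
    show "\<mu> \<le> T ^ (2 * l)" unfolding \<mu>R using R sT by (intro power_mono) auto
  qed
  finally have main: "unit_ball_vol (real N) * (L * (Z T - Z s)) \<le> (2 * pi) ^ N * ((\<Sum>j=1..k. lam j) - \<mu> * real k)" .
  have ZZ: "Z T - Z s = 2 * \<kappa> * h * \<kappa> ^ N * \<kappa> ^ (2 * l) *
      (real N / real (N + 2 * l) * ?M (N + 2 * l + 1) - ?M (N + 2 * l) / ?M N * ?M (N + 1))"
  proof -
    have "Z T - Z s = real N / (real (N + 2 * l) * real (N + 2 * l + 1)) * (T ^ (N + 2 * l + 1) - s ^ (N + 2 * l + 1))
        - \<mu> / real (N + 1) * (T ^ (N + 1) - s ^ (N + 1))"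
      by (simp add: Z_def diff_divide_distrib right_diff_distrib del: of_nat_add)
    also have "\<dots> = real N / (real (N + 2 * l) * real (N + 2 * l + 1)) * (\<kappa> ^ (N + 2 * l + 1) * (2 * h * real (N + 2 * l + 1) * ?M (N + 2 * l + 1)))
        - \<mu> / real (N + 1) * (\<kappa> ^ (N + 1) * (2 * h * real (N + 1) * ?M (N + 1)))"
      using diff[of "N + 2 * l + 1"] diff[of "N + 1"] by (simp del: of_nat_add power_Suc)
    also have "\<dots> = 2 * \<kappa> * h * \<kappa> ^ N * \<kappa> ^ (2 * l) *
      (real N / real (N + 2 * l) * ?M (N + 2 * l + 1) - ?M (N + 2 * l) / ?M N * ?M (N + 1))"
    proof -
      have c1: "a / (x * y) * (K * \<kappa> * (2 * h * y * m)) = 2 * \<kappa> * h * K * (a / x * m)"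
        if "x \<noteq> 0" "y \<noteq> 0" for a x y K m :: real
        using that by (simp add: field_simps)
      have c2: "a / y * (K * \<kappa> * (2 * h * y * m)) = 2 * \<kappa> * h * K * (a * m)" if "y \<noteq> 0" for a y K m :: real
        using that by (simp add: field_simps)
      have nz: "real (N + 2 * l) \<noteq> 0" "real (N + 2 * l + 1) \<noteq> 0" "real (N + 1) \<noteq> 0"
        using N by simp_all
      show ?thesis
        unfolding power_add[of \<kappa> _ 1] power_one_right c1[OF nz(1,2)] c2[OF nz(3)]
        by (simp only: \<mu>_def power_add right_diff_distrib mult_ac times_divide_eq_left times_divide_eq_right)
    qed
    finally show ?thesis .
  qed
  have LV: "L * (2 * \<kappa> * h) = V" using VL L by (simp add: field_simps)
  \<comment> \<open>The ball of radius \<open>\<kappa>\<close> filled to height V has the mass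
    required of the density of \<open>k\<close> eigenfunctions.\<close>
  have kk: "unit_ball_vol (real N) * V * \<kappa> ^ N = (2 * pi) ^ N * real k"
    using k by (simp add: field_simps)
  have "unit_ball_vol (real N) * (L * (Z T - Z s)) = (2 * pi) ^ N * (real k * \<kappa> ^ (2 * l) *
      (real N / real (N + 2 * l) * ?M (N + 2 * l + 1) - ?M (N + 2 * l) / ?M N * ?M (N + 1)))"
  proof -
    have "unit_ball_vol (real N) * (L * (Z T - Z s)) = (unit_ball_vol (real N) * (L * (2 * \<kappa> * h)) * \<kappa> ^ N) * (\<kappa> ^ (2 * l) *
      (real N / real (N + 2 * l) * ?M (N + 2 * l + 1) - ?M (N + 2 * l) / ?M N * ?M (N + 1)))"
      unfolding ZZ by (simp only: mult_ac)
    then show ?thesis unfolding LV kk by (simp only: mult_ac)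
  qed
  with main have "real k * \<kappa> ^ (2 * l) *
      (real N / real (N + 2 * l) * ?M (N + 2 * l + 1) - ?M (N + 2 * l) / ?M N * ?M (N + 1)) \<le> (\<Sum>j=1..k. lam j) - \<mu> * real k"
    by (simp del: of_nat_add)
  moreover have "\<mu> * real k = real k * \<kappa> ^ (2 * l) * (?M (N + 2 * l) / ?M N)"
    by (simp add: \<mu>_def)
  moreover have split: "K * (a * (1 - b) + c) = K * a + K * (c - a * b)" for K a b c :: real
    by (simp add: algebra_simps)
  ultimately show ?thesis unfolding split by linarith
qed

theorem theorem1:
  fixes \<Omega> :: "(real ^ 'n::finite) set" and l :: nat and lam :: "nat \<Rightarrow> real" and n :: real
  assumes "n = real CARD('n)" and "CARD('n) \<ge> 2" and "l \<ge> 1"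
    and "open \<Omega>" and "connected \<Omega>" and "\<Omega> \<noteq> {}" and "bounded \<Omega>"
    and "dirichlet_eigenvalues l \<Omega> lam"
  shows "\<exists>\<epsilon> :: nat \<Rightarrow> real.
    (\<forall>k\<ge>1. \<epsilon> k \<ge> 0) \<and>
    \<epsilon> \<in> O(\<lambda>k. real k powr (- 2 / n)) \<and>
    (\<forall>k\<ge>1.
      1 / real k * (\<Sum>j=1..k. lam j) \<ge>
        n / (n + 2 * real l) *
          ((2 * pi) ^ (2 * l) / (unit_ball_vol n * volume \<Omega>) powr (2 * real l / n)) *
          real k powr (2 * real l / n)
      + n * real l / 48 *
          ((2 * pi) ^ (2 * l - 2) / (unit_ball_vol n * volume \<Omega>) powr ((2 * real l - 2) / n)) *
          (volume \<Omega> / moment_of_inertia \<Omega>) *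
          real k powr ((2 * real l - 2) / n) * (1 - \<epsilon> k))"
proof -
  let ?N = "CARD('n)" and ?V = "volume \<Omega>" and ?I = "moment_of_inertia \<Omega>"
  let ?b = "unit_ball_vol n * ?V"
  note \<Omega> = \<open>open \<Omega>\<close> \<open>bounded \<Omega>\<close> \<open>\<Omega> \<noteq> {}\<close>
  have V: "?V > 0" and I: "?I > 0" using \<Omega> by (rule volume_pos, rule moment_of_inertia_pos)
  have N: "?N > 0" and n: "n > 0" and nN: "n = real ?N" using assms(1) by simp_all
  have b: "?b > 0" using V n by simp
  define \<kappa> where "\<kappa> k = 2 * pi * (real k / ?b) powr (1 / n)" for k :: nat
  \<comment> \<open>The width V / L of the slope, which does not depend on \<open>k\<close>.\<close>
  define \<delta> where "\<delta> = ?V / (2 * sqrt (?V * ?I))"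
  define X where "X k = n / (n + 2 * real l) * ((2 * pi) ^ (2 * l) / ?b powr (2 * real l / n)) * real k powr (2 * real l / n)" for k :: nat
  define A where "A k = n * real l / 48 * ((2 * pi) ^ (2 * l - 2) / ?b powr ((2 * real l - 2) / n)) * (?V / ?I) * real k powr ((2 * real l - 2) / n)" for k :: nat
  define a where "a k = 1 / real k * (\<Sum>j=1..k. lam j)" for k :: nat
  \<comment> \<open>The least nonnegative number for which the bound at \<open>k\<close> is true;
    the cone estimate is needed only for its rate of decay.\<close>
  define \<epsilon> where "\<epsilon> k = max 0 ((X k + A k - a k) / A k)" for k
  have \<delta>: "\<delta> > 0" using V I by (simp add: \<delta>_def)
  have \<delta>2: "\<delta>\<^sup>2 = ?V / (4 * ?I)"
    using V I by (simp add: \<delta>_def power_divide power_mult_distrib field_simps power2_eq_square)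
  have \<kappa>pos: "\<kappa> k > 0" if "k \<ge> 1" for k
  proof -
    have "real k / ?b > 0" using that b by (intro divide_pos_pos) auto
    then have "(real k / ?b) powr (1 / n) > 0" by (metis less_irrefl powr_gt_zero)
    then show ?thesis by (simp add: \<kappa>_def)
  qed
  have \<kappa>p: "\<kappa> k ^ p = (2 * pi) ^ p / ?b powr (real p / n) * real k powr (real p / n)" if "k \<ge> 1" for k p
  proof -
    have "((real k / ?b) powr (1 / n)) ^ p = (real k / ?b) powr (real p / n)"
    proof -
      have "real k / ?b > 0" using that b by (intro divide_pos_pos) auto
      then have "(real k / ?b) powr (1 / n) > 0" by (metis less_irrefl powr_gt_zero)
      then have "((real k / ?b) powr (1 / n)) ^ p = ((real k / ?b) powr (1 / n)) powr real p"
        by (rule powr_realpow[symmetric])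
      then show ?thesis by (simp add: powr_powr)
    qed
    also have "\<dots> = real k powr (real p / n) / ?b powr (real p / n)"
      by (rule powr_divide)
    finally show ?thesis by (simp add: \<kappa>_def power_mult_distrib)
  qed
  have kN: "real k = unit_ball_vol (real ?N) * ?V / (2 * pi) ^ ?N * \<kappa> k ^ ?N" if "k \<ge> 1" for k
  proof -
    have "unit_ball_vol (real ?N) \<noteq> 0" "?V \<noteq> 0" using b by (auto simp: nN)
    then show ?thesis using \<kappa>p[OF that, of ?N] that n b by (simp add: nN abs_of_pos)
  qed
  have Apos: "A k > 0" if "k \<ge> 1" for k
  proof -
    have "?b powr x > 0" "real k powr x > 0" for x
      using b that powr_gt_zero[of ?b x] powr_gt_zero[of "real k" x] by auto
    then show ?thesis
      unfolding A_def using n V I \<open>l \<ge> 1\<close>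
      by (intro mult_pos_pos divide_pos_pos zero_less_power) auto
  qed
  have Xk: "X k = n / (n + 2 * real l) * \<kappa> k ^ (2 * l)" if "k \<ge> 1" for k
    using \<kappa>p[OF that, of "2 * l"] by (simp add: X_def)
  have Ak: "A k = n * real l / 12 * \<delta>\<^sup>2 * \<kappa> k ^ (2 * l - 2)" if "k \<ge> 1" for k
  proof -
    have "real (2 * l - 2) = 2 * real l - 2" using \<open>l \<ge> 1\<close> by (simp add: of_nat_diff)
    then show ?thesis
      using \<kappa>p[OF that, of "2 * l - 2"] by (simp add: A_def \<delta>2 mult_ac)
  qed
  obtain C where C: "C \<ge> 0" "\<And>h. 0 < h \<Longrightarrow> h \<le> 1 \<Longrightarrow>
      real ?N / real (?N + 2 * l) + real ?N * real l / 3 * h\<^sup>2 - C * h ^ 4 \<le>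
      power_mean (?N + 2 * l) h / power_mean ?N h * (1 - power_mean (?N + 1) h)
      + real ?N / real (?N + 2 * l) * power_mean (?N + 2 * l + 1) h"
    using truncated_cone_expansion[OF N, of l] by blast
  \<comment> \<open>The quotient of the error C h^4 \<open>\<kappa>\<close>^(2l) by
    \<open>A k\<close> is K / \<open>\<kappa>\<close>^2: the 16 comes from h^4 with h =
    \<open>\<delta>\<close> / (2 \<open>\<kappa>\<close>), the 12 from the form of
    \<open>A k\<close> in terms of \<open>\<delta>\<close> and \<open>\<kappa>\<close>.\<close>
  define K where "K = C * \<delta>\<^sup>2 * 12 / (16 * n * real l)"
  have K: "K \<ge> 0" using C(1) n by (simp add: K_def)
  \<comment> \<open>The condition \<open>\<kappa> k > \<delta>\<close> ensures h < 1, so that the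
    slope stays away from the origin; it holds for all large \<open>k\<close>.\<close>
  have lower: "\<epsilon> k \<le> K / (\<kappa> k)\<^sup>2" if k: "k \<ge> 1" and big: "\<kappa> k > \<delta>" for k
  proof -
    define h where "h = \<delta> / (2 * \<kappa> k)"
    have h: "0 < h" "h < 1" "h \<le> 1"
      using \<kappa>pos[OF k] \<delta> big by (simp_all add: h_def divide_less_eq divide_le_eq)
    let ?B = "power_mean (?N + 2 * l) h / power_mean ?N h * (1 - power_mean (?N + 1) h)
      + real ?N / real (?N + 2 * l) * power_mean (?N + 2 * l + 1) h"
    have "(\<Sum>j=1..k. lam j) \<ge> real k * \<kappa> k ^ (2 * l) * ?B"
      by (rule eigenvalue_sum_truncated_cone[OF \<Omega> \<open>l \<ge> 1\<close> assms(8) \<kappa>pos[OF k] kN[OF k] _ h(2)])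
         (simp add: h_def \<delta>_def)
    then have "\<kappa> k ^ (2 * l) * ?B \<le> a k"
      using k by (simp add: a_def field_simps del: of_nat_add)
    moreover have "\<kappa> k ^ (2 * l) * (real ?N / real (?N + 2 * l) + real ?N * real l / 3 * h\<^sup>2 - C * h ^ 4) \<le> \<kappa> k ^ (2 * l) * ?B"
      using C(2)[OF h(1,3)] \<kappa>pos[OF k] by (intro mult_left_mono) auto
    moreover have "\<kappa> k ^ (2 * l) * (real ?N / real (?N + 2 * l) + real ?N * real l / 3 * h\<^sup>2 - C * h ^ 4)
        = X k + A k - A k * (K / (\<kappa> k)\<^sup>2)"
    proof -
      have pw: "\<kappa> k ^ (2 * l) = \<kappa> k ^ (2 * l - 2) * (\<kappa> k)\<^sup>2"
      proof -
        have "2 * l - 2 + 2 = 2 * l" using \<open>l \<ge> 1\<close> by simp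
        then show ?thesis using power_add[of "\<kappa> k" "2 * l - 2" 2] by (simp only:)
      qed
      have t2: "\<kappa> k ^ (2 * l) * (real ?N * real l / 3 * h\<^sup>2) = A k"
        using \<kappa>pos[OF k] unfolding Ak[OF k] pw by (simp add: h_def nN power_divide power_mult_distrib)
      have t3: "\<kappa> k ^ (2 * l) * (C * h ^ 4) = A k * (K / (\<kappa> k)\<^sup>2)"
        using \<kappa>pos[OF k] n \<open>l \<ge> 1\<close> unfolding Ak[OF k] pw K_def
        by (simp add: h_def power_divide power_mult_distrib power2_eq_square power4_eq_xxxx field_simps)
      have t1: "\<kappa> k ^ (2 * l) * (real ?N / real (?N + 2 * l)) = X k"
        unfolding Xk[OF k] by (simp add: nN)
      show ?thesis unfolding right_diff_distrib distrib_left t1 t2 t3 ..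
    qed
    ultimately have "X k + A k - a k \<le> K / (\<kappa> k)\<^sup>2 * A k" by (simp add: mult.commute)
    then have "(X k + A k - a k) / A k \<le> K / (\<kappa> k)\<^sup>2"
      using Apos[OF k] by (subst pos_divide_le_eq)
    then show ?thesis using K by (simp add: \<epsilon>_def)
  qed
  have \<kappa>2: "1 / (\<kappa> k)\<^sup>2 = ?b powr (2 / n) / (2 * pi)\<^sup>2 * real k powr (- 2 / n)" if "k \<ge> 1" for k
    using \<kappa>p[OF that, of 2] b that by (simp add: powr_minus field_simps)
  have "eventually (\<lambda>k. \<kappa> k > \<delta>) sequentially"
  proof -
    define c where "c = \<delta> / (2 * pi)"
    have c: "c > 0" using \<delta> by (simp add: c_def)
    have "eventually (\<lambda>k. real k > ?b * c powr n) sequentially"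
      using filterlim_real_sequentially unfolding filterlim_at_top_dense by blast
    then show ?thesis
    proof eventually_elim
      case (elim k)
      then have "c powr n < real k / ?b" using b by (simp only: pos_less_divide_eq mult.commute)
      then have "(c powr n) powr (1 / n) < (real k / ?b) powr (1 / n)"
        using n by (intro powr_less_mono2) auto
      then have "c < (real k / ?b) powr (1 / n)" using c n by (simp add: powr_powr)
      then show "\<kappa> k > \<delta>" by (simp add: \<kappa>_def c_def field_simps)
    qed
  qed
  then have ev: "eventually (\<lambda>k. norm (\<epsilon> k) \<le> (K * (?b powr (2 / n) / (2 * pi)\<^sup>2)) * norm (real k powr (- 2 / n))) sequentially"
    using eventually_ge_at_top[of 1]
  proof eventually_elim
    case (elim k)
    have "\<epsilon> k \<le> K * (1 / (\<kappa> k)\<^sup>2)" using lower[OF elim(2,1)] by simp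
    moreover have "\<epsilon> k \<ge> 0" by (simp add: \<epsilon>_def)
    ultimately show ?case unfolding \<kappa>2[OF elim(2)] by (simp add: mult_ac)
  qed
  have "X k + A k * (1 - \<epsilon> k) \<le> a k" if "k \<ge> 1" for k
  proof -
    have "(X k + A k - a k) / A k \<le> \<epsilon> k" by (simp add: \<epsilon>_def)
    then have "X k + A k - a k \<le> \<epsilon> k * A k"
      using Apos[OF that] by (subst (asm) pos_divide_le_eq)
    then show ?thesis by (simp add: algebra_simps)
  qed
  moreover have "\<epsilon> k \<ge> 0" for k by (simp add: \<epsilon>_def)
  moreover have "\<epsilon> \<in> O(\<lambda>k. real k powr (- 2 / n))" using ev by (rule bigoI)
  ultimately show ?thesis unfolding a_def X_def A_def by blast
qed

end
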